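(* Let $d\ge1$. Let $\lambda$ be an irreducible probability measure with finite exponential moment on $\mathrm{Sim}(\mathbb{R}^d)^+$ and let $\sigma$ be a $\lambda$-stationary probability measure on $\mathbb{R}^d$. For every $l\in\mathbb{N}$ there exist constants $C,c>0$ depending only on $\sigma$ and $l$ such that for every nonzero $P\in\mathcal{P}_{d,l}$ and every $\varepsilon>0$, $$\sigma\{\boldsymbol{s}\in\mathbb{R}^d:|P(\boldsymbol{s})|\le\varepsilon\|P\|\}\le C\varepsilon^c.$$
   Context: $\mathrm{Sim}(\mathbb{R}^d)^+$ is the group of orientation preserving similarities of $\mathbb{R}^d$, i.e. maps $\phi:\boldsymbol{s}\mapsto r_\phi O_\phi\boldsymbol{s}+b_\phi$ with $r_\phi>0$, $O_\phi\in \mathrm{SO}_d(\mathbb{R})$, $b_\phi\in\mathbb{R}^d$. $\lambda$ is irreducible if every (nonempty) affine subspace $E\subseteq\mathbb{R}^d$ with $\phi E=E$ for all $\phi\in\operatorname{supp}\lambda$ equals $\mathbb{R}^d$. $\lambda$ has finite exponential moment if $\int (r_\phi^{\varepsilon}+r_\phi^{-\varepsilon}+\|b_\phi\|^{\varepsilon})\,d\lambda(\phi)<\infty$ for some $\varepsilon>0$. $\sigma$ is $\lambda$-stationary if $\sigma=\int\phi_\star\sigma\,d\lambda(\phi)$. $\mathcal{P}_{d,l}$ is the vector space of real polynomial functions on $\mathbb{R}^d$ of degree at most $l$, and $\|P\|$ is the supremum norm of the coefficients of $P$. *)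

theory Defs
  imports "HOL-Probability.Probability"
begin

section \<open>Orientation preserving similarities\<close>

definition sim_map :: "real \<Rightarrow> real^'d^'d \<Rightarrow> real^'d \<Rightarrow> real^'d \<Rightarrow> real^'d" where
  "sim_map r Q b = (\<lambda>s. r *\<^sub>R (Q *v s) + b)"

definition sim_plus :: "(real^'d \<Rightarrow> real^'d) set" where
  "sim_plus = {sim_map r Q b | r Q b. 0 < r \<and> rotation_matrix Q}"

definition sim_ratio :: "(real^'d \<Rightarrow> real^'d) \<Rightarrow> real" where
  "sim_ratio \<phi> = (THE r. 0 < r \<and> (\<exists>Q b. rotation_matrix Q \<and> \<phi> = sim_map r Q b))"

definition sim_trans :: "(real^'d \<Rightarrow> real^'d) \<Rightarrow> real^'d" where
  "sim_trans \<phi> = (THE b. \<exists>r Q. 0 < r \<and> rotation_matrix Q \<and> \<phi> = sim_map r Q b)"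

lemma norm_sim_map_diff:
  assumes "0 < r" "rotation_matrix Q"
  shows "norm (sim_map r Q b s - sim_map r Q b t) = r * norm (s - t)"
proof -
  have "orthogonal_transformation (\<lambda>x. Q *v x)"
    using assms(2)
    by (simp add: rotation_matrix_def orthogonal_transformation_matrix)
  then have "norm (Q *v (s - t)) = norm (s - t)"
    by (rule orthogonal_transformation_norm)
  moreover have "sim_map r Q b s - sim_map r Q b t = r *\<^sub>R (Q *v (s - t))"
    by (simp add: sim_map_def matrix_vector_mult_diff_distrib scaleR_diff_right)
  ultimately show ?thesis
    using assms(1) by simp
qed

lemma sim_map_eq_iff:
  fixes Q Q' :: "real^'d::finite^'d"
  assumes "0 < r" "rotation_matrix Q" "0 < r'" "rotation_matrix Q'"
  shows "sim_map r Q b = sim_map r' Q' b' \<longleftrightarrow> r = r' \<and> Q = Q' \<and> b = b'"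
proof
  assume eq: "sim_map r Q b = sim_map r' Q' b'"
  have b: "b = b'"
    using fun_cong[OF eq, of 0] by (simp add: sim_map_def)
  define k :: 'd where "k = undefined"
  have r: "r = r'"
    using norm_sim_map_diff[OF assms(1,2), of b "axis k 1" 0]
      norm_sim_map_diff[OF assms(3,4), of b' "axis k 1" 0] eq
    by (simp add: norm_axis_1)
  have "Q *v s = Q' *v s" for s
    using fun_cong[OF eq, of s] b r assms(1) by (simp add: sim_map_def)
  then have "Q = Q'"
    by (simp add: matrix_eq)
  with b r show "r = r' \<and> Q = Q' \<and> b = b'" by simp
qed simp

lemma sim_ratio_sim_map [simp]:
  "0 < r \<Longrightarrow> rotation_matrix Q \<Longrightarrow> sim_ratio (sim_map r Q b) = r"
  unfolding sim_ratio_def by (rule the_equality) (auto simp: sim_map_eq_iff)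

lemma sim_trans_sim_map [simp]:
  "0 < r \<Longrightarrow> rotation_matrix Q \<Longrightarrow> sim_trans (sim_map r Q b) = b"
  unfolding sim_trans_def by (rule the_equality) (auto simp: sim_map_eq_iff)

text \<open>
  The set \<open>sim_plus\<close> carries the subspace topology of the product topology on functions, that is,
  the topology of pointwise convergence. By the next lemma this is the usual topology on
  \<open>(r, Q, b)\<close> in \<open>]0,\<infinity>[ \<times> SO\<^sub>d \<times> \<real>\<^sup>d\<close>, so the Borel measures on the group are the measures
  with the sigma-algebra of \<open>restrict_space borel sim_plus\<close>.
\<close>

lemma sim_plus_homeomorphism:
  fixes k :: "'d::finite"
  shows "homeomorphism ({0<..} \<times> {Q. rotation_matrix Q} \<times> UNIV) (sim_plus :: (real^'d \<Rightarrow> real^'d) set)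
     (\<lambda>(r, Q, b). sim_map r Q b)
     (\<lambda>\<phi>. (norm (\<phi> (axis k 1) - \<phi> 0),
       \<chi> i j. (\<phi> (axis j 1) - \<phi> 0) $ i / norm (\<phi> (axis k 1) - \<phi> 0), \<phi> 0))"
    (is "homeomorphism ?S _ ?f ?g")
proof -
  have inv: "?g (?f x) = x" if xS: "x \<in> ?S" for x
  proof -
    obtain r Q b where x: "x = (r, Q, b)" "0 < r" "rotation_matrix Q"
      using xS by auto
    have 1: "norm (sim_map r Q b (axis k 1) - sim_map r Q b 0) = r"
      using norm_sim_map_diff[OF x(2,3), of b "axis k 1" 0] by (simp add: norm_axis_1)
    have 2: "(sim_map r Q b (axis j 1) - sim_map r Q b 0) $ i = r * Q $ i $ j" for i j
      by (simp add: sim_map_def matrix_vector_mult_basis column_def)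
    show ?thesis
      unfolding x(1) prod.case 1 2 using x(2) by (simp add: sim_map_def vec_eq_iff)
  qed
  have im: "?f ` ?S = sim_plus"
    by (force simp: sim_plus_def)
  have ev: "continuous_on sim_plus (\<lambda>\<phi>. \<phi> s)" for s :: "real^'d"
    by (rule continuous_on_subset[OF continuous_on_product_coordinates subset_UNIV])
  have nz: "norm (\<phi> (axis k 1) - \<phi> 0) \<noteq> 0"
    if \<phi>: "\<phi> \<in> sim_plus" for \<phi> :: "real^'d \<Rightarrow> real^'d"
  proof -
    obtain r Q b where "0 < r" "rotation_matrix Q" "\<phi> = sim_map r Q b"
      using \<phi> by (auto simp: sim_plus_def)
    then show ?thesis
      using norm_sim_map_diff[of r Q b "axis k 1" 0] by (simp add: norm_axis_1)
  qed
  have "continuous_on ?S ?f"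
  proof (rule continuous_on_coordinatewise_then_product)
    fix s :: "real^'d"
    show "continuous_on ?S (\<lambda>x. ?f x s)"
      unfolding sim_map_def matrix_vector_mult_def case_prod_beta
      by (intro continuous_intros continuous_on_vec_lambda)
  qed
  moreover have "continuous_on sim_plus ?g"
    using nz by (intro continuous_intros continuous_on_vec_lambda ev ballI)
  moreover have "?f (?g \<phi>) = \<phi>" if \<phi>: "\<phi> \<in> sim_plus" for \<phi>
  proof -
    from \<phi> have "\<phi> \<in> ?f ` ?S" unfolding im .
    then obtain x where "x \<in> ?S" "\<phi> = ?f x" by (rule imageE)
    with inv[of x] show ?thesis by (simp only:)
  qed
  moreover have "?g ` sim_plus = ?S"
    unfolding im[symmetric] image_image using inv by (simp only: image_ident cong: image_cong)
  ultimately show ?thesis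
    unfolding homeomorphism_def using inv im by blast
qed

definition sim_prob_measure :: "(real^'d \<Rightarrow> real^'d) measure \<Rightarrow> bool" where
  "sim_prob_measure \<Lambda> \<longleftrightarrow> prob_space \<Lambda> \<and> sets \<Lambda> = sets (restrict_space borel sim_plus)"

definition sim_supp :: "(real^'d \<Rightarrow> real^'d) measure \<Rightarrow> (real^'d \<Rightarrow> real^'d) set" where
  "sim_supp \<Lambda> = {\<phi> \<in> sim_plus. \<forall>U. open U \<and> \<phi> \<in> U \<longrightarrow> 0 < emeasure \<Lambda> (U \<inter> sim_plus)}"

definition irreducible_sim :: "(real^'d \<Rightarrow> real^'d) measure \<Rightarrow> bool" where
  "irreducible_sim \<Lambda> \<longleftrightarrow>
     (\<forall>E. affine E \<and> E \<noteq> {} \<and> (\<forall>\<phi>\<in>sim_supp \<Lambda>. \<phi> ` E = E) \<longrightarrow> E = UNIV)"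

definition finite_exp_moment :: "(real^'d \<Rightarrow> real^'d) measure \<Rightarrow> bool" where
  "finite_exp_moment \<Lambda> \<longleftrightarrow> (\<exists>\<epsilon>>0.
     (\<integral>\<^sup>+\<phi>. ennreal (sim_ratio \<phi> powr \<epsilon> + sim_ratio \<phi> powr (-\<epsilon>) + norm (sim_trans \<phi>) powr \<epsilon>) \<partial>\<Lambda>) < \<infinity>)"

text \<open>The integrand below is the pushforward of \<open>\<sigma>\<close> under \<open>\<phi>\<close>, evaluated at \<open>A\<close>.\<close>

definition stationary :: "(real^'d \<Rightarrow> real^'d) measure \<Rightarrow> (real^'d) measure \<Rightarrow> bool" where
  "stationary \<Lambda> \<sigma> \<longleftrightarrow>
     (\<forall>A\<in>sets borel. emeasure \<sigma> A = (\<integral>\<^sup>+\<phi>. emeasure (distr \<sigma> borel \<phi>) A \<partial>\<Lambda>))"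

section \<open>Polynomial functions\<close>

text \<open>
  Polynomials are treated as functions on \<open>\<real>\<^sup>d\<close>; \<open>\<alpha>\<close> ranges over multi-indices. A polynomial
  function determines its coefficients (\<open>has_coeffs_unique\<close>), so \<open>poly_coeffs\<close> and
  \<open>poly_norm\<close> are meaningful for every \<open>P\<close> in \<open>poly_space l\<close>.
\<close>

definition has_coeffs :: "(real^'d::finite \<Rightarrow> real) \<Rightarrow> (('d \<Rightarrow> nat) \<Rightarrow> real) \<Rightarrow> bool" where
  "has_coeffs P c \<longleftrightarrow> finite {\<alpha>. c \<alpha> \<noteq> 0} \<and>
     P = (\<lambda>s. \<Sum>\<alpha> | c \<alpha> \<noteq> 0. c \<alpha> * (\<Prod>i\<in>UNIV. (s $ i) ^ \<alpha> i))"

definition poly_space :: "nat \<Rightarrow> (real^'d \<Rightarrow> real) set" where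
  "poly_space l = {P. \<exists>c. has_coeffs P c \<and> (\<forall>\<alpha>. c \<alpha> \<noteq> 0 \<longrightarrow> sum \<alpha> UNIV \<le> l)}"

definition poly_coeffs :: "(real^'d::finite \<Rightarrow> real) \<Rightarrow> ('d \<Rightarrow> nat) \<Rightarrow> real" where
  "poly_coeffs P = (THE c. has_coeffs P c)"

definition poly_norm :: "(real^'d \<Rightarrow> real) \<Rightarrow> real" where
  "poly_norm P = (SUP \<alpha>. \<bar>poly_coeffs P \<alpha>\<bar>)"

lemma monomials_independent:
  fixes c :: "('d \<Rightarrow> nat) \<Rightarrow> real"
  assumes "finite S" "finite A"
    and "\<And>\<alpha> \<beta>. \<alpha> \<in> A \<Longrightarrow> \<beta> \<in> A \<Longrightarrow> (\<forall>i\<in>S. \<alpha> i = \<beta> i) \<Longrightarrow> \<alpha> = \<beta>"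
    and "\<And>x. (\<Sum>\<alpha>\<in>A. c \<alpha> * (\<Prod>i\<in>S. x i ^ \<alpha> i)) = 0"
    and "\<gamma> \<in> A"
  shows "c \<gamma> = 0"
  using assms
proof (induction S arbitrary: A \<gamma> rule: finite_induct)
  case empty
  then have "A = {\<gamma>}" by auto
  with empty.prems(3)[of undefined] show ?case by simp
next
  case (insert j S)
  define B where "B k = {\<alpha> \<in> A. \<alpha> j = k}" for k
  define N where "N = Max ((\<lambda>\<alpha>. \<alpha> j) ` A)"
  have N: "\<alpha> j \<le> N" if "\<alpha> \<in> A" for \<alpha>
    unfolding N_def using that insert.prems(1) by auto
  have B0: "(\<Sum>\<alpha>\<in>B (\<gamma> j). c \<alpha> * (\<Prod>i\<in>S. x i ^ \<alpha> i)) = 0" for x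
  proof -
    define q where "q k = (\<Sum>\<alpha>\<in>B k. c \<alpha> * (\<Prod>i\<in>S. x i ^ \<alpha> i))" for k
    have "(\<Sum>k\<le>N. q k * t ^ k) = 0" for t
    proof -
      have pr: "(\<Prod>i\<in>S. (x(j := t)) i ^ \<alpha> i) = (\<Prod>i\<in>S. x i ^ \<alpha> i)" for \<alpha>
        using insert.hyps by (intro prod.cong) auto
      have "0 = (\<Sum>\<alpha>\<in>A. c \<alpha> * (\<Prod>i\<in>insert j S. (x(j := t)) i ^ \<alpha> i))"
        using insert.prems(3) by simp
      also have "\<dots> = (\<Sum>\<alpha>\<in>A. c \<alpha> * (\<Prod>i\<in>S. x i ^ \<alpha> i) * t ^ \<alpha> j)"
        unfolding prod.insert[OF insert.hyps] pr by (simp add: mult_ac)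
      also have "\<dots> = (\<Sum>k\<le>N. \<Sum>\<alpha>\<in>B k. c \<alpha> * (\<Prod>i\<in>S. x i ^ \<alpha> i) * t ^ \<alpha> j)"
        unfolding B_def using N insert.prems(1) by (intro sum.group[symmetric]) auto
      also have "\<dots> = (\<Sum>k\<le>N. q k * t ^ k)"
        unfolding q_def sum_distrib_right by (intro sum.cong) (auto simp: B_def)
      finally show ?thesis by simp
    qed
    then have "\<forall>k\<le>N. q k = 0"
      using polyfun_eq_0[of q N] by simp
    then show ?thesis
      using N insert.prems(4) by (simp add: q_def)
  qed
  show ?case
    by (rule insert.IH[of "B (\<gamma> j)"])
      (use insert.prems B0 in \<open>auto simp: B_def\<close>)
qed

lemma has_coeffs_unique:
  fixes P :: "real^'d::finite \<Rightarrow> real"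
  assumes "has_coeffs P c" "has_coeffs P c'"
  shows "c = c'"
proof
  fix \<gamma>
  define A where "A = insert \<gamma> ({\<alpha>. c \<alpha> \<noteq> 0} \<union> {\<alpha>. c' \<alpha> \<noteq> 0})"
  have fin: "finite A"
    using assms by (simp add: A_def has_coeffs_def)
  have P: "P s = (\<Sum>\<alpha>\<in>A. e \<alpha> * (\<Prod>i\<in>UNIV. (s $ i) ^ \<alpha> i))"
    if "has_coeffs P e" "{\<alpha>. e \<alpha> \<noteq> 0} \<subseteq> A" for e s
    using that fin unfolding has_coeffs_def
    by (auto intro!: sum.mono_neutral_left)
  have "(\<Sum>\<alpha>\<in>A. (c \<alpha> - c' \<alpha>) * (\<Prod>i\<in>UNIV. x i ^ \<alpha> i)) = 0" for x
  proof -
    have "{\<alpha>. c \<alpha> \<noteq> 0} \<subseteq> A" "{\<alpha>. c' \<alpha> \<noteq> 0} \<subseteq> A"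
      by (auto simp: A_def)
    from P[OF assms(1) this(1), of "\<chi> i. x i"] P[OF assms(2) this(2), of "\<chi> i. x i"]
    show ?thesis
      by (simp add: left_diff_distrib sum_subtractf)
  qed
  then have "c \<gamma> - c' \<gamma> = 0"
    using fin
    by (intro monomials_independent[where S = UNIV and A = A and c = "\<lambda>\<alpha>. c \<alpha> - c' \<alpha>"])
      (auto simp: A_def)
  then show "c \<gamma> = c' \<gamma>" by simp
qed

lemma poly_coeffs_eq: "has_coeffs P c \<Longrightarrow> poly_coeffs P = c"
  unfolding poly_coeffs_def by (rule the_equality) (auto dest: has_coeffs_unique)

end

theory Submission
  imports Defs
begin

text \<open>
  Why the estimate holds. Write \<open>r\<close> for the ratio of a random similarity \<open>\<phi>\<close>. The existence of a
  stationary probability measure forces contraction: \<open>E (ln r) < 0\<close> (\<open>negative_drift\<close>). To see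
  this, consider the largest mass \<open>g t\<close> that \<open>\<sigma>\<close> gives to a (smoothed) ball of radius \<open>exp t\<close>.
  Stationarity says \<open>g t \<le> E (g (t - ln r))\<close>. Since \<open>g\<close> is bounded and strictly increasing, a
  nonnegative drift would imply \<open>r = 1\<close> almost surely (\<open>bounded_subharmonic_increment_zero\<close>). Then
  the random similarities are isometries that permute the points where the largest mass is reached;
  these form a compact set, whose circumcentre would be a common fixed point, contradicting
  irreducibility (\<open>not_isometric\<close>). Contraction gives \<open>E (r powr s) < 1\<close> for all small \<open>s > 0\<close>, and
  power moments of \<open>\<sigma>\<close> (\<open>integrable_norm_powr\<close>).

  Next, affine functions. Proper affine subspaces are null sets (\<open>proper_affine_null\<close>): among the
  subspaces of minimal dimension with positive mass, those of maximal mass are finitely many and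
  are permuted by almost every \<open>\<phi>\<close>; a contraction among these has its fixed point in all of them,
  so their intersection is a proper nonempty invariant subspace. By compactness, thin strips around
  hyperplanes have uniformly small mass (\<open>strip_uniformly_small\<close>). To obtain a power of the width,
  let \<open>V\<close> be the supremum over all unit vectors \<open>u\<close> and all \<open>t\<close> of
  \<open>\<integral>(1 + norm x) powr s * (\<bar>u \<bullet> x - t\<bar> + w) powr (-c) d\<sigma>\<close>. Decomposing \<open>\<sigma>\<close> into the images of \<open>\<sigma>\<close>
  under a long product of random similarities gives \<open>V \<le> a + V / 2\<close> with \<open>a\<close> independent of \<open>w\<close>
  (\<open>strip_potential_step\<close>): pieces away from the hyperplane contribute to \<open>a\<close>, and the pieces close
  to it have small probability and reproduce \<open>V\<close>. Hence \<open>V \<le> 2 a\<close>, and \<open>strip_decay\<close> follows by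
  Markov's inequality.

  Finally, polynomials are treated by induction on the degree (\<open>poly_decay_normalized\<close>). If all
  nonconstant coefficients are tiny, the polynomial is small only far out, where the tail of \<open>\<sigma>\<close> is
  small. Otherwise some partial derivative has a coefficient that is not tiny, so by the induction
  hypothesis the gradient is at least a small power of \<open>\<epsilon>\<close> outside a set of power small mass. After
  a number of steps proportional to \<open>ln (1 / \<epsilon>)\<close>, the pieces of \<open>\<sigma>\<close> have a size between two powers
  of \<open>\<epsilon>\<close> (\<open>iter_law_ratio_concentrated\<close>). On such a piece the polynomial is close to its affine
  Taylor approximation, so its small values lie in a strip (\<open>taylor_decay\<close>).
\<close>

section \<open>Random similarities in coordinates\<close>

text \<open>
  A similarity \<open>s \<mapsto> r Q s + b\<close> is encoded by the triple \<open>(r, Q, b)\<close>. On this Euclidean space all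
  measurability questions reduce to continuity. Triples that do not define a similarity are
  allowed; the laws considered below give them probability zero.
\<close>

type_synonym 'd sim_param = "real \<times> (real^'d^'d) \<times> (real^'d)"

text \<open>
  The map with parameters \<open>z\<close>.
\<close>

definition sim_apply :: "'d sim_param \<Rightarrow> real^'d::finite \<Rightarrow> real^'d" where
  "sim_apply z = sim_map (fst z) (fst (snd z)) (snd (snd z))"

text \<open>
  The parameters of the composition of two similarities.
\<close>

definition sim_param_comp :: "'d sim_param \<Rightarrow> 'd sim_param \<Rightarrow> ('d::finite) sim_param" where
  "sim_param_comp z z' = (fst z * fst z', fst (snd z) ** fst (snd z'),
     fst z *\<^sub>R (fst (snd z) *v snd (snd z')) + snd (snd z))"

text \<open>
  The parameters define a similarity, possibly reversing the orientation: only the orthogonality of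
  the linear part matters below.
\<close>

definition proper_param :: "('d::finite) sim_param \<Rightarrow> bool" where
  "proper_param z \<longleftrightarrow> 0 < fst z \<and> orthogonal_matrix (fst (snd z))"

lemma continuous_sim_apply: "continuous_on UNIV (\<lambda>(z, y). sim_apply z y)"
  unfolding sim_apply_def sim_map_def matrix_vector_mult_def case_prod_beta
  by (intro continuous_intros continuous_on_vec_lambda)

lemma continuous_sim_apply_right: "continuous_on UNIV (sim_apply z)"
  unfolding sim_apply_def sim_map_def matrix_vector_mult_def case_prod_beta
  by (intro continuous_intros continuous_on_vec_lambda)

lemma continuous_sim_param_comp: "continuous_on UNIV (\<lambda>(z, z'). sim_param_comp z z')"
  unfolding sim_param_comp_def matrix_vector_mult_def matrix_matrix_mult_def case_prod_beta
  by (intro continuous_intros continuous_on_vec_lambda)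

lemma sim_apply_measurable [measurable]:
  "(\<lambda>(z, y). sim_apply z y) \<in> borel \<Otimes>\<^sub>M borel \<rightarrow>\<^sub>M borel"
  unfolding borel_prod by (rule borel_measurable_continuous_onI[OF continuous_sim_apply])

lemma sim_param_comp_measurable [measurable]:
  "(\<lambda>(z, z'). sim_param_comp z z') \<in> borel \<Otimes>\<^sub>M borel \<rightarrow>\<^sub>M borel"
  unfolding borel_prod by (rule borel_measurable_continuous_onI[OF continuous_sim_param_comp])

lemma fst_param_measurable [measurable]: "(fst :: ('d::finite) sim_param \<Rightarrow> real) \<in> borel \<rightarrow>\<^sub>M borel"
  by (intro borel_measurable_continuous_onI continuous_intros)

lemma snd_snd_param_measurable [measurable]:
  "(\<lambda>z :: ('d::finite) sim_param. snd (snd z)) \<in> borel \<rightarrow>\<^sub>M borel"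
  by (intro borel_measurable_continuous_onI continuous_intros)

lemma proper_param_measurable [measurable]:
    "Measurable.pred borel (proper_param :: ('d::finite) sim_param \<Rightarrow> bool)"
proof -
  have 1: "open {z :: 'd sim_param. 0 < fst z}"
    by (intro open_Collect_less continuous_intros)
  have c: "continuous_on UNIV (\<lambda>z::'d sim_param. transpose (fst (snd z)) ** fst (snd z))"
    unfolding transpose_def matrix_matrix_mult_def
    by (intro continuous_intros continuous_on_vec_lambda)
  have 2: "closed {z :: 'd sim_param. transpose (fst (snd z)) ** fst (snd z) = mat 1}"
    by (rule closed_Collect_eq[OF c]) (intro continuous_intros)
  have "Measurable.pred borel (\<lambda>z :: 'd sim_param. 0
      < fst z \<and> transpose (fst (snd z)) ** fst (snd z) = mat 1)"
    using 1 2 by (intro pred_intros_logic) (auto simp: pred_def intro: borel_open borel_closed)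
  then show ?thesis
    unfolding proper_param_def orthogonal_matrix by simp
qed

lemma sim_apply_comp: "sim_apply (sim_param_comp z z') y = sim_apply z (sim_apply z' y)"
  by (simp add: sim_apply_def sim_param_comp_def sim_map_def matrix_vector_mul_assoc
      matrix_vector_right_distrib scaleR_right_distrib matrix_vector_mult_scaleR)

lemma proper_param_comp: "proper_param z \<Longrightarrow> proper_param z' \<Longrightarrow> proper_param (sim_param_comp z z')"
  by (auto simp: proper_param_def sim_param_comp_def orthogonal_matrix_mul)

lemma sim_apply_diff: "sim_apply z x - sim_apply z y = fst z *\<^sub>R (fst (snd z) *v (x - y))"
  by (simp add: sim_apply_def sim_map_def matrix_vector_mult_diff_distrib scaleR_diff_right)

lemma norm_orthogonal_matrix: "orthogonal_matrix Q \<Longrightarrow> norm (Q *v x) = norm (x :: real^'d::finite)"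
  by (metis orthogonal_matrix orthogonal_transformation_matrix matrix_of_matrix_vector_mul
      matrix_vector_mul_linear orthogonal_transformation_norm)

lemma norm_sim_apply_diff:
  assumes "proper_param z"
  shows "norm (sim_apply z x - sim_apply z y) = fst z * norm (x - y)"
  using assms by (simp add: sim_apply_diff proper_param_def norm_orthogonal_matrix)

lemma norm_sim_apply_le:
  assumes "proper_param z"
  shows "norm (sim_apply z x) \<le> fst z * norm x + norm (snd (snd z))"
  using assms norm_triangle_ineq[of "fst z *\<^sub>R (fst (snd z) *v x)" "snd (snd z)"]
  by (simp add: sim_apply_def sim_map_def proper_param_def norm_orthogonal_matrix)

lemma bij_sim_apply:
  assumes "proper_param z" shows "bij (sim_apply z)"
proof (rule bijI)
  have r: "fst z > 0" and Q: "orthogonal_matrix (fst (snd z))" using assms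
    by (auto simp: proper_param_def)
  show "inj (sim_apply z)"
  proof (rule injI)
    fix x y assume "sim_apply z x = sim_apply z y"
    then show "x = y" using norm_sim_apply_diff[OF assms, of x y] r by simp
  qed
  show "surj (sim_apply z)"
  proof (rule surjI)
    fix x
    show "sim_apply z (transpose (fst (snd z)) *v ((1 / fst z) *\<^sub>R (x - snd (snd z)))) = x"
      using r Q unfolding sim_apply_def sim_map_def
      by (simp add: matrix_vector_mul_assoc orthogonal_matrix_def matrix_vector_mult_scaleR
          del: transpose_matrix_vector)
  qed
qed

text \<open>
  The law of a random similarity.
\<close>

locale random_similarity = prob_space \<mu> for \<mu> :: "('d::finite) sim_param measure" +
  assumes sets_mu [measurable_cong, simp]: "sets \<mu> = sets borel"
    and AE_proper: "AE z in \<mu>. proper_param z"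

lemma space_eq_UNIV: "sets M = sets borel \<Longrightarrow> space M = UNIV"
  using sets_eq_imp_space_eq[of M borel] by simp

lemma emeasure_vimage_sim_apply_measurable:
  fixes \<sigma> :: "(real^'d::finite) measure"
  assumes "prob_space \<sigma>" and [measurable_cong, simp]: "sets \<sigma> = sets borel"
      and [measurable]: "A \<in> sets borel"
  shows "(\<lambda>z. emeasure \<sigma> (sim_apply z -` A)) \<in> borel_measurable borel"
proof -
  interpret prob_space \<sigma> by fact
  have "(\<lambda>z. emeasure \<sigma> (Pair z -` ((\<lambda>(z, y). sim_apply z y) -` A \<inter> space (borel \<Otimes>\<^sub>M \<sigma>))))
      \<in> borel_measurable (borel :: 'd sim_param measure)"
    by (rule measurable_emeasure_Pair) measurable
  then show ?thesis by (simp add: space_pair_measure space_eq_UNIV vimage_def)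
qed

text \<open>
  A probability measure \<open>\<sigma>\<close> on the Euclidean space that is stationary under a random similarity.
\<close>

locale stationary_similarity = random_similarity \<mu> + sig: prob_space \<sigma>
  for \<mu> :: "('d::finite) sim_param measure" and \<sigma> :: "(real^'d) measure" +
  assumes sets_sigma [measurable_cong, simp]: "sets \<sigma> = sets borel"
    and stat: "\<And>A. A \<in> sets borel \<Longrightarrow> emeasure \<sigma> A = (\<integral>\<^sup>+z. emeasure \<sigma> (sim_apply z -` A) \<partial>\<mu>)"
begin

lemma space_mu [simp]: "space \<mu> = UNIV" and space_sigma [simp]: "space \<sigma> = UNIV"
  by (rule space_eq_UNIV[OF sets_mu], rule space_eq_UNIV[OF sets_sigma])

lemma prob_UNIV [simp]: "prob UNIV = 1" and sigma_prob_UNIV [simp]: "sig.prob UNIV = 1"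
  using prob_space sig.prob_space by simp_all

lemma sim_apply_measurable_right [measurable]: "sim_apply z \<in> borel \<rightarrow>\<^sub>M borel"
  by (rule borel_measurable_continuous_onI[OF continuous_sim_apply_right])

text \<open>
  Stationarity as an identity of measures: if \<open>z\<close> has law \<open>\<mu>\<close> and \<open>y\<close> has law \<open>\<sigma>\<close> independently,
  then \<open>sim_apply z y\<close> has law \<open>\<sigma>\<close>. This gives stationarity for integrals.
\<close>

lemma sigma_eq_distr: "\<sigma> = distr (\<mu> \<Otimes>\<^sub>M \<sigma>) borel (\<lambda>(z, y). sim_apply z y)"
proof (rule measure_eqI)
  fix A assume "A \<in> sets \<sigma>"
  then have A [measurable]: "A \<in> sets borel" by simp
  have "emeasure (distr (\<mu> \<Otimes>\<^sub>M \<sigma>) borel (\<lambda>(z, y). sim_apply z y)) A =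
     emeasure (\<mu> \<Otimes>\<^sub>M \<sigma>) ((\<lambda>(z, y). sim_apply z y) -` A \<inter> space (\<mu> \<Otimes>\<^sub>M \<sigma>))"
    by (rule emeasure_distr) measurable
  also have "\<dots> = (\<integral>\<^sup>+z. emeasure \<sigma> (Pair z -` ((\<lambda>(z, y). sim_apply z y) -` A \<inter> space (\<mu> \<Otimes>\<^sub>M \<sigma>)))
      \<partial>\<mu>)"
    by (rule sig.emeasure_pair_measure_alt) measurable
  also have "\<dots> = (\<integral>\<^sup>+z. emeasure \<sigma> (sim_apply z -` A) \<partial>\<mu>)"
    by (intro nn_integral_cong arg_cong[where f = "emeasure \<sigma>"]) (auto simp: space_pair_measure)
  finally show "emeasure \<sigma> A = emeasure (distr (\<mu> \<Otimes>\<^sub>M \<sigma>) borel (\<lambda>(z, y). sim_apply z y)) A"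
    using stat[OF A] by simp
qed simp

lemma nn_stationary:
  assumes [measurable]: "f \<in> borel_measurable borel"
  shows "(\<integral>\<^sup>+x. f x \<partial>\<sigma>) = (\<integral>\<^sup>+z. \<integral>\<^sup>+y. f (sim_apply z y) \<partial>\<sigma> \<partial>\<mu>)"
proof -
  have "(\<integral>\<^sup>+x. f x \<partial>\<sigma>) = (\<integral>\<^sup>+p. f ((\<lambda>(z, y). sim_apply z y) p) \<partial>(\<mu> \<Otimes>\<^sub>M \<sigma>))"
    by (subst sigma_eq_distr, rule nn_integral_distr) auto
  also have "\<dots> = (\<integral>\<^sup>+z. \<integral>\<^sup>+y. f (sim_apply z y) \<partial>\<sigma> \<partial>\<mu>)"
    by (subst sig.nn_integral_fst[symmetric]) auto
  finally show ?thesis .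
qed

end

text \<open>
  The law of the product of \<open>n\<close> independent random similarities.
\<close>

primrec iter_law :: "('d::finite) sim_param measure \<Rightarrow> nat \<Rightarrow> 'd sim_param measure" where
  "iter_law \<mu> 0 = return borel (1, mat 1, 0)"
| "iter_law \<mu> (Suc n) = distr (\<mu> \<Otimes>\<^sub>M iter_law \<mu> n) borel (\<lambda>(z, z'). sim_param_comp z z')"

lemma iter_law_random_similarity:
  assumes "random_similarity \<mu>"
  shows "random_similarity (iter_law \<mu> n)"
proof (induction n)
  case 0
  have "proper_param (1 :: real, mat 1 :: real^'a^'a, 0 :: real^'a)"
    by (simp add: proper_param_def orthogonal_matrix_id)
  then show ?case
    by (simp add: random_similarity_def random_similarity_axioms_def prob_space_return AE_return)
next
  case (Suc n)
  interpret random_similarity \<mu> by fact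
  interpret I: random_similarity "iter_law \<mu> n" by fact
  interpret P: pair_prob_space \<mu> "iter_law \<mu> n" ..
  have m [measurable]: "(\<lambda>(z, z'). sim_param_comp z z') \<in> \<mu> \<Otimes>\<^sub>M iter_law \<mu> n \<rightarrow>\<^sub>M borel"
    by measurable
  have mp: "Measurable.pred (\<mu> \<Otimes>\<^sub>M iter_law \<mu> n)
      (\<lambda>p. proper_param (case p of (z, z') \<Rightarrow> sim_param_comp z z'))"
    by (rule measurable_compose[OF m proper_param_measurable])
  have 1: "prob_space (iter_law \<mu> (Suc n))"
    by (simp add: P.prob_space_distr)
  have "AE z in \<mu>. AE z' in iter_law \<mu> n. proper_param (sim_param_comp z z')"
    using AE_proper
  proof eventually_elim
    case (elim z)
    show ?case using I.AE_proper by eventually_elim (use elim in \<open>simp add: proper_param_comp\<close>)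
  qed
  then have "AE p in \<mu> \<Otimes>\<^sub>M iter_law \<mu> n. proper_param (case p of (z, z') \<Rightarrow> sim_param_comp z z')"
    by (intro P.AE_pair_measure[OF predE[OF mp]]) simp
  then have "AE z in iter_law \<mu> (Suc n). proper_param z"
    unfolding iter_law.simps by (subst AE_distr_iff) auto
  moreover have "sets (iter_law \<mu> (Suc n)) = sets borel" by simp
  ultimately show ?case
    using 1 by (simp add: random_similarity_def random_similarity_axioms_def del: iter_law.simps)
qed

lemma iter_law_stationary:
  assumes "stationary_similarity \<mu> \<sigma>"
  shows "stationary_similarity (iter_law \<mu> n) \<sigma>"
proof (induction n)
  case 0
  interpret stationary_similarity \<mu> \<sigma> by fact
  interpret I: random_similarity "iter_law \<mu> 0"
    by (rule iter_law_random_similarity) unfold_locales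
  have id: "sim_apply (1, mat 1, 0) = (\<lambda>x :: real^'a. x)"
    by (auto simp: sim_apply_def sim_map_def fun_eq_iff)
  show ?case
  proof unfold_locales
    fix A :: "(real^'a) set" assume A [measurable]: "A \<in> sets borel"
    have m: "(\<lambda>z. emeasure \<sigma> (sim_apply z -` A)) \<in> borel_measurable borel"
      by (rule emeasure_vimage_sim_apply_measurable) (auto intro: sig.prob_space_axioms)
    show "emeasure \<sigma> A = (\<integral>\<^sup>+z. emeasure \<sigma> (sim_apply z -` A) \<partial>iter_law \<mu> 0)"
      by (simp add: nn_integral_return m id)
  qed simp
next
  case (Suc n)
  interpret stationary_similarity \<mu> \<sigma> by fact
  interpret J: stationary_similarity "iter_law \<mu> n" \<sigma> by fact
  interpret I: random_similarity "iter_law \<mu> (Suc n)"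
    by (rule iter_law_random_similarity) unfold_locales
  show ?case
  proof unfold_locales
    fix A :: "(real^'a) set" assume A [measurable]: "A \<in> sets borel"
    have m [measurable]: "(\<lambda>z. emeasure \<sigma> (sim_apply z -` A)) \<in> borel_measurable borel"
      by (rule emeasure_vimage_sim_apply_measurable) (auto intro: sig.prob_space_axioms)
    have "(\<integral>\<^sup>+z. emeasure \<sigma> (sim_apply z -` A) \<partial>iter_law \<mu> (Suc n)) =
       (\<integral>\<^sup>+p. emeasure \<sigma> (sim_apply ((\<lambda>(z, z'). sim_param_comp z z') p) -` A)
           \<partial>(\<mu> \<Otimes>\<^sub>M iter_law \<mu> n))"
      unfolding iter_law.simps by (rule nn_integral_distr) auto
    also have "\<dots> = (\<integral>\<^sup>+z. \<integral>\<^sup>+z'. emeasure \<sigma> (sim_apply (sim_param_comp z z') -` A) \<partial>iter_law \<mu> n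
        \<partial>\<mu>)"
      by (subst J.nn_integral_fst[symmetric]) auto
    also have "\<dots> = (\<integral>\<^sup>+z. emeasure \<sigma> (sim_apply z -` A) \<partial>\<mu>)"
    proof (rule nn_integral_cong)
      fix z
      have *: "sim_apply z -` A \<in> sets borel"
        using measurable_sets[OF sim_apply_measurable_right[of z] A] by simp
      have "sim_apply (sim_param_comp z z') -` A = sim_apply z' -` (sim_apply z -` A)" for z'
        by (auto simp: sim_apply_comp)
      then show "(\<integral>\<^sup>+z'. emeasure \<sigma> (sim_apply (sim_param_comp z z') -` A) \<partial>iter_law \<mu> n)
          = emeasure \<sigma> (sim_apply z -` A)"
        using J.stat[OF *] by simp
    qed
    finally show "emeasure \<sigma> A = (\<integral>\<^sup>+z. emeasure \<sigma> (sim_apply z -` A) \<partial>iter_law \<mu> (Suc n))"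
      using stat[OF A] by simp
  qed simp
qed

text \<open>
  Ratios are multiplicative, so their power moments are too.
\<close>

lemma iter_law_moment:
  assumes "random_similarity \<mu>"
  shows "(\<integral>\<^sup>+z. ennreal (fst z powr s) \<partial>iter_law \<mu> n) = (\<integral>\<^sup>+z. ennreal (fst z powr s) \<partial>\<mu>) ^ n"
proof (induction n)
  case 0
  show ?case by (simp add: nn_integral_return)
next
  case (Suc n)
  interpret random_similarity \<mu> by fact
  interpret I: random_similarity "iter_law \<mu> n" by (rule iter_law_random_similarity) fact
  have "(\<integral>\<^sup>+z. ennreal (fst z powr s) \<partial>iter_law \<mu> (Suc n)) =
     (\<integral>\<^sup>+p. ennreal (fst ((\<lambda>(z, z'). sim_param_comp z z') p) powr s) \<partial>(\<mu> \<Otimes>\<^sub>M iter_law \<mu> n))"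
    unfolding iter_law.simps by (rule nn_integral_distr) auto
  also have "\<dots> = (\<integral>\<^sup>+z. \<integral>\<^sup>+z'. ennreal (fst (sim_param_comp z z') powr s) \<partial>iter_law \<mu> n \<partial>\<mu>)"
    by (subst I.nn_integral_fst[symmetric]) auto
  also have "\<dots> = (\<integral>\<^sup>+z. ennreal (fst z powr s) * (\<integral>\<^sup>+z'. ennreal (fst z' powr s) \<partial>iter_law \<mu> n) \<partial>\<mu>)"
  proof (rule nn_integral_cong_AE)
    show "AE z in \<mu>. (\<integral>\<^sup>+z'. ennreal (fst (sim_param_comp z z') powr s) \<partial>iter_law \<mu> n) =
        ennreal (fst z powr s) * (\<integral>\<^sup>+z'. ennreal (fst z' powr s) \<partial>iter_law \<mu> n)"
      using AE_proper
    proof eventually_elim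
      case (elim z)
      have "(\<integral>\<^sup>+z'. ennreal (fst (sim_param_comp z z') powr s) \<partial>iter_law \<mu> n) =
         (\<integral>\<^sup>+z'. ennreal (fst z powr s) * ennreal (fst z' powr s) \<partial>iter_law \<mu> n)"
      proof (rule nn_integral_cong_AE)
        show "AE z' in iter_law \<mu> n. ennreal (fst (sim_param_comp z z') powr s)
            = ennreal (fst z powr s) * ennreal (fst z' powr s)"
          using I.AE_proper
          by eventually_elim (use elim in
              \<open>simp add: sim_param_comp_def proper_param_def powr_mult ennreal_mult'\<close>)
      qed
      also have "\<dots> = ennreal (fst z powr s) * (\<integral>\<^sup>+z'. ennreal (fst z' powr s) \<partial>iter_law \<mu> n)"
        by (rule nn_integral_cmult) simp
      finally show ?case .
    qed
  qed
  also have "\<dots> = (\<integral>\<^sup>+z. ennreal (fst z powr s) \<partial>\<mu>) ^ Suc n"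
    by (simp add: nn_integral_multc Suc.IH)
  finally show ?case .
qed

section \<open>Bounded subharmonic functions on the line\<close>

text \<open>
  The integral telescopes: for \<open>x \<ge> 0\<close> it is the integral of \<open>k\<close> over \<open>{T..T + x}\<close> minus the
  integral over \<open>{-T..-T + x}\<close>. As \<open>T\<close> tends to infinity, the bound tends to \<open>x\<close> times the total
  variation of \<open>k\<close> if \<open>K\<close> is the supremum of \<open>k\<close>.
\<close>

lemma mono_increment_integral_le:
  fixes k :: "real \<Rightarrow> real"
  assumes "mono k" and K: "\<And>t. k t \<le> K" and T: "0 \<le> T"
  shows "integral {-T..T} (\<lambda>t. k (t + x) - k t) \<le> x * (K - k (-T)) + \<bar>x\<bar> * (K - k (T - \<bar>x\<bar>))"
proof -
  have int: "k integrable_on {a..b}" for a b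
    by (rule integrable_on_mono_on) (use \<open>mono k\<close> in \<open>auto simp: mono_on_def mono_def\<close>)
  have int': "(\<lambda>t. k (t + x)) integrable_on {a..b}" for a b
    by (rule integrable_on_mono_on) (use \<open>mono k\<close> in \<open>auto simp: mono_on_def mono_def\<close>)
  have shift: "integral {-T..T} (\<lambda>t. k (t + x)) = integral {-T+x..T+x} k"
    using integral_shift_real_ivl[of "-T+x" x "T+x" k] by simp
  have w: "integral {-T..T} (\<lambda>t. k (t + x) - k t) = integral {-T+x..T+x} k - integral {-T..T} k"
    unfolding shift[symmetric] by (rule Henstock_Kurzweil_Integration.integral_diff[OF int' int])
  have ub: "integral {a..b} k \<le> (b - a) * c" if "a \<le> b" "\<And>t. t \<in> {a..b} \<Longrightarrow> k t \<le> c" for a b c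
    using integral_le[OF int integrable_const_ivl, of a b c] that by simp
  have lb: "(b - a) * c \<le> integral {a..b} k" if "a \<le> b" "\<And>t. t \<in> {a..b} \<Longrightarrow> c \<le> k t" for a b c
    using integral_le[OF integrable_const_ivl int, of a b c] that by simp
  show ?thesis
  proof (cases "0 \<le> x")
    case True
    have "integral {-T..T+x} k = integral {-T..T} k + integral {T..T+x} k"
      using True T by (intro Henstock_Kurzweil_Integration.integral_combine[symmetric] int) auto
    moreover have "integral {-T..T+x} k = integral {-T..-T+x} k + integral {-T+x..T+x} k"
      using True T by (intro Henstock_Kurzweil_Integration.integral_combine[symmetric] int) auto
    moreover have "integral {T..T+x} k \<le> x * K"
      using ub[of T "T+x" K] True K by simp
    moreover have "x * k (-T) \<le> integral {-T..-T+x} k"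
      using lb[of "-T" "-T+x" "k (-T)"] True \<open>mono k\<close> by (simp add: mono_def)
    moreover have "0 \<le> \<bar>x\<bar> * (K - k (T - \<bar>x\<bar>))"
      using K by simp
    ultimately show ?thesis unfolding w by (simp add: algebra_simps)
  next
    case False
    have "integral {-T+x..T} k = integral {-T+x..T+x} k + integral {T+x..T} k"
      using False T by (intro Henstock_Kurzweil_Integration.integral_combine[symmetric] int) auto
    moreover have "integral {-T+x..T} k = integral {-T+x..-T} k + integral {-T..T} k"
      using False T by (intro Henstock_Kurzweil_Integration.integral_combine[symmetric] int) auto
    moreover have "(-x) * k (T + x) \<le> integral {T+x..T} k"
      using lb[of "T+x" T "k (T+x)"] False \<open>mono k\<close> by (simp add: mono_def)
    moreover have "integral {-T+x..-T} k \<le> (-x) * k (-T)"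
      using ub[of "-T+x" "-T" "k (-T)"] False \<open>mono k\<close> by (simp add: mono_def)
    ultimately show ?thesis unfolding w using False by (simp add: algebra_simps)
  qed
qed

lemma integral_restrict_lborel_eq_HK:
  fixes f :: "real \<Rightarrow> real"
  assumes [measurable]: "f \<in> borel_measurable borel" and b: "\<And>t. \<bar>f t\<bar> \<le> B"
  shows "(\<integral>t. f t \<partial>restrict_space lborel {a..b}) = integral {a..b} f"
proof -
  have "set_integrable lborel {a..b} f"
    unfolding set_integrable_def
    by (rule integrableI_bounded_set_indicator[where B = B])
        (use b in \<open>auto simp: emeasure_lborel_Icc_eq\<close>)
  then show ?thesis
    by (simp add: integral_restrict_space set_borel_integral_eq_integral(2)[symmetric]
        set_lebesgue_integral_def)
qed

text \<open>
  A strictly increasing function with values in \<open>[0, 1]\<close> is not subharmonic for a random walk with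
  drift \<open>\<le> 0\<close>, unless the walk stands still. With \<open>k = g\<^sup>2\<close>, subharmonicity of \<open>g\<close> gives
  \<open>E (g (t + \<xi>) - g t)\<^sup>2 \<le> E (k (t + \<xi>)) - k t\<close>. The integral of the right-hand side over \<open>{-T..T}\<close>
  telescopes, and has a limit \<open>\<le> 0\<close> as \<open>T\<close> tends to infinity because the drift is \<open>\<le> 0\<close>.
\<close>

lemma (in prob_space) bounded_subharmonic_increment_zero:
  fixes g :: "real \<Rightarrow> real" and \<xi> :: "'a \<Rightarrow> real"
  assumes \<xi>: "integrable M \<xi>" and drift: "expectation \<xi> \<le> 0"
    and g: "strict_mono g" and g0: "\<And>t. 0 \<le> g t" and g1: "\<And>t. g t \<le> 1"
    and sub: "\<And>t. g t \<le> expectation (\<lambda>z. g (t + \<xi> z))"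
  shows "AE z in M. \<xi> z = 0"
proof -
  have \<xi>_meas [measurable]: "\<xi> \<in> borel_measurable M" using \<xi> by simp
  have g_mono: "mono g" using g by (rule strict_mono_mono)
  have [measurable]: "g \<in> borel_measurable borel"
    by (rule borel_measurable_mono[OF g_mono])
  define k where "k t = g t ^ 2" for t
  have k_meas [measurable]: "k \<in> borel_measurable borel"
    unfolding k_def by measurable
  have k_mono: "mono k"
    using g_mono g0 by (auto simp: k_def mono_def intro!: power_mono)
  have k0: "0 \<le> k t" and k1: "k t \<le> 1" for t
    using g0 g1 by (auto simp: k_def power_le_one)
  define K where "K = (SUP t. k t)"
  have bdd: "bdd_above (range k)" using k1 by (auto simp: bdd_above_def)
  have K: "k t \<le> K" for t unfolding K_def by (rule cSUP_upper[OF _ bdd]) simp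
  have K1: "K \<le> 1" unfolding K_def by (rule cSUP_least) (auto simp: k1)
  have lim: "(k \<longlongrightarrow> K) at_top"
  proof (rule order_tendstoI)
    fix a assume "a < K"
    then obtain t where "a < k t" unfolding K_def using less_cSUP_iff[OF _ bdd, of a] by auto
    then show "\<forall>\<^sub>F x in at_top. a < k x"
      using k_mono by (auto simp: eventually_at_top_linorder mono_def intro: less_le_trans)
  next
    fix a assume "K < a"
    then show "\<forall>\<^sub>F x in at_top. k x < a" using K le_less_trans by (intro always_eventually) blast
  qed
  define D where "D T x = integral {-T..T} (\<lambda>t. (g (t + x) - g t) ^ 2)" for T x :: real
  have Sint: "(\<lambda>t. (g (t + x) - g t) ^ 2) integrable_on {a..b}" for x a b
  proof -
    have i1: "(\<lambda>t. k (t + x)) integrable_on {a..b}" "k integrable_on {a..b}"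
      using k_mono by (auto intro!: integrable_on_mono_on simp: mono_on_def mono_def)
    have "set_integrable lborel {a..b} (\<lambda>t. (g (t + x) - g t) ^ 2)"
      unfolding set_integrable_def
    proof (rule integrableI_bounded_set_indicator[where B = 1])
      have "\<bar>g (t + x) - g t\<bar> \<le> 1" for t using g0[of t] g1[of t] g0[of "t+x"] g1[of "t+x"]
        by linarith
      then show "AE t\<in>{a..b} in lborel. norm ((g (t + x) - g t) ^ 2) \<le> 1"
        by (auto simp: power_le_one abs_square_le_1)
    qed (auto simp: emeasure_lborel_Icc_eq)
    then show ?thesis by (rule set_borel_integral_eq_integral(1))
  qed
  have D_mono: "D 1 x \<le> D T x" if "1 \<le> T" for T x
    unfolding D_def using that by (intro integral_subset_le Sint) auto
  have main: "integrable M (\<lambda>z. D T (\<xi> z)) \<and>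
    expectation (\<lambda>z. D T (\<xi> z))
        \<le> expectation (\<lambda>z. \<xi> z * (K - k (-T)) + \<bar>\<xi> z\<bar> * (K - k (T - \<bar>\<xi> z\<bar>)))"
    if T: "0 \<le> T" for T
  proof -
    define L where "L = restrict_space lborel {-T..T}"
    interpret L: finite_measure L
      unfolding L_def
      by (rule finite_measureI) (simp add: emeasure_restrict_space space_restrict_space T)
    interpret P: pair_sigma_finite M L ..
    interpret F: finite_measure "M \<Otimes>\<^sub>M L"
      by (rule finite_measure_pair_measure) unfold_locales
    have id: "(\<lambda>t. t) \<in> borel_measurable L" unfolding L_def
      by (rule measurable_restrict_space1) simp
    have [measurable]: "(\<lambda>p. snd p) \<in> borel_measurable (M \<Otimes>\<^sub>M L)"
      by (rule measurable_compose[OF measurable_snd id])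
    note id [measurable]
    have gb: "\<bar>g a\<bar> \<le> 1" "\<bar>k a\<bar> \<le> 1" for a using g0[of a] g1[of a] k0[of a] k1[of a] by auto
    define S where "S = (\<lambda>z t. (g (t + \<xi> z) - g t) ^ 2)"
    define W where "W = (\<lambda>z t. k (t + \<xi> z) - k t)"
    have Sb: "\<bar>g (t + x) - g t\<bar> \<le> 1" for t x using g0[of t] g1[of t] g0[of "t+x"] g1[of "t+x"]
      by linarith
    have intS: "integrable (M \<Otimes>\<^sub>M L) (case_prod S)"
    proof (rule F.integrable_const_bound[where B = 1])
      show "AE p in M \<Otimes>\<^sub>M L. norm (case_prod S p) \<le> 1"
        using Sb by (auto simp: S_def power_le_one abs_square_le_1)
    qed (simp add: S_def case_prod_beta)
    have intW: "integrable (M \<Otimes>\<^sub>M L) (case_prod W)"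
    proof (rule F.integrable_const_bound[where B = 1])
      have "\<bar>k (t + x) - k t\<bar> \<le> 1" for t x using k0[of t] k1[of t] k0[of "t+x"] k1[of "t+x"]
        by linarith
      then show "AE p in M \<Otimes>\<^sub>M L. norm (case_prod W p) \<le> 1" by (auto simp: W_def)
    qed (simp add: W_def case_prod_beta)
    have intWS: "integrable (M \<Otimes>\<^sub>M L) (case_prod (\<lambda>z t. W z t - S z t))"
      using Bochner_Integration.integrable_diff[OF intW intS] by (simp add: case_prod_beta')
    have eqS: "(\<integral>t. S z t \<partial>L) = D T (\<xi> z)" for z
      unfolding L_def S_def D_def
      by (rule integral_restrict_lborel_eq_HK[where B = 1]) (use Sb in \<open>auto simp: abs_square_le_1\<close>)
    have eqW: "(\<integral>t. W z t \<partial>L) = integral {-T..T} (\<lambda>t. k (t + \<xi> z) - k t)" for z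
      unfolding L_def W_def
    proof (rule integral_restrict_lborel_eq_HK[where B = 1])
      fix t show "\<bar>k (t + \<xi> z) - k t\<bar> \<le> 1"
        using k0[of t] k1[of t] k0[of "t+\<xi> z"] k1[of "t+\<xi> z"] by linarith
    qed simp
    have ig: "integrable M (\<lambda>z. g (t + \<xi> z))" for t
      by (rule integrable_const_bound[where B = 1]) (auto simp: gb)
    \<comment> \<open>W - S = 2 g(t) (g(t + \<xi>) - g(t)), whose expectation is nonnegative by subharmonicity\<close>
    have "0 \<le> (\<integral>t. (\<integral>z. W z t - S z t \<partial>M) \<partial>L)"
    proof (rule Bochner_Integration.integral_nonneg)
      fix t
      have "(\<integral>z. W z t - S z t \<partial>M) = (\<integral>z. 2 * g t * (g (t + \<xi> z) - g t) \<partial>M)"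
        by (intro Bochner_Integration.integral_cong)
            (auto simp: W_def S_def k_def power2_eq_square algebra_simps)
      also have "\<dots> = 2 * g t * (expectation (\<lambda>z. g (t + \<xi> z)) - g t)"
        using ig by (simp add: prob_space)
      finally show "0 \<le> (\<integral>z. W z t - S z t \<partial>M)"
        using sub[of t] g0[of t] by simp
    qed
    also have "\<dots> = (\<integral>z. (\<integral>t. W z t - S z t \<partial>L) \<partial>M)"
      by (rule P.Fubini_integral[OF intWS])
    also have "\<dots> = (\<integral>z. (\<integral>t. W z t \<partial>L) - (\<integral>t. S z t \<partial>L) \<partial>M)"
    proof (rule Bochner_Integration.integral_cong_AE)
      show "AE z in M. (\<integral>t. W z t - S z t \<partial>L) = (\<integral>t. W z t \<partial>L) - (\<integral>t. S z t \<partial>L)"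
        using P.AE_integrable_fst[OF intW] P.AE_integrable_fst[OF intS]
        by eventually_elim auto
      from P.integrable_fst[OF intWS] show "(\<lambda>z. \<integral>t. W z t - S z t \<partial>L) \<in> borel_measurable M"
        by (rule borel_measurable_integrable)
      show "(\<lambda>z. (\<integral>t. W z t \<partial>L) - (\<integral>t. S z t \<partial>L)) \<in> borel_measurable M"
        by (rule borel_measurable_integrable)
            (intro Bochner_Integration.integrable_diff P.integrable_fst intS intW)
    qed
    also have "\<dots> = (\<integral>z. (\<integral>t. W z t \<partial>L) \<partial>M) - (\<integral>z. D T (\<xi> z) \<partial>M)"
      using P.integrable_fst[OF intW] P.integrable_fst[OF intS] by (simp add: eqS)
    finally have 1: "(\<integral>z. D T (\<xi> z) \<partial>M) \<le> (\<integral>z. (\<integral>t. W z t \<partial>L) \<partial>M)" by simp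
    have [measurable]: "(\<lambda>z. k (T - \<bar>\<xi> z\<bar>)) \<in> borel_measurable M" by measurable
    have "(\<integral>z. (\<integral>t. W z t \<partial>L) \<partial>M)
        \<le> expectation (\<lambda>z. \<xi> z * (K - k (-T)) + \<bar>\<xi> z\<bar> * (K - k (T - \<bar>\<xi> z\<bar>)))"
    proof (rule Bochner_Integration.integral_mono)
      show "integrable M (\<lambda>z. \<integral>t. W z t \<partial>L)" by (rule P.integrable_fst[OF intW])
      show "integrable M (\<lambda>z. \<xi> z * (K - k (-T)) + \<bar>\<xi> z\<bar> * (K - k (T - \<bar>\<xi> z\<bar>)))"
      proof (rule Bochner_Integration.integrable_add)
        show "integrable M (\<lambda>z. \<bar>\<xi> z\<bar> * (K - k (T - \<bar>\<xi> z\<bar>)))"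
        proof (rule Bochner_Integration.integrable_bound[OF integrable_abs[OF \<xi>]])
          have "\<bar>K - k a\<bar> \<le> 1" for a using K[of a] K1 k0[of a] by linarith
          then show "AE z in M. norm (\<bar>\<xi> z\<bar> * (K - k (T - \<bar>\<xi> z\<bar>))) \<le> norm \<bar>\<xi> z\<bar>"
            by (auto simp: abs_mult intro!: mult_left_le)
        qed simp
      qed (use \<xi> in simp)
      show "(\<integral>t. W z t \<partial>L) \<le> \<xi> z * (K - k (-T)) + \<bar>\<xi> z\<bar> * (K - k (T - \<bar>\<xi> z\<bar>))" for z
        unfolding eqW by (rule mono_increment_integral_le[OF k_mono K T])
    qed
    moreover have "integrable M (\<lambda>z. D T (\<xi> z))"
      using P.integrable_fst[OF intS] by (simp add: eqS)
    ultimately show ?thesis using 1 by simp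
  qed
  have lim0: "(\<lambda>n. expectation (\<lambda>z. \<bar>\<xi> z\<bar> * (K - k (real n - \<bar>\<xi> z\<bar>)))) \<longlonglongrightarrow> expectation (\<lambda>z. 0)"
  proof (rule integral_dominated_convergence[where w = "\<lambda>z. \<bar>\<xi> z\<bar>"])
    show "AE z in M. (\<lambda>n. \<bar>\<xi> z\<bar> * (K - k (real n - \<bar>\<xi> z\<bar>))) \<longlonglongrightarrow> 0"
    proof (rule AE_I2)
      fix z
      have "filterlim (\<lambda>n. - \<bar>\<xi> z\<bar> + real n) at_top sequentially"
        by (rule filterlim_tendsto_add_at_top[OF tendsto_const filterlim_real_sequentially])
      then have "(\<lambda>n. k (real n - \<bar>\<xi> z\<bar>)) \<longlonglongrightarrow> K"
        using filterlim_compose[OF lim] by (simp add: algebra_simps)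
      then have "(\<lambda>n. \<bar>\<xi> z\<bar> * (K - k (real n - \<bar>\<xi> z\<bar>))) \<longlonglongrightarrow> \<bar>\<xi> z\<bar> * (K - K)"
        by (intro tendsto_intros)
      then show "(\<lambda>n. \<bar>\<xi> z\<bar> * (K - k (real n - \<bar>\<xi> z\<bar>))) \<longlonglongrightarrow> 0" by simp
    qed
    have "\<bar>K - k a\<bar> \<le> 1" for a using K[of a] K1 k0[of a] by linarith
    then show "AE z in M. norm (\<bar>\<xi> z\<bar> * (K - k (real n - \<bar>\<xi> z\<bar>))) \<le> \<bar>\<xi> z\<bar>" for n
      by (auto simp: abs_mult intro!: mult_left_le)
  qed (use \<xi> in auto)
  have D0: "0 \<le> D T x" for T x unfolding D_def
    by (intro Henstock_Kurzweil_Integration.integral_nonneg Sint) auto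
  have bound: "expectation (\<lambda>z. D 1 (\<xi> z)) \<le> expectation (\<lambda>z. \<bar>\<xi> z\<bar> * (K - k (real n - \<bar>\<xi> z\<bar>)))"
      if n: "1 \<le> n" for n
  proof -
    have T: "0 \<le> real n" "1 \<le> real n" using n by auto
    have b: "\<bar>K - k a\<bar> \<le> 1" for a using K[of a] K1 k0[of a] by linarith
    have i: "integrable M (\<lambda>z. \<bar>\<xi> z\<bar> * (K - k (real n - \<bar>\<xi> z\<bar>)))"
      by (rule Bochner_Integration.integrable_bound[OF integrable_abs[OF \<xi>]])
         (use b in \<open>auto simp: abs_mult intro!: mult_left_le\<close>)
    have "expectation (\<lambda>z. D 1 (\<xi> z)) \<le> expectation (\<lambda>z. D (real n) (\<xi> z))"
      using main[of 1] main[of "real n"] T D_mono by (intro Bochner_Integration.integral_mono) auto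
    also have "\<dots> \<le> expectation (\<lambda>z. \<xi> z * (K - k (-real n)) + \<bar>\<xi> z\<bar> * (K - k (real n - \<bar>\<xi> z\<bar>)))"
      using main[of "real n"] T by auto
    also have "\<dots> = expectation \<xi> * (K - k (-real n))
        + expectation (\<lambda>z. \<bar>\<xi> z\<bar> * (K - k (real n - \<bar>\<xi> z\<bar>)))"
      using i \<xi> by simp
    also have "\<dots> \<le> expectation (\<lambda>z. \<bar>\<xi> z\<bar> * (K - k (real n - \<bar>\<xi> z\<bar>)))"
      using drift K[of "- real n"] by (simp add: mult_nonpos_nonneg)
    finally show ?thesis .
  qed
  have "expectation (\<lambda>z. D 1 (\<xi> z)) \<le> 0"
    by (rule LIMSEQ_le_const[OF lim0[simplified]]) (use bound in blast)
  then have "expectation (\<lambda>z. D 1 (\<xi> z)) = 0"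
    using D0 by (intro antisym Bochner_Integration.integral_nonneg) auto
  then have "AE z in M. D 1 (\<xi> z) = 0"
    using main[of 1] D0 by (subst (asm) integral_nonneg_eq_0_iff_AE) auto
  then show ?thesis
  proof eventually_elim
    case (elim z)
    show "\<xi> z = 0"
    proof (rule ccontr)
      assume ne: "\<xi> z \<noteq> 0"
      let ?f = "\<lambda>t. (g (t + \<xi> z) - g t) ^ 2"
      have "AE t in restrict_space lborel {-1..1}. ?f t = 0"
      proof -
        have "set_integrable lborel {-1..1} ?f"
          unfolding set_integrable_def
        proof (rule integrableI_bounded_set_indicator[where B = 1])
          have "\<bar>g (t + \<xi> z) - g t\<bar> \<le> 1" for t
            using g0[of t] g1[of t] g0[of "t+\<xi> z"] g1[of "t+\<xi> z"] by linarith
          then show "AE t\<in>{-1..1} in lborel. norm (?f t) \<le> 1"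
            by (auto simp: power_le_one abs_square_le_1)
        qed (auto simp: emeasure_lborel_Icc_eq)
        then have i: "integrable (restrict_space lborel {-1..1}) ?f"
          by (simp add: integrable_restrict_space set_integrable_def)
        have "(\<integral>t. ?f t \<partial>restrict_space lborel {-1..1}) = D 1 (\<xi> z)"
          unfolding D_def
        proof (rule integral_restrict_lborel_eq_HK[where B = 1])
          fix t
          have "\<bar>g (t + \<xi> z) - g t\<bar> \<le> 1"
            using g0[of t] g1[of t] g0[of "t+\<xi> z"] g1[of "t+\<xi> z"] by linarith
          then show "\<bar>?f t\<bar> \<le> 1" by (auto simp: abs_square_le_1)
        qed simp
        then show ?thesis
          using elim integral_nonneg_eq_0_iff_AE[OF i] by simp
      qed
      moreover have "?f t \<noteq> 0" for t
        using g ne by (auto simp: strict_mono_eq)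
      ultimately have "AE t in restrict_space lborel {-1..1::real}. False" by simp
      then have "AE t in lborel. t \<notin> {-1..1::real}"
        by (subst (asm) AE_restrict_space_iff) auto
      then have "{-1..1::real} \<in> null_sets lborel"
        by (subst AE_iff_null_sets) auto
      then show False
        by (simp add: null_sets_def)
    qed
  qed
qed

section \<open>Negative drift\<close>

text \<open>
  The point is the circumcentre of \<open>K\<close>, which is unique by the parallelogram identity. The
  inclusion \<open>K \<subseteq> \<phi> ` K\<close> makes the image of the circumcentre another centre of a ball of minimal
  radius.
\<close>

lemma exists_isometry_fixed_center:
  fixes K :: "'a::euclidean_space set"
  assumes "compact K" "K \<noteq> {}"
  shows "\<exists>c. \<forall>\<phi>. (\<forall>x y. norm (\<phi> x - \<phi> y) = norm (x - y)) \<and> K \<subseteq> \<phi> ` K \<longrightarrow> \<phi> c = c"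
proof -
  define R where "R c = (SUP x\<in>K. dist c x)" for c
  have att: "\<exists>x\<in>K. \<forall>y\<in>K. dist c y \<le> dist c x" for c
    by (rule continuous_attains_sup[OF assms]) (intro continuous_intros)
  have R_le: "R c \<le> r \<longleftrightarrow> (\<forall>x\<in>K. dist c x \<le> r)" for c r
  proof -
    obtain x where "x \<in> K" "\<forall>y\<in>K. dist c y \<le> dist c x" using att by blast
    then have "bdd_above (dist c ` K)" by (auto simp: bdd_above_def)
    then show ?thesis unfolding R_def using assms(2) by (simp add: cSUP_le_iff)
  qed
  have R_ge: "dist c x \<le> R c" if "x \<in> K" for c x using R_le[of c "R c"] that by simp
  have R_att: "\<exists>x\<in>K. R c = dist c x" for c
    using att[of c] R_le[of c] R_ge by (meson antisym)
  have "R c \<le> R c' + dist c c'" for c c'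
    unfolding R_le using R_ge dist_triangle[of c _ c'] by (smt (verit))
  then have lip: "\<bar>R c - R c'\<bar> \<le> dist c c'" for c c'
    by (smt (verit) dist_commute)
  have cont: "continuous_on UNIV R"
    unfolding continuous_on_iff dist_real_def using lip by (meson le_less_trans)
  obtain x0 where x0: "x0 \<in> K" using assms(2) by blast
  obtain c where c: "c \<in> cball x0 (R x0)" "\<And>c'. c' \<in> cball x0 (R x0) \<Longrightarrow> R c \<le> R c'"
  proof -
    have "cball x0 (R x0) \<noteq> {}" using R_ge[OF x0, of x0] by simp
    then have "\<exists>c\<in>cball x0 (R x0). \<forall>c'\<in>cball x0 (R x0). R c \<le> R c'"
      by (intro continuous_attains_inf continuous_on_subset[OF cont]) auto
    then show ?thesis using that by blast
  qed
  have min: "R c \<le> R c'" for c'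
  proof (cases "c' \<in> cball x0 (R x0)")
    case False
    then have "R x0 < R c'" using R_ge[OF x0, of c'] by (simp add: dist_commute)
    then show ?thesis using c(2)[of x0] R_ge[OF x0, of x0] by simp
  qed (use c in auto)
  have uniq: "c' = c" if c': "R c' \<le> R c" for c'
  proof (rule ccontr)
    assume ne: "c' \<noteq> c"
    define m where "m = (1/2) *\<^sub>R (c + c')"
    obtain x where x: "x \<in> K" "R m = dist m x" using R_att by blast
    have "(dist m x)\<^sup>2 = ((dist c x)\<^sup>2 + (dist c' x)\<^sup>2) / 2 - (dist c c')\<^sup>2 / 4"
      unfolding m_def dist_norm power2_norm_eq_inner
      by (simp add: inner_diff_left inner_diff_right inner_add_left inner_add_right inner_commute
          field_simps)
    moreover have "(dist c x)\<^sup>2 \<le> (R c)\<^sup>2" "(dist c' x)\<^sup>2 \<le> (R c)\<^sup>2"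
      using R_ge[OF x(1)] c' by (auto intro!: power_mono intro: order_trans)
    moreover have "0 < (dist c c')\<^sup>2" using ne by simp
    moreover have "a < r" if "a = (b + c) / 2 - d / 4" "b \<le> r" "c \<le> r" "0 < d" for a b c d r :: real
      using that by argo
    ultimately have "(R m)\<^sup>2 < (R c)\<^sup>2" unfolding x(2) by blast
    then have "R m < R c"
      using R_ge[OF x(1), of c] zero_le_dist[of c x] by (smt (verit) power_less_imp_less_base)
    with min[of m] show False by simp
  qed
  have "\<phi> c = c" if iso: "\<And>x y. norm (\<phi> x - \<phi> y) = norm (x - y)" and K: "K \<subseteq> \<phi> ` K" for \<phi>
  proof (rule uniq)
    show "R (\<phi> c) \<le> R c"
      unfolding R_le
    proof
      fix x assume "x \<in> K"
      then obtain x' where "x' \<in> K" "x = \<phi> x'" using K by blast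
      then show "dist (\<phi> c) x \<le> R c" using iso R_ge by (simp add: dist_norm)
    qed
  qed
  then show ?thesis by blast
qed

lemma powr_le_linear_interpolation:
  fixes r s e :: real
  assumes "0 < r" "0 < s" "s \<le> e"
  shows "r powr s \<le> 1 + s / e * (r powr e - 1)"
proof -
  have "(r powr e) powr (s / e) * 1 powr (1 - s / e) \<le> s / e * (r powr e) + (1 - s / e) * 1"
    using assms by (intro Youngs_inequality_0) auto
  then show ?thesis using assms by (simp add: powr_powr algebra_simps)
qed

lemma powr_le_moment_sum:
  fixes r a e :: real
  assumes "0 < r" "\<bar>a\<bar> \<le> e"
  shows "r powr a \<le> r powr e + r powr (- e)"
proof (cases "1 \<le> r")
  case True
  then have "r powr a \<le> r powr e" using assms by (intro powr_mono) auto
  then show ?thesis by (simp add: add_increasing2)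
next
  case False
  then have "r powr a \<le> r powr (-e)" using assms by (intro powr_mono') auto
  then show ?thesis by (simp add: add_increasing)
qed

lemma abs_ln_le_powr:
  fixes r e :: real assumes "0 < r" "0 < e"
  shows "\<bar>ln r\<bar> \<le> (r powr e + r powr (-e)) / e"
proof -
  have "e * ln r \<le> r powr e" using ln_le_minus_one[of "r powr e"] assms by (simp add: ln_powr)
  moreover have "- e * ln r \<le> r powr (-e)" using ln_le_minus_one[of "r powr (-e)"] assms
    by (simp add: ln_powr)
  moreover have "0 \<le> r powr e" "0 \<le> r powr (-e)" by auto
  ultimately have "e * \<bar>ln r\<bar> \<le> r powr e + r powr (-e)"
    by (smt (verit) minus_mult_commute)
  then show ?thesis using assms by (simp add: field_simps)
qed

text \<open>
  Irreducibility refers to almost every similarity instead of all similarities in the support, and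
  to an inclusion instead of an equality; \<open>irreducible_stationary_distr\<close> derives this form from the
  original one.
\<close>

locale irreducible_stationary = stationary_similarity \<mu> \<sigma>
  for \<mu> :: "('d::finite) sim_param measure" and \<sigma> :: "(real^'d) measure" +
  assumes irreducible: "\<And>E. affine E \<Longrightarrow> E \<noteq> {} \<Longrightarrow> AE z in \<mu>. sim_apply z ` E \<subseteq> E \<Longrightarrow> E = UNIV"
    and moment: "\<exists>\<epsilon>>0. (\<integral>\<^sup>+z. ennreal (fst z powr \<epsilon> + fst z powr (-\<epsilon>) + norm (snd (snd z)) powr \<epsilon>)
        \<partial>\<mu>) < \<infinity>"

context stationary_similarity
begin

lemma integral_stationary:
  fixes f :: "real^'d \<Rightarrow> real"
  assumes [measurable]: "f \<in> borel_measurable borel" and b: "\<And>x. \<bar>f x\<bar> \<le> B"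
  shows "(\<integral>x. f x \<partial>\<sigma>) = (\<integral>z. (\<integral>y. f (sim_apply z y) \<partial>\<sigma>) \<partial>\<mu>)"
    and "integrable \<mu> (\<lambda>z. \<integral>y. f (sim_apply z y) \<partial>\<sigma>)"
proof -
  interpret P: pair_prob_space \<mu> \<sigma> ..
  have i: "integrable (\<mu> \<Otimes>\<^sub>M \<sigma>) (case_prod (\<lambda>z y. f (sim_apply z y)))"
    by (rule P.integrable_const_bound[where B = B]) (use b in \<open>auto simp: case_prod_beta\<close>)
  have "(\<integral>x. f x \<partial>\<sigma>) = (\<integral>p. f ((\<lambda>(z, y). sim_apply z y) p) \<partial>(\<mu> \<Otimes>\<^sub>M \<sigma>))"
    by (subst sigma_eq_distr, rule integral_distr) auto
  also have "\<dots> = (\<integral>p. (case_prod (\<lambda>z y. f (sim_apply z y))) p \<partial>(\<mu> \<Otimes>\<^sub>M \<sigma>))"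
    by (simp add: case_prod_beta)
  also have "\<dots> = (\<integral>z. (\<integral>y. f (sim_apply z y) \<partial>\<sigma>) \<partial>\<mu>)"
    by (rule P.integral_fst[OF i, symmetric])
  finally show "(\<integral>x. f x \<partial>\<sigma>) = (\<integral>z. (\<integral>y. f (sim_apply z y) \<partial>\<sigma>) \<partial>\<mu>)" .
  show "integrable \<mu> (\<lambda>z. \<integral>y. f (sim_apply z y) \<partial>\<sigma>)"
    using P.integrable_fst[OF i] by simp
qed

lemma measure_stationary:
  assumes [measurable]: "A \<in> sets borel"
  shows "measure \<sigma> A = expectation (\<lambda>z. measure \<sigma> (sim_apply z -` A))"
    and "integrable \<mu> (\<lambda>z. measure \<sigma> (sim_apply z -` A))"
proof -
  have m: "(indicator A :: _ \<Rightarrow> real) \<in> borel_measurable borel" by measurable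
  have b: "\<bar>indicator A x :: real\<bar> \<le> 1" for x by (simp split: split_indicator)
  have e: "(\<integral>y. indicator A (sim_apply z y) \<partial>\<sigma>) = measure \<sigma> (sim_apply z -` A)" for z
  proof -
    have "(\<lambda>y. indicator A (sim_apply z y) :: real) = indicator (sim_apply z -` A)"
      by (auto simp: indicator_def fun_eq_iff)
    then show ?thesis by simp
  qed
  show "measure \<sigma> A = expectation (\<lambda>z. measure \<sigma> (sim_apply z -` A))"
    using integral_stationary(1)[OF m b] by (simp add: e)
  show "integrable \<mu> (\<lambda>z. measure \<sigma> (sim_apply z -` A))"
    using integral_stationary(2)[OF m b] by (simp add: e)
qed

text \<open>
  A continuous substitute for the mass of the ball with centre \<open>x\<close> and radius \<open>exp t\<close>.
\<close>

definition smooth_mass :: "real^'d \<Rightarrow> real \<Rightarrow> real" where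
  "smooth_mass x t = (\<integral>y. exp (- (exp (-t) * norm (x - y))) \<partial>\<sigma>)"

lemma smooth_mass_integrable: "integrable \<sigma> (\<lambda>y. exp (- (exp (-t) * norm (x - y))))"
  by (rule sig.integrable_const_bound[where B = 1]) auto

lemma smooth_mass_pos: "0 < smooth_mass x t"
proof -
  have "(\<integral>y. 0 \<partial>\<sigma>) < smooth_mass x t"
    unfolding smooth_mass_def
    by (rule sig.integral_less_AE_space) (use smooth_mass_integrable sig.emeasure_space_1 in auto)
  then show ?thesis by simp
qed

lemma smooth_mass_le_1: "smooth_mass x t \<le> 1"
  unfolding smooth_mass_def by (rule sig.integral_le_const[OF smooth_mass_integrable]) auto

lemma smooth_mass_lipschitz: "\<bar>smooth_mass x t - smooth_mass x' t\<bar> \<le> exp (-t) * norm (x - x')"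
proof -
  have e: "\<bar>exp (-a) - exp (-b)\<bar> \<le> \<bar>a - b\<bar>" if "0 \<le> a" "0 \<le> b" for a b :: real
  proof -
    have *: "exp (-a) - exp (-b) \<le> b - a" if "0 \<le> a" "a \<le> b" for a b :: real
    proof -
      have "exp (-a) - exp (-b) = exp (-a) * (1 - exp (-(b - a)))"
        by (simp add: algebra_simps exp_add[symmetric])
      also have "\<dots> \<le> 1 * (b - a)"
        using exp_ge_add_one_self[of "a - b"] that by (intro mult_mono) (auto simp: algebra_simps)
      finally show ?thesis by simp
    qed
    show ?thesis using *[of a b] *[of b a] that by (cases "a \<le> b") (auto simp: abs_if)
  qed
  have "\<bar>smooth_mass x t - smooth_mass x' t\<bar> =
     \<bar>\<integral>y. exp (- (exp (-t) * norm (x - y))) - exp (- (exp (-t) * norm (x' - y))) \<partial>\<sigma>\<bar>"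
    unfolding smooth_mass_def using smooth_mass_integrable by simp
  also have "\<dots> \<le> (\<integral>y. \<bar>exp (- (exp (-t) * norm (x - y))) - exp (- (exp (-t) * norm (x' - y)))\<bar> \<partial>\<sigma>)"
    by (rule integral_abs_bound)
  also have "\<dots> \<le> exp (-t) * norm (x - x')"
  proof (rule sig.integral_le_const)
    have "\<bar>exp (- (exp (-t) * norm (x - y))) - exp (- (exp (-t) * norm (x' - y)))\<bar>
        \<le> exp (-t) * norm (x - x')" for y
    proof -
      have "\<bar>exp (- (exp (-t) * norm (x - y))) - exp (- (exp (-t) * norm (x' - y)))\<bar>
        \<le> \<bar>exp (-t) * norm (x - y) - exp (-t) * norm (x' - y)\<bar>" by (rule e) auto
      also have "\<dots> = exp (-t) * \<bar>norm (x - y) - norm (x' - y)\<bar>"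
        by (simp add: abs_mult right_diff_distrib[symmetric])
      also have "\<dots> \<le> exp (-t) * norm (x - x')"
        using norm_triangle_ineq3[of "x - y" "x' - y"] by simp
      finally show ?thesis .
    qed
    then show "AE y in \<sigma>. \<bar>exp (- (exp (-t) * norm (x - y))) - exp (- (exp (-t) * norm (x' - y)))\<bar>
        \<le> exp (-t) * norm (x - x')"
      by simp
  qed (intro integrable_abs Bochner_Integration.integrable_diff smooth_mass_integrable)
  finally show ?thesis .
qed

lemma smooth_mass_continuous: "continuous_on A (\<lambda>x. smooth_mass x t)"
proof (rule continuous_on_subset[OF _ subset_UNIV])
  have "(exp (-t))-lipschitz_on UNIV (\<lambda>x. smooth_mass x t)"
    using smooth_mass_lipschitz by (auto simp: lipschitz_on_def dist_norm)
  then show "continuous_on UNIV (\<lambda>x. smooth_mass x t)"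
    by (rule lipschitz_on_continuous_on)
qed

lemma exists_radius_small_tail:
  assumes "0 < \<delta>" shows "\<exists>R>0. measure \<sigma> {x. R < norm x} < \<delta>"
proof -
  have "(\<lambda>n. measure \<sigma> {x. real n < norm x}) \<longlonglongrightarrow> measure \<sigma> (\<Inter>n. {x. real n < norm x})"
    by (rule sig.finite_Lim_measure_decseq) (auto simp: decseq_def)
  also have "(\<Inter>n. {x :: real^'d. real n < norm x}) = {}"
  proof -
    have "\<exists>n. norm x \<le> real n" for x :: "real^'d" by (rule real_arch_simple)
    then have ex: "\<exists>n. \<not> real n < norm x" for x :: "real^'d" unfolding not_less .
    show ?thesis
    proof (rule equals0I)
      fix x :: "real^'d" assume "x \<in> (\<Inter>n. {x. real n < norm x})"
      then have "real n < norm x" for n by auto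
      with ex[of x] show False by simp
    qed
  qed
  finally have "(\<lambda>n. measure \<sigma> {x. real n < norm x}) \<longlonglongrightarrow> 0" by simp
  then have "eventually (\<lambda>n. measure \<sigma> {x. real n < norm x} < \<delta>) sequentially"
    using assms by (rule order_tendstoD)
  with eventually_gt_at_top[of 0] have
      "eventually (\<lambda>n. 0 < n \<and> measure \<sigma> {x. real n < norm x} < \<delta>) sequentially"
    by (rule eventually_conj)
  then obtain n where "0 < n" "measure \<sigma> {x. real n < norm x} < \<delta>"
    using eventually_happens'[OF sequentially_bot] by blast
  then show ?thesis by (intro exI[of _ "real n"]) auto
qed

lemma smooth_mass_vanishes:
  assumes "0 < \<delta>" shows "\<exists>R>0. \<forall>x. R < norm x \<longrightarrow> smooth_mass x t < \<delta>"
proof -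
  obtain R1 where R1: "R1 > 0" "measure \<sigma> {x. R1 < norm x} < \<delta> / 2"
    using exists_radius_small_tail[of "\<delta>/2"] assms by auto
  define R2 where "R2 = exp t * \<bar>ln (\<delta> / 2)\<bar>"
  have R2: "exp (- (exp (-t) * R2)) \<le> \<delta> / 2"
  proof -
    have "exp (-t) * R2 = \<bar>ln (\<delta> / 2)\<bar>"
      by (simp add: R2_def mult.assoc[symmetric] exp_add[symmetric])
    then have "exp (- (exp (-t) * R2)) \<le> exp (ln (\<delta> / 2))" by simp
    then show ?thesis using assms by simp
  qed
  have "smooth_mass x t < \<delta>" if x: "R1 + R2 < norm x" for x
  proof -
    have "smooth_mass x t \<le> (\<integral>y. indicator {x. R1 < norm x} y + \<delta> / 2 \<partial>\<sigma>)"
      unfolding smooth_mass_def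
    proof (rule Bochner_Integration.integral_mono[OF smooth_mass_integrable])
      show "integrable \<sigma> (\<lambda>y. indicator {x. R1 < norm x} y + \<delta> / 2)"
        by (rule sig.integrable_const_bound[where B = "1 + \<delta>/2"])
            (use assms in \<open>auto split: split_indicator\<close>)
      fix y
      show "exp (- (exp (-t) * norm (x - y))) \<le> indicator {x. R1 < norm x} y + \<delta> / 2"
      proof (cases "R1 < norm y")
        case True
        then show ?thesis using assms by (simp add: add_increasing2)
      next
        case False
        then have "R2 \<le> norm (x - y)" using x norm_triangle_ineq2[of x y] by linarith
        then have "exp (- (exp (-t) * norm (x - y))) \<le> exp (- (exp (-t) * R2))" by simp
        with R2 have "exp (- (exp (-t) * norm (x - y))) \<le> \<delta> / 2" by (rule order_trans[rotated])
          with False show ?thesis by simp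
      qed
    qed
    also have "\<dots> = measure \<sigma> {x. R1 < norm x} + \<delta> / 2"
      by (subst Bochner_Integration.integral_add)
          (auto simp: integrable_indicator_iff less_top[symmetric])
    finally show ?thesis using R1 by simp
  qed
  moreover have "0 \<le> R2" by (simp add: R2_def)
  ultimately show ?thesis using R1 by (intro exI[of _ "R1 + R2"]) auto
qed

lemma smooth_mass_attains: "\<exists>x. \<forall>x'. smooth_mass x' t \<le> smooth_mass x t"
proof -
  obtain R where R: "R > 0" "\<And>x. R < norm x \<Longrightarrow> smooth_mass x t < smooth_mass 0 t"
    using smooth_mass_vanishes[OF smooth_mass_pos[of 0 t], of t] by blast
  have "\<exists>x\<in>cball 0 R. \<forall>x'\<in>cball 0 R. smooth_mass x' t \<le> smooth_mass x t"
    by (intro continuous_attains_sup smooth_mass_continuous) (use R in auto)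
  then obtain x where x: "\<And>x'. norm x' \<le> R \<Longrightarrow> smooth_mass x' t \<le> smooth_mass x t"
    unfolding Bex_def Ball_def mem_cball_0 by blast
  have "smooth_mass x' t \<le> smooth_mass x t" for x'
    using x[of x'] R(2)[of x'] x[of 0] R(1) by (cases "norm x' \<le> R") auto
  then show ?thesis by blast
qed

lemma smooth_mass_argmax_compact: "compact {x. \<forall>x'. smooth_mass x' t \<le> smooth_mass x t}"
proof -
  obtain R where R: "R > 0" "\<And>x. R < norm x \<Longrightarrow> smooth_mass x t < smooth_mass 0 t"
    using smooth_mass_vanishes[OF smooth_mass_pos[of 0 t], of t] by blast
  have "bounded {x. \<forall>x'. smooth_mass x' t \<le> smooth_mass x t}"
    unfolding bounded_iff using R(2) by (force simp: not_less[symmetric])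
  moreover have "closed {x. \<forall>x'. smooth_mass x' t \<le> smooth_mass x t}"
    by (intro closed_Collect_all closed_Collect_le continuous_on_const smooth_mass_continuous)
  ultimately show ?thesis by (simp add: compact_eq_bounded_closed)
qed

text \<open>
  A similarity acts on balls; on the logarithmic scale the radius is translated by \<open>ln (fst z)\<close>.
\<close>

lemma smooth_mass_transport:
  assumes z: "proper_param z"
  shows "(\<integral>y. exp (- (exp (-t) * norm (sim_apply z x - sim_apply z y))) \<partial>\<sigma>)
      = smooth_mass x (t - ln (fst z))"
proof -
  have r: "0 < fst z" using z by (simp add: proper_param_def)
  then have "exp (-(t - ln (fst z))) = exp (-t) * fst z"
    by (simp add: exp_add[symmetric] exp_diff exp_minus field_simps)
  then show ?thesis
    unfolding smooth_mass_def norm_sim_apply_diff[OF z] by (simp add: mult.assoc)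
qed

text \<open>
  The maximum of the smoothed mass over all centres. It exists because the smoothed mass vanishes
  at infinity.
\<close>

definition max_mass :: "real \<Rightarrow> real" where
  "max_mass t = smooth_mass (SOME x. \<forall>x'. smooth_mass x' t \<le> smooth_mass x t) t"

lemma smooth_mass_le_max: "smooth_mass x t \<le> max_mass t"
  unfolding max_mass_def using someI_ex[OF smooth_mass_attains[of t]] by blast

lemma max_mass_attained: "\<exists>x. max_mass t = smooth_mass x t"
  unfolding max_mass_def by blast

end

context irreducible_stationary
begin

lemma not_dirac: "\<not> (AE y in \<sigma>. y = x)"
proof
  assume x: "AE y in \<sigma>. y = x"
  have m: "(\<lambda>y. indicator (-{x}) y :: ennreal) \<in> borel_measurable borel" by measurable
  have mm: "(\<lambda>z. \<integral>\<^sup>+y. indicator (-{x}) (sim_apply z y) \<partial>\<sigma>) \<in> borel_measurable \<mu>" by measurable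
  have "(\<integral>\<^sup>+y. indicator (-{x}) y \<partial>\<sigma>) = 0"
    using x by (subst nn_integral_0_iff_AE) (auto split: split_indicator)
  then have "AE z in \<mu>. (\<integral>\<^sup>+y. indicator (-{x}) (sim_apply z y) \<partial>\<sigma>) = 0"
    using nn_stationary[OF m] nn_integral_0_iff_AE[OF mm] by simp
  then have "AE z in \<mu>. sim_apply z ` {x} \<subseteq> {x}"
  proof eventually_elim
    case (elim z)
    have "AE y in \<sigma>. (indicator (-{x}) (sim_apply z y) :: ennreal) = 0"
      using elim by (subst (asm) nn_integral_0_iff_AE) auto
    with x have "AE y in \<sigma>. sim_apply z x = x"
      by eventually_elim (auto split: split_indicator_asm)
    then show ?case by simp
  qed
  then have "{x} = (UNIV :: (real^'d) set)" by (intro irreducible) auto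
  then have "x + axis undefined 1 \<in> {x}" by blast
  then show False by (simp add: axis_eq_0_iff)
qed

text \<open>
  Strictness needs that \<open>\<sigma>\<close> is not a Dirac measure.
\<close>

lemma max_mass_strict_mono: "strict_mono max_mass"
proof (rule strict_monoI)
  fix t t' :: real assume t: "t < t'"
  obtain x where x: "max_mass t = smooth_mass x t" using max_mass_attained by blast
  have "smooth_mass x t < smooth_mass x t'"
    unfolding smooth_mass_def
  proof (rule sig.integral_less_AE[OF smooth_mass_integrable smooth_mass_integrable, where A
      = "-{x}"])
    have "emeasure \<sigma> (-{x}) = 0 \<longleftrightarrow> (AE y in \<sigma>. y = x)"
      by (subst AE_iff_measurable[OF _ refl]) (auto simp: Compl_eq)
    then show "emeasure \<sigma> (- {x}) \<noteq> 0" using not_dirac by simp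
    show "AE y in \<sigma>. y \<in> - {x}
        \<longrightarrow> exp (- (exp (- t) * norm (x - y))) \<noteq> exp (- (exp (- t') * norm (x - y)))"
      using t by auto
    show "AE y in \<sigma>. exp (- (exp (- t) * norm (x - y))) \<le> exp (- (exp (- t') * norm (x - y)))"
      using t by (auto intro!: mult_right_mono)
  qed simp
  also have "\<dots> \<le> max_mass t'" by (rule smooth_mass_le_max)
  finally show "max_mass t < max_mass t'" using x by simp
qed

lemma mass_transport_le:
  assumes "proper_param z"
  shows "(\<integral>y. exp (- (exp (-t) * norm (x - sim_apply z y))) \<partial>\<sigma>) \<le> max_mass (t - ln (fst z))"
proof -
  obtain x' where "x = sim_apply z x'" using bij_sim_apply[OF assms] by (metis bij_pointE)
  then show ?thesis using smooth_mass_transport[OF assms] smooth_mass_le_max by simp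
qed

lemma max_mass_measurable [measurable]: "max_mass \<in> borel_measurable borel"
  by (rule borel_measurable_mono[OF strict_mono_mono[OF max_mass_strict_mono]])

lemma max_mass_bounds: "0 \<le> max_mass t" "max_mass t \<le> 1"
  using max_mass_attained[of t] smooth_mass_pos[of _ t] smooth_mass_le_1[of _ t]
    by (auto intro: less_imp_le)

lemma max_mass_subharmonic: "max_mass t \<le> expectation (\<lambda>z. max_mass (t + - ln (fst z)))"
proof -
  obtain x where x: "max_mass t = smooth_mass x t" using max_mass_attained by blast
  have m: "(\<lambda>y. exp (- (exp (-t) * norm (x - y)))) \<in> borel_measurable borel" by measurable
  have b: "\<And>y. \<bar>exp (- (exp (-t) * norm (x - y)))\<bar> \<le> 1" by simp
  have "max_mass t = (\<integral>z. (\<integral>y. exp (- (exp (-t) * norm (x - sim_apply z y))) \<partial>\<sigma>) \<partial>\<mu>)"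
    unfolding x smooth_mass_def by (rule integral_stationary(1)[OF m b])
  also have "\<dots> \<le> expectation (\<lambda>z. max_mass (t + - ln (fst z)))"
  proof (rule integral_mono_AE)
    show "integrable \<mu> (\<lambda>z. \<integral>y. exp (- (exp (-t) * norm (x - sim_apply z y))) \<partial>\<sigma>)"
      by (rule integral_stationary(2)[OF m b])
    show "integrable \<mu> (\<lambda>z. max_mass (t + - ln (fst z)))"
      by (rule integrable_const_bound[where B = 1]) (use max_mass_bounds in auto)
    show "AE z in \<mu>. (\<integral>y. exp (- (exp (-t) * norm (x - sim_apply z y))) \<partial>\<sigma>)
        \<le> max_mass (t + - ln (fst z))"
      using AE_proper by eventually_elim (use mass_transport_le in auto)
  qed
  finally show ?thesis .
qed

text \<open>
  The set of centres of maximal smoothed mass at a fixed scale is compact, and stationarity makes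
  it invariant under almost every isometry. Its circumcentre would be a common fixed point.
\<close>

lemma not_isometric: "\<not> (AE z in \<mu>. fst z = 1)"
proof
  assume one: "AE z in \<mu>. fst z = 1"
  define K where "K = {x. \<forall>x'. smooth_mass x' 0 \<le> smooth_mass x 0}"
  have K: "compact K" unfolding K_def by (rule smooth_mass_argmax_compact)
  have ne: "K \<noteq> {}" unfolding K_def using smooth_mass_attains by auto
  have K_iff: "x \<in> K \<longleftrightarrow> smooth_mass x 0 = max_mass 0" for x
  proof -
    obtain x0 where x0: "max_mass 0 = smooth_mass x0 0" using max_mass_attained by blast
    have "smooth_mass x' 0 \<le> max_mass 0" for x' by (rule smooth_mass_le_max)
    then show ?thesis unfolding K_def using x0 by (auto intro: antisym)
  qed
  have pt: "AE z in \<mu>. x \<in> sim_apply z ` K" if x: "x \<in> K" for x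
  proof -
    have m: "(\<lambda>y. exp (- (exp (-0) * norm (x - y)))) \<in> borel_measurable borel" by measurable
    have b: "\<And>y. \<bar>exp (- (exp (-0) * norm (x - y)))\<bar> \<le> 1" by simp
    let ?h = "\<lambda>z. \<integral>y. exp (- (exp (-0) * norm (x - sim_apply z y))) \<partial>\<sigma>"
    have ih: "integrable \<mu> ?h" by (rule integral_stationary(2)[OF m b])
    have eq: "max_mass 0 = expectation ?h"
      using x unfolding K_iff[symmetric] using integral_stationary(1)[OF m b] K_iff
        unfolding smooth_mass_def by simp
    have le: "AE z in \<mu>. ?h z \<le> max_mass 0"
      using AE_proper one by eventually_elim (use mass_transport_le[of _ 0 x] in force)
    have i2: "integrable \<mu> (\<lambda>z. max_mass 0 - ?h z)" using ih by simp
    have "expectation (\<lambda>z. max_mass 0 - ?h z) = 0"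
      using ih eq prob_space by simp
    moreover have "AE z in \<mu>. 0 \<le> max_mass 0 - ?h z" using le by eventually_elim simp
    ultimately have "AE z in \<mu>. max_mass 0 - ?h z = 0"
      using integral_nonneg_eq_0_iff_AE[OF i2] by simp
    with AE_proper one show ?thesis
    proof eventually_elim
      case (elim z)
      obtain x' where x': "x = sim_apply z x'" using bij_sim_apply[OF elim(1)] by (metis bij_pointE)
      have "smooth_mass x' 0 = max_mass 0"
        using smooth_mass_transport[OF elim(1), of 0 x'] elim x' by simp
      then show ?case using x' K_iff by blast
    qed
  qed
  \<comment> \<open>a countable dense subset serves to exchange the quantifiers over points and similarities\<close>
  obtain D where D: "countable D" "D \<subseteq> K" "K \<subseteq> closure D" using separable[of K] by blast
  have "AE z in \<mu>. \<forall>x\<in>D. x \<in> sim_apply z ` K"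
    using D pt by (subst AE_ball_countable) auto
  then have sub: "AE z in \<mu>. K \<subseteq> sim_apply z ` K"
  proof eventually_elim
    case (elim z)
    have "compact (sim_apply z ` K)"
      by (rule compact_continuous_image[OF
          continuous_on_subset[OF continuous_sim_apply_right subset_UNIV] K])
    then have "closure D \<subseteq> sim_apply z ` K"
      using elim by (intro closure_minimal) (auto simp: compact_imp_closed)
    with D show ?case by blast
  qed
  obtain c where c: "\<And>\<phi>. (\<forall>x y. norm (\<phi> x - \<phi> y) = norm (x - y)) \<Longrightarrow> K \<subseteq> \<phi> ` K \<Longrightarrow> \<phi> c = c"
    using exists_isometry_fixed_center[OF K ne] by blast
  have "AE z in \<mu>. sim_apply z ` {c} \<subseteq> {c}"
    using AE_proper one sub
  proof eventually_elim
    case (elim z)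
    have "sim_apply z c = c"
      by (rule c) (use elim norm_sim_apply_diff[OF elim(1)] in auto)
    then show ?case by simp
  qed
  then have "{c} = (UNIV :: (real^'d) set)" by (intro irreducible) auto
  then have "c + axis undefined 1 \<in> {c}" by blast
  then show False by (simp add: axis_eq_0_iff)
qed

text \<open>
  An exponent as in the moment condition.
\<close>

definition exponent :: real where
  "exponent = (SOME \<epsilon>. \<epsilon> > 0 \<and>
      (\<integral>\<^sup>+z. ennreal (fst z powr \<epsilon> + fst z powr (-\<epsilon>) + norm (snd (snd z)) powr \<epsilon>) \<partial>\<mu>) < \<infinity>)"

lemma exponent_pos: "0 < exponent"
  and exponent_moment: "(\<integral>\<^sup>+z. ennreal (fst z powr exponent + fst z powr (-exponent)
      + norm (snd (snd z)) powr exponent) \<partial>\<mu>) < \<infinity>"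
  using someI_ex[OF moment] unfolding exponent_def by auto

lemma integrable_moment_sum:
  "integrable \<mu> (\<lambda>z. fst z powr exponent + fst z powr (-exponent)
      + norm (snd (snd z)) powr exponent)"
  using exponent_moment by (intro integrableI_nonneg) auto

lemma integrable_ratio_powr:
  assumes "\<bar>a\<bar> \<le> exponent"
  shows "integrable \<mu> (\<lambda>z. fst z powr a)"
proof (rule Bochner_Integration.integrable_bound[OF integrable_moment_sum])
  show "AE z in \<mu>. norm (fst z powr a)
      \<le> norm (fst z powr exponent + fst z powr (-exponent) + norm (snd (snd z)) powr exponent)"
    using AE_proper
  proof eventually_elim
    case (elim z)
    then have "fst z powr a \<le> fst z powr exponent + fst z powr (-exponent)"
      using assms by (intro powr_le_moment_sum) (auto simp: proper_param_def)
    then show ?case by (simp add: add_increasing2)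
  qed
qed simp

lemma integrable_ln_ratio: "integrable \<mu> (\<lambda>z. ln (fst z))"
proof (rule Bochner_Integration.integrable_bound)
  show "integrable \<mu> (\<lambda>z. (fst z powr exponent + fst z powr (-exponent)) / exponent)"
    using integrable_ratio_powr[of exponent] integrable_ratio_powr[of "-exponent"] exponent_pos
      by simp
  show "AE z in \<mu>. norm (ln (fst z))
      \<le> norm ((fst z powr exponent + fst z powr (-exponent)) / exponent)"
    using AE_proper
  proof eventually_elim
    case (elim z)
    then have "\<bar>ln (fst z)\<bar> \<le> (fst z powr exponent + fst z powr (-exponent)) / exponent"
      using exponent_pos by (intro abs_ln_le_powr) (auto simp: proper_param_def)
    then show ?case using exponent_pos by simp
  qed
qed simp

lemma negative_drift: "expectation (\<lambda>z. ln (fst z)) < 0"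
proof (rule ccontr)
  assume "\<not> expectation (\<lambda>z. ln (fst z)) < 0"
  then have "AE z in \<mu>. - ln (fst z) = 0"
    using integrable_ln_ratio max_mass_bounds
    by (intro bounded_subharmonic_increment_zero[OF _ _ max_mass_strict_mono _ _
        max_mass_subharmonic]) auto
  with AE_proper have "AE z in \<mu>. fst z = 1"
    by eventually_elim (auto simp: proper_param_def)
  with not_isometric show False by simp
qed

text \<open>
  The derivative of \<open>s \<mapsto> E (r powr s)\<close> at \<open>0\<close> is the negative drift; smaller exponents follow from
  the concavity of powers with exponents at most \<open>1\<close>.
\<close>

lemma ratio_moment_less_1: "\<exists>s0>0. s0 \<le> exponent \<and> s0
    \<le> 1 \<and> (\<forall>s. 0 < s \<and> s \<le> s0 \<longrightarrow> expectation (\<lambda>z. fst z powr s) < 1)"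
proof -
  let ?u = "\<lambda>n z. (fst z powr (exponent / Suc n) - 1) / (exponent / Suc n)"
  let ?w = "\<lambda>z. \<bar>ln (fst z)\<bar> + (fst z powr exponent + 1) / exponent"
  have lim: "(\<lambda>n. expectation (?u n)) \<longlonglongrightarrow> expectation (\<lambda>z. ln (fst z))"
  proof (rule integral_dominated_convergence[where w = ?w])
    show "integrable \<mu> ?w"
      using integrable_ln_ratio integrable_ratio_powr[of exponent] exponent_pos by simp
    show "AE z in \<mu>. (\<lambda>n. ?u n z) \<longlonglongrightarrow> ln (fst z)"
      using AE_proper
    proof eventually_elim
      case (elim z)
      then have r: "0 < fst z" by (simp add: proper_param_def)
      have "((\<lambda>h. (fst z powr (0 + h) - fst z powr 0) / h) \<longlongrightarrow> ln (fst z)) (at 0)"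
      proof -
        have "((\<lambda>h. fst z powr h) has_real_derivative ln (fst z)) (at 0)"
          using r by (auto intro!: derivative_eq_intros)
        then show ?thesis by (simp add: DERIV_def)
      qed
      moreover have "filterlim (\<lambda>n. exponent / Suc n) (at 0) sequentially"
        unfolding filterlim_at
      proof
        show "\<forall>\<^sub>F n in sequentially. exponent / real (Suc n) \<in> UNIV \<and> exponent / real (Suc n) \<noteq> 0"
          using exponent_pos by auto
        show "(\<lambda>n. exponent / real (Suc n)) \<longlonglongrightarrow> 0"
          by (rule LIMSEQ_Suc[OF lim_const_over_n])
      qed
      ultimately have "(\<lambda>n. (fst z powr (0 + exponent / Suc n) - fst z powr 0) / (exponent / Suc n))
          \<longlonglongrightarrow> ln (fst z)"
        by (rule filterlim_compose)
      then show ?case using r by simp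
    qed
    fix n
    show "AE z in \<mu>. norm (?u n z) \<le> ?w z"
      using AE_proper
    proof eventually_elim
      case (elim z)
      then have r: "0 < fst z" by (simp add: proper_param_def)
      define s where "s = exponent / Suc n"
      have s: "0 < s" "s \<le> exponent" using exponent_pos by (auto simp: s_def field_simps)
      have lower: "ln (fst z) \<le> (fst z powr s - 1) / s"
        using ln_le_minus_one[of "fst z powr s"] r s by (simp add: ln_powr field_simps)
      have upper: "(fst z powr s - 1) / s \<le> (fst z powr exponent - 1) / exponent"
      proof -
        have "fst z powr s \<le> 1 + s / exponent * (fst z powr exponent - 1)"
          using powr_le_linear_interpolation[of "fst z" s exponent] r s by simp
        then show ?thesis using s exponent_pos by (simp add: field_simps)
      qed
      have "\<bar>(fst z powr s - 1) / s\<bar> \<le> \<bar>ln (fst z)\<bar> + (fst z powr exponent + 1) / exponent"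
      proof -
        have "(fst z powr exponent - 1) / exponent \<le> (fst z powr exponent + 1) / exponent"
          using exponent_pos by (intro divide_right_mono) auto
        moreover have "0 \<le> (fst z powr exponent + 1) / exponent" using exponent_pos by simp
        ultimately show ?thesis using lower upper by linarith
      qed
      then show ?case by (simp add: s_def)
    qed
  qed auto
  have "\<forall>\<^sub>F n in sequentially. expectation (?u n) < 0"
    by (rule order_tendstoD(2)[OF lim negative_drift])
  then obtain n0 where n0: "\<And>n. n0 \<le> n \<Longrightarrow> expectation (?u n) < 0"
    by (auto simp: eventually_sequentially)
  define s0 where "s0 = exponent / Suc (max n0 (nat \<lceil>exponent\<rceil>))"
  have s0: "0 < s0" "s0 \<le> exponent" using exponent_pos by (auto simp: s0_def field_simps)
  have "exponent \<le> real (nat \<lceil>exponent\<rceil>)" by linarith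
  then have "exponent \<le> real (Suc (max n0 (nat \<lceil>exponent\<rceil>)))"
    by (rule order_trans) simp
  then have s01: "s0 \<le> 1" unfolding s0_def by simp
  have i0: "integrable \<mu> (\<lambda>z. fst z powr s0)"
    by (rule integrable_ratio_powr) (use s0 in auto)
  have "expectation (\<lambda>z. (fst z powr s0 - 1) / s0) < 0"
    using n0[of "max n0 (nat \<lceil>exponent\<rceil>)"] by (simp add: s0_def)
  then have e0: "expectation (\<lambda>z. fst z powr s0) < 1"
    using i0 s0 by (simp add: prob_space divide_less_0_iff)
  have "expectation (\<lambda>z. fst z powr s) < 1" if s: "0 < s" "s \<le> s0" for s
  proof -
    have "expectation (\<lambda>z. fst z powr s) \<le> expectation (\<lambda>z. 1 + s / s0 * (fst z powr s0 - 1))"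
    proof (rule integral_mono_AE)
      show "integrable \<mu> (\<lambda>z. fst z powr s)" by (rule integrable_ratio_powr) (use s s0 in auto)
      show "AE z in \<mu>. fst z powr s \<le> 1 + s / s0 * (fst z powr s0 - 1)"
        using AE_proper by eventually_elim
            (rule powr_le_linear_interpolation, use s in \<open>auto simp: proper_param_def\<close>)
    qed (use i0 in simp)
    also have "\<dots> = 1 + s / s0 * (expectation (\<lambda>z. fst z powr s0) - 1)"
      using i0 by (simp add: prob_space)
    also have "\<dots> < 1"
      using mult_pos_neg[of "s / s0" "expectation (\<lambda>z. fst z powr s0) - 1"] e0 s s0 by simp
    finally show ?thesis .
  qed
  then show ?thesis using s0 s01 by blast
qed

end

section \<open>Moments and mass of affine subspaces\<close>

lemma powr_add_le_add_powr:
  fixes a b s :: real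
  assumes "0 \<le> a" "0 \<le> b" "0 < s" "s \<le> 1"
  shows "(a + b) powr s \<le> a powr s + b powr s"
proof (cases "a + b = 0")
  case False
  then have ab: "0 < a + b" using assms by linarith
  have *: "c / (a + b) \<le> (c / (a + b)) powr s" if "0 \<le> c" "c \<le> a + b" for c
  proof -
    have "(c / (a + b)) powr 1 \<le> (c / (a + b)) powr s"
      using that ab assms by (intro powr_mono') auto
    then show ?thesis using that ab by simp
  qed
  have "1 = a / (a + b) + b / (a + b)" using ab by (simp add: add_divide_distrib[symmetric])
  also have "\<dots> \<le> (a / (a + b)) powr s + (b / (a + b)) powr s"
    using *[of a] *[of b] assms by simp
  also have "\<dots> = (a powr s + b powr s) / (a + b) powr s"
    using assms ab by (simp add: powr_divide add_divide_distrib)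
  finally show ?thesis using ab by (simp add: field_simps)
qed (use assms in auto)

lemma affine_borel [measurable]:
  fixes E :: "'a::euclidean_space set"
  shows "affine E \<Longrightarrow> E \<in> sets borel"
  by (simp add: borel_closed affine_closed)

lemma sim_apply_eq_translation: "sim_apply z
    = (\<lambda>x. snd (snd z) + x) \<circ> (\<lambda>x. (fst z *\<^sub>R fst (snd z)) *v x)"
  by (auto simp: sim_apply_def sim_map_def scaleR_matrix_vector_assoc)

lemma aff_dim_sim_apply_image:
  assumes "proper_param z" shows "aff_dim (sim_apply z ` S) = aff_dim S"
proof -
  have "inj (\<lambda>x. (fst z *\<^sub>R fst (snd z)) *v x)"
    using bij_is_inj[OF bij_sim_apply[OF assms]] unfolding sim_apply_eq_translation
    by (auto simp: inj_def)
  then show ?thesis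
    unfolding sim_apply_eq_translation image_comp[symmetric]
    by (simp add: aff_dim_translation_eq aff_dim_injective_linear_image)
qed

lemma affine_sim_apply_vimage:
  assumes "affine E" shows "affine (sim_apply z -` E)"
  unfolding affine_def
proof (intro ballI allI impI)
  fix x y and u v :: real
  assume E': "x \<in> sim_apply z -` E" "y \<in> sim_apply z -` E" and uv: "u + v = 1"
  from E' have E: "sim_apply z x \<in> E" "sim_apply z y \<in> E" by auto
  have "sim_apply z (u *\<^sub>R x + v *\<^sub>R y) = u *\<^sub>R sim_apply z x + v *\<^sub>R sim_apply z y
      + (1 - (u + v)) *\<^sub>R snd (snd z)"
    unfolding sim_apply_def sim_map_def
    by (simp add: matrix_vector_right_distrib matrix_vector_mult_scaleR algebra_simps)
  then have "sim_apply z (u *\<^sub>R x + v *\<^sub>R y) = u *\<^sub>R sim_apply z x + v *\<^sub>R sim_apply z y"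
    using uv by simp
  then show "u *\<^sub>R x + v *\<^sub>R y \<in> sim_apply z -` E" using assms E uv by (auto simp: affine_def)
qed

context irreducible_stationary
begin

text \<open>
  A bound such that ratios contract on average for every positive exponent up to it.
\<close>

definition contr_exp :: real where
  "contr_exp = (SOME contr_exp. contr_exp > 0 \<and> contr_exp \<le> exponent \<and> contr_exp
      \<le> 1 \<and> (\<forall>s. 0 < s \<and> s \<le> contr_exp \<longrightarrow> expectation (\<lambda>z. fst z powr s) < 1))"

lemma contr_exp: "0 < contr_exp" "contr_exp \<le> exponent" "contr_exp \<le> 1" "\<And>s. 0 < s \<Longrightarrow> s \<le> contr_exp
    \<Longrightarrow> expectation (\<lambda>z. fst z powr s) < 1"
  using someI_ex[OF ratio_moment_less_1, folded contr_exp_def] by auto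

text \<open>
  With \<open>\<theta> = E (r powr s) < 1\<close> and \<open>B = E (norm b powr s)\<close>, stationarity and Jensen's inequality for
  the concave truncation \<open>min _ M\<close> give \<open>\<integral>min (norm y powr s) M \<le> \<integral>min (\<theta> * norm y powr s) M + B\<close>.
  The truncated integrals are finite, so they can be subtracted; then \<open>M\<close> tends to infinity.
\<close>

lemma integrable_norm_powr:
  assumes s: "0 < s" "s \<le> contr_exp"
  shows "integrable \<sigma> (\<lambda>y. norm y powr s)"
proof -
  interpret P: pair_prob_space \<mu> \<sigma> ..
  define \<theta> where "\<theta> = expectation (\<lambda>z. fst z powr s)"
  have s1: "s \<le> 1" "s \<le> exponent" using s contr_exp by auto
  have \<theta>: "0 \<le> \<theta>" "\<theta> < 1" unfolding \<theta>_def using s contr_exp(4) by auto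
  have ir: "integrable \<mu> (\<lambda>z. fst z powr s)" by (rule integrable_ratio_powr) (use s s1 in auto)
  have \<theta>_nn: "(\<integral>\<^sup>+z. ennreal (fst z powr s) \<partial>\<mu>) = ennreal \<theta>"
    unfolding \<theta>_def by (rule nn_integral_eq_integral[OF ir]) auto
  have ib: "integrable \<mu> (\<lambda>z. norm (snd (snd z)) powr s)"
  proof (rule Bochner_Integration.integrable_bound)
    show "integrable \<mu> (\<lambda>z. 1
        + (fst z powr exponent + fst z powr (-exponent) + norm (snd (snd z)) powr exponent))"
      using integrable_moment_sum by simp
    have "x powr s \<le> 1 + x powr exponent" if "0 \<le> x" for x :: real
    proof (cases "x \<le> 1")
      case True
      then have "x powr s \<le> 1" using s that by (simp add: powr_le1)
      then show ?thesis by (simp add: add_increasing2)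
    next
      case False
      then have "x powr s \<le> x powr exponent" using s1 by (intro powr_mono) auto
      then show ?thesis by simp
    qed
    then have "norm (snd (snd z)) powr s \<le> 1
        + (fst z powr exponent + fst z powr (-exponent) + norm (snd (snd z)) powr exponent)"
        for z :: "'d sim_param"
      by (smt (verit) norm_ge_zero powr_ge_zero)
    then show "AE z in \<mu>. norm (norm (snd (snd z)) powr s)
        \<le> norm (1 + (fst z powr exponent + fst z powr (-exponent)
        + norm (snd (snd z)) powr exponent))"
      by (auto intro: order_trans[OF _ abs_ge_self])
  qed simp
  define B where "B = expectation (\<lambda>z. norm (snd (snd z)) powr s)"
  have B_nn: "(\<integral>\<^sup>+z. ennreal (norm (snd (snd z)) powr s) \<partial>\<mu>) = ennreal B"
    unfolding B_def by (rule nn_integral_eq_integral[OF ib]) auto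
  let ?a = "\<lambda>y :: real^'d. norm y powr s"
  have bound: "(\<integral>\<^sup>+y. ennreal ((1 - \<theta>) * (?a y * indicator {..M} (?a y))) \<partial>\<sigma>) \<le> ennreal B"
      if M: "0 \<le> M" for M
  proof -
    let ?Y = "\<integral>\<^sup>+y. ennreal (min (\<theta> * ?a y) M) \<partial>\<sigma>"
    have Yfin: "?Y < \<infinity>"
    proof -
      have "?Y \<le> (\<integral>\<^sup>+y. ennreal M \<partial>\<sigma>)" by (intro nn_integral_mono ennreal_leI) auto
      also have "\<dots> < \<infinity>" by (simp add: sig.emeasure_space_1[simplified])
      finally show ?thesis .
    qed
    have "?Y + (\<integral>\<^sup>+y. ennreal ((1 - \<theta>) * (?a y * indicator {..M} (?a y))) \<partial>\<sigma>) =
      (\<integral>\<^sup>+y. ennreal (min (\<theta> * ?a y) M) + ennreal ((1 - \<theta>) * (?a y * indicator {..M} (?a y))) \<partial>\<sigma>)"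
      by (rule nn_integral_add[symmetric]) auto
    also have "\<dots> \<le> (\<integral>\<^sup>+y. ennreal (min (?a y) M) \<partial>\<sigma>)"
    proof (rule nn_integral_mono)
      fix y
      have "min (\<theta> * a) M + (1 - \<theta>) * (a * indicator {..M} a) \<le> min a M" if "0 \<le> a" for a :: real
      proof -
        have "\<theta> * a \<le> a" using \<theta> that by (simp add: mult_left_le_one_le)
        then show ?thesis by (auto simp: indicator_def algebra_simps)
      qed
      from this[of "?a y"] show "ennreal (min (\<theta> * ?a y) M)
          + ennreal ((1 - \<theta>) * (?a y * indicator {..M} (?a y))) \<le> ennreal (min (?a y) M)"
        using \<theta> M by (subst ennreal_plus[symmetric])
            (auto intro!: ennreal_leI simp del: ennreal_plus)
    qed
    also have "\<dots> = (\<integral>\<^sup>+z. \<integral>\<^sup>+y. ennreal (min (?a (sim_apply z y)) M) \<partial>\<sigma> \<partial>\<mu>)"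
      by (rule nn_stationary) simp
    also have "\<dots> \<le> (\<integral>\<^sup>+z. (\<integral>\<^sup>+y. ennreal (min (fst z powr s * ?a y) M) \<partial>\<sigma>)
        + ennreal (norm (snd (snd z)) powr s) \<partial>\<mu>)"
    proof (rule nn_integral_mono_AE)
      show "AE z in \<mu>. (\<integral>\<^sup>+y. ennreal (min (?a (sim_apply z y)) M) \<partial>\<sigma>) \<le>
         (\<integral>\<^sup>+y. ennreal (min (fst z powr s * ?a y) M) \<partial>\<sigma>) + ennreal (norm (snd (snd z)) powr s)"
        using AE_proper
      proof eventually_elim
        case (elim z)
        then have r: "0 < fst z" by (simp add: proper_param_def)
        have "(\<integral>\<^sup>+y. ennreal (min (?a (sim_apply z y)) M) \<partial>\<sigma>) \<le>
           (\<integral>\<^sup>+y. ennreal (min (fst z powr s * ?a y) M) + ennreal (norm (snd (snd z)) powr s) \<partial>\<sigma>)"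
        proof (rule nn_integral_mono)
          fix y
          have "?a (sim_apply z y) \<le> (fst z * norm y + norm (snd (snd z))) powr s"
            using norm_sim_apply_le[OF elim, of y] s by (intro powr_mono2) auto
          also have "\<dots> \<le> (fst z * norm y) powr s + norm (snd (snd z)) powr s"
            using r s s1 by (intro powr_add_le_add_powr) auto
          finally have "?a (sim_apply z y) \<le> fst z powr s * ?a y + norm (snd (snd z)) powr s"
            using r by (simp add: powr_mult)
          moreover have "0 \<le> norm (snd (snd z)) powr s" by simp
          ultimately have "min (?a (sim_apply z y)) M \<le> min (fst z powr s * ?a y) M
              + norm (snd (snd z)) powr s"
            by linarith
          then show "ennreal (min (?a (sim_apply z y)) M) \<le> ennreal (min (fst z powr s * ?a y) M)
              + ennreal (norm (snd (snd z)) powr s)"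
            using M by (subst ennreal_plus[symmetric])
                (auto intro!: ennreal_leI simp del: ennreal_plus)
        qed
        also have "\<dots> = (\<integral>\<^sup>+y. ennreal (min (fst z powr s * ?a y) M) \<partial>\<sigma>)
            + ennreal (norm (snd (snd z)) powr s)"
          by (subst nn_integral_add) (auto simp: sig.emeasure_space_1[simplified])
        finally show ?case .
      qed
    qed
    also have "\<dots> = (\<integral>\<^sup>+z. (\<integral>\<^sup>+y. ennreal (min (fst z powr s * ?a y) M) \<partial>\<sigma>) \<partial>\<mu>) + ennreal B"
      unfolding B_nn[symmetric] by (rule nn_integral_add) auto
    also have "(\<integral>\<^sup>+z. (\<integral>\<^sup>+y. ennreal (min (fst z powr s * ?a y) M) \<partial>\<sigma>) \<partial>\<mu>)
        = (\<integral>\<^sup>+y. (\<integral>\<^sup>+z. ennreal (min (fst z powr s * ?a y) M) \<partial>\<mu>) \<partial>\<sigma>)"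
      by (rule P.Fubini'[symmetric]) auto
    also have "\<dots> \<le> ?Y"
    proof (rule nn_integral_mono)
      fix y
      have "(\<integral>\<^sup>+z. ennreal (min (fst z powr s * ?a y) M) \<partial>\<mu>)
          \<le> (\<integral>\<^sup>+z. ennreal (fst z powr s) * ennreal (?a y) \<partial>\<mu>)"
        by (intro nn_integral_mono) (auto simp: ennreal_mult[symmetric] intro!: ennreal_leI)
      also have "\<dots> = ennreal (\<theta> * ?a y)"
        using \<theta> by (simp add: nn_integral_multc \<theta>_nn ennreal_mult)
      finally have 1: "(\<integral>\<^sup>+z. ennreal (min (fst z powr s * ?a y) M) \<partial>\<mu>) \<le> ennreal (\<theta> * ?a y)" .
      have "(\<integral>\<^sup>+z. ennreal (min (fst z powr s * ?a y) M) \<partial>\<mu>) \<le> (\<integral>\<^sup>+z. ennreal M \<partial>\<mu>)"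
        by (intro nn_integral_mono ennreal_leI) auto
      then have 2: "(\<integral>\<^sup>+z. ennreal (min (fst z powr s * ?a y) M) \<partial>\<mu>) \<le> ennreal M"
        by (simp add: emeasure_space_1[simplified])
      show "(\<integral>\<^sup>+z. ennreal (min (fst z powr s * ?a y) M) \<partial>\<mu>) \<le> ennreal (min (\<theta> * ?a y) M)"
        using 1 2 by (simp add: min_def)
    qed
    finally have "?Y + (\<integral>\<^sup>+y. ennreal ((1 - \<theta>) * (?a y * indicator {..M} (?a y))) \<partial>\<sigma>) \<le> ?Y
        + ennreal B"
      by (simp add: add_right_mono)
    then show ?thesis using Yfin by (auto simp: ennreal_add_left_cancel_le)
  qed
  have "(\<integral>\<^sup>+y. ennreal ((1 - \<theta>) * ?a y) \<partial>\<sigma>)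
      = (\<integral>\<^sup>+y. liminf (\<lambda>n. ennreal ((1 - \<theta>) * (?a y * indicator {..real n} (?a y)))) \<partial>\<sigma>)"
  proof (rule nn_integral_cong)
    fix y
    obtain N where "?a y \<le> real N" using real_arch_simple by blast
    then have "\<forall>\<^sub>F n in sequentially. ennreal ((1 - \<theta>) * (?a y * indicator {..real n} (?a y)))
        = ennreal ((1 - \<theta>) * ?a y)"
      unfolding eventually_sequentially by (intro exI[of _ N]) auto
    then have "(\<lambda>n. ennreal ((1 - \<theta>) * (?a y * indicator {..real n} (?a y))))
        \<longlonglongrightarrow> ennreal ((1 - \<theta>) * ?a y)"
      by (rule tendsto_eventually)
    then show "ennreal ((1 - \<theta>) * ?a y)
        = liminf (\<lambda>n. ennreal ((1 - \<theta>) * (?a y * indicator {..real n} (?a y))))"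
      by (intro lim_imp_Liminf[symmetric]) auto
  qed
  also have "\<dots> \<le> liminf (\<lambda>n. \<integral>\<^sup>+y. ennreal ((1 - \<theta>) * (?a y * indicator {..real n} (?a y))) \<partial>\<sigma>)"
    by (rule nn_integral_liminf) simp
  also have "\<dots> \<le> ennreal B"
    by (rule Liminf_le) (use bound in auto)
  finally have "(\<integral>\<^sup>+y. ennreal ((1 - \<theta>) * ?a y) \<partial>\<sigma>) < \<infinity>"
    by (simp add: le_less_trans)
  then have "integrable \<sigma> (\<lambda>y. (1 - \<theta>) * ?a y)"
    using \<theta> by (intro integrableI_nonneg) auto
  then have "integrable \<sigma> (\<lambda>y. (1 / (1 - \<theta>)) * ((1 - \<theta>) * ?a y))"
    by (rule Bochner_Integration.integrable_mult_right)
  then show ?thesis using \<theta> by simp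
qed

text \<open>
  Let \<open>m\<close> be the minimal dimension of an affine subspace of positive mass. Distinct subspaces of
  this dimension meet in null sets, so only finitely many have a mass above a given bound. The set
  \<open>M\<close> of those of maximal mass is finite and nonempty, and preimages under almost every similarity
  map \<open>M\<close> to itself.
\<close>

lemma proper_affine_null:
  assumes E0: "affine E0" "E0 \<noteq> UNIV"
  shows "measure \<sigma> E0 = 0"
proof (rule ccontr)
  assume "measure \<sigma> E0 \<noteq> 0"
  then have E0_pos: "0 < measure \<sigma> E0" by (simp add: zero_less_measure_iff)
  define S where "S = {E :: (real^'d) set. affine E \<and> 0 < measure \<sigma> E}"
  have ne: "E \<noteq> {}" if "E \<in> S" for E using that by (auto simp: S_def)
  define m where "m = (LEAST m. \<exists>E\<in>S. nat (aff_dim E) = m)"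
  have "\<exists>m. \<exists>E\<in>S. nat (aff_dim E) = m" using E0 E0_pos by (auto simp: S_def)
  from LeastI_ex[OF this] obtain E1 where E1: "E1 \<in> S" "nat (aff_dim E1) = m" unfolding m_def
    by blast
  have least: "m \<le> nat (aff_dim E)" if "E \<in> S" for E
    unfolding m_def using that by (intro Least_le) blast
  have nonneg: "0 \<le> aff_dim E" if "E \<in> S" for E
    using ne[OF that] aff_dim_negative_iff[of E] by linarith
  have m_less: "int m < DIM(real^'d)"
  proof -
    have "aff_dim E0 < DIM(real^'d)"
      using E0 affine_hull_UNIV aff_dim_eq_full[of E0] aff_dim_le_DIM[of E0]
        by (metis affine_hull_eq order_less_le)
    then show ?thesis using least[of E0] nonneg[of E0] E0 E0_pos by (simp add: S_def)
  qed
  define A where "A = {E\<in>S. aff_dim E = int m}"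
  have null: "measure \<sigma> (E \<inter> F) = 0" if "E \<in> A" "F \<in> A" "E \<noteq> F" for E F
  proof (rule ccontr)
    assume "measure \<sigma> (E \<inter> F) \<noteq> 0"
    then have EF: "E \<inter> F \<in> S"
      using that by (auto simp: S_def A_def zero_less_measure_iff affine_Int)
    then have "int m \<le> aff_dim (E \<inter> F)" using least[OF EF] nonneg[OF EF] by linarith
    moreover have "aff_dim (E \<inter> F) \<le> aff_dim E" "aff_dim (E \<inter> F) \<le> aff_dim F"
      by (auto intro: aff_dim_subset)
    ultimately have "aff_dim (E \<inter> F) = aff_dim E" "aff_dim (E \<inter> F) = aff_dim F" using that
      by (auto simp: A_def)
    moreover have "affine E" "affine F" "affine (E \<inter> F)" using that EF by (auto simp: A_def S_def)
    ultimately have "E \<inter> F = E" "E \<inter> F = F"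
      using ne[OF EF] affine_dim_equal[of "E \<inter> F" E] affine_dim_equal[of "E \<inter> F" F] by auto
    then show False using that by simp
  qed
  have fin: "finite {E\<in>A. \<delta> \<le> measure \<sigma> E}" if \<delta>: "0 < \<delta>" for \<delta>
  proof (rule conjunct1[OF finite_if_finite_subsets_card_bdd])
    fix F assume F: "F \<subseteq> {E\<in>A. \<delta> \<le> measure \<sigma> E}" "finite F"
    have F_meas: "E \<in> sets \<sigma>" if "E \<in> F" for E using F that by (auto simp: A_def S_def)
    have "AE y in \<sigma>. \<forall>E\<in>F. \<forall>E'\<in>F. E \<noteq> E' \<longrightarrow> y \<notin> E \<inter> E'"
    proof (intro AE_finite_allI F(2))
      fix E E' assume E: "E \<in> F" "E' \<in> F"
      show "AE y in \<sigma>. E \<noteq> E' \<longrightarrow> y \<notin> E \<inter> E'"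
      proof (cases "E = E'")
        case False
        then have "measure \<sigma> (E \<inter> E') = 0" using null F(1) E by blast
        then have "E \<inter> E' \<in> null_sets \<sigma>"
          using F_meas E by (auto simp: null_sets_def sig.emeasure_eq_measure)
        then have "AE y in \<sigma>. y \<notin> E \<inter> E'" by (rule AE_not_in)
        then show ?thesis by eventually_elim simp
      qed simp
    qed
    then have le1: "AE y in \<sigma>. (\<Sum>E\<in>F. indicator E y) \<le> (1::real)"
    proof eventually_elim
      case (elim y)
      have "(\<Sum>E\<in>F. indicator E y :: real) = real (card {E\<in>F. y \<in> E})"
        using F(2) by (simp add: indicator_def sum.If_cases Int_def)
      also have "card {E\<in>F. y \<in> E} \<le> 1"
        using elim F(2) card_le_Suc0_iff_eq[of "{E\<in>F. y \<in> E}"] by auto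
      finally show ?case by simp
    qed
    have "\<delta> * card F = (\<Sum>E\<in>F. \<delta>)" by simp
    also have "\<dots> \<le> (\<Sum>E\<in>F. measure \<sigma> E)" using F(1) by (intro sum_mono) auto
    also have "\<dots> = (\<integral>y. (\<Sum>E\<in>F. indicator E y) \<partial>\<sigma>)"
      using F_meas by (subst Bochner_Integration.integral_sum)
          (auto simp: sig.emeasure_finite less_top[symmetric])
    also have "\<dots> \<le> 1"
      using F_meas le1 by (intro sig.integral_le_const Bochner_Integration.integrable_sum)
          (auto simp: sig.emeasure_finite less_top[symmetric])
    finally have "card F \<le> nat \<lceil>1 / \<delta>\<rceil>" using \<delta>
      by (simp add: field_simps le_nat_iff le_ceiling_iff) 
    then show "card F \<le> nat \<lceil>1 / \<delta>\<rceil>" .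
  qed
  have E1A: "E1 \<in> A" using E1 nonneg[OF E1(1)] by (auto simp: A_def)
  define B where "B = {E\<in>A. measure \<sigma> E1 \<le> measure \<sigma> E}"
  have B: "finite B" "E1 \<in> B" unfolding B_def using fin E1A by (auto simp: A_def S_def)
  define mx where "mx = Max (measure \<sigma> ` B)"
  have mx_ge: "measure \<sigma> E \<le> mx" if "E \<in> A" for E
  proof (cases "E \<in> B")
    case True then show ?thesis unfolding mx_def using B by auto
  next
    case False
    then have "measure \<sigma> E \<le> measure \<sigma> E1" using that by (auto simp: B_def)
    also have "\<dots> \<le> mx" unfolding mx_def using B by auto
    finally show ?thesis .
  qed
  have mx_pos: "0 < mx" using mx_ge[OF E1A] E1 by (auto simp: S_def)
  define M where "M = {E\<in>A. measure \<sigma> E = mx}"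
  have "mx \<in> measure \<sigma> ` B" unfolding mx_def using B by (intro Max_in) auto
  then obtain E2 where E2: "E2 \<in> M" unfolding M_def B_def by auto
  have "M \<subseteq> B" using mx_ge[OF E1A] by (auto simp: M_def B_def)
  then have M_fin: "finite M" using B(1) finite_subset by blast
  have step: "AE z in \<mu>. sim_apply z -` E \<in> M" if E: "E \<in> M" for E
  proof -
    have aff: "affine E" and dim: "aff_dim E = int m" and mE: "measure \<sigma> E = mx"
      using E by (auto simp: M_def A_def S_def)
    have mem: "sim_apply z -` E \<in> A \<or> measure \<sigma> (sim_apply z -` E) = 0" if z: "proper_param z" for z
    proof -
      have "sim_apply z ` (sim_apply z -` E) = E"
        using bij_sim_apply[OF z] by (simp add: surj_image_vimage_eq bij_is_surj)
      then have "aff_dim (sim_apply z -` E) = int m"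
        using aff_dim_sim_apply_image[OF z, of "sim_apply z -` E"] dim by simp
      then show ?thesis
        using affine_sim_apply_vimage[OF aff, of z]
          by (auto simp: A_def S_def zero_less_measure_iff)
    qed
    have i: "integrable \<mu> (\<lambda>z. mx - measure \<sigma> (sim_apply z -` E))"
      using measure_stationary(2)[of E] aff by simp
    have "expectation (\<lambda>z. mx - measure \<sigma> (sim_apply z -` E)) = 0"
      using measure_stationary[of E] aff mE by simp
    moreover have "AE z in \<mu>. 0 \<le> mx - measure \<sigma> (sim_apply z -` E)"
      using AE_proper by eventually_elim (use mem mx_ge mx_pos in fastforce)
    ultimately have "AE z in \<mu>. mx - measure \<sigma> (sim_apply z -` E) = 0"
      using integral_nonneg_eq_0_iff_AE[OF i] by simp
    with AE_proper show ?thesis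
    proof eventually_elim
      case (elim z)
      then show ?case using mem[of z] mx_pos by (auto simp: M_def)
    qed
  qed
  have all: "AE z in \<mu>. \<forall>E\<in>M. sim_apply z -` E \<in> M"
    by (intro AE_finite_allI M_fin step)
  \<comment> \<open>the negative drift provides a contraction that permutes \<open>M\<close>\<close>
  obtain z where z: "proper_param z" "\<forall>E\<in>M. sim_apply z -` E \<in> M" "fst z < 1"
  proof (rule ccontr)
    assume no: "\<not> thesis"
    have "AE z in \<mu>. 0 \<le> ln (fst z)"
      using AE_proper all
    proof eventually_elim
      case (elim z)
      have "1 \<le> fst z" using no that[OF elim] by (meson not_le)
      then show ?case by simp
    qed
    then have "0 \<le> expectation (\<lambda>z. ln (fst z))" by (rule integral_nonneg_AE)
    with negative_drift show False by simp
  qed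
  have r: "0 < fst z" using z by (simp add: proper_param_def)
  have "\<exists>!p. sim_apply z p = p"
    by (rule banach_fix_type[of "fst z"])
        (use r z norm_sim_apply_diff[OF z(1)] in \<open>auto simp: dist_norm\<close>)
  then obtain p where p: "sim_apply z p = p" by blast
  \<comment> \<open>the subspace in \<open>M\<close> farthest from the fixed point has a preimage that is still farther, unless
    all distances vanish\<close>
  define D where "D = Max (infdist p ` M)"
  have D_ge: "infdist p E \<le> D" if "E \<in> M" for E unfolding D_def using that M_fin by auto
  have "D \<in> infdist p ` M" unfolding D_def using E2 M_fin by (intro Max_in) auto
  then obtain E3 where E3: "E3 \<in> M" "D = infdist p E3" by blast
  have ne3: "sim_apply z -` E3 \<noteq> {}" using ne z(2) E3 by (auto simp: M_def A_def)
  have "infdist p E3 / fst z \<le> infdist p (sim_apply z -` E3)"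
    unfolding infdist_notempty[OF ne3]
  proof (rule cINF_greatest[OF ne3])
    fix y assume "y \<in> sim_apply z -` E3"
    then have "infdist p E3 \<le> dist p (sim_apply z y)" by (intro infdist_le) auto
    also have "\<dots> = fst z * dist p y" using norm_sim_apply_diff[OF z(1), of p y] p
      by (simp add: dist_norm)
    finally show "infdist p E3 / fst z \<le> dist p y" using r by (simp add: field_simps)
  qed
  also have "\<dots> \<le> D" using D_ge z(2) E3 by blast
  finally have "D \<le> fst z * D" using E3 r by (simp add: field_simps)
  then have "D \<le> 0" using mult_strict_right_mono[OF z(3), of D] by (cases "0 < D") auto
  then have p_mem: "p \<in> E" if "E \<in> M" for E
    using D_ge[OF that] infdist_nonneg[of p E] that ne[of E]
    by (subst in_closed_iff_infdist_zero) (auto simp: M_def A_def S_def affine_closed)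
  have "\<Inter>M = UNIV"
  proof (rule irreducible)
    show "affine (\<Inter>M)" by (rule affine_Inter) (auto simp: M_def A_def S_def)
    show "\<Inter>M \<noteq> {}" using p_mem by blast
    show "AE z in \<mu>. sim_apply z ` \<Inter>M \<subseteq> \<Inter>M"
      using all by eventually_elim blast
  qed
  then have "E2 = UNIV" using E2 by blast
  then show False using E2 m_less by (simp add: M_def A_def)
qed

text \<open>
  Otherwise strips of width tending to \<open>0\<close> and mass \<open>\<ge> \<delta>\<close> would accumulate at a hyperplane of mass
  \<open>\<ge> \<delta> / 2\<close>. They all meet a fixed ball whose complement has mass \<open>< \<delta> / 2\<close>, so directions and
  offsets stay in a compact set.
\<close>

lemma strip_uniformly_small:
  assumes \<delta>: "0 < \<delta>"
  shows "\<exists>\<eta>>0. \<forall>u t. norm u = 1 \<longrightarrow> measure \<sigma> {x. \<bar>u \<bullet> x - t\<bar> \<le> \<eta>} < \<delta>"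
proof (rule ccontr)
  assume "\<not> ?thesis"
  then have "\<forall>n. \<exists>u t. norm u = 1 \<and> \<delta> \<le> measure \<sigma> {x. \<bar>u \<bullet> x - t\<bar> \<le> inverse (real (Suc n))}"
    by (metis inverse_positive_iff_positive not_le of_nat_0_less_iff zero_less_Suc)
  then obtain u t where u: "\<And>n. norm (u n) = 1"
    and strip: "\<And>n. \<delta> \<le> measure \<sigma> {x. \<bar>u n \<bullet> x - t n\<bar> \<le> inverse (real (Suc n))}"
    by metis
  obtain R where R: "R > 0" "measure \<sigma> {x. R < norm x} < \<delta> / 2"
    using exists_radius_small_tail[of "\<delta> / 2"] \<delta> by auto
  have ux: "\<bar>u n \<bullet> x\<bar> \<le> norm x" for n x using Cauchy_Schwarz_ineq2[of "u n" x] u by simp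
  have t: "\<bar>t n\<bar> \<le> R + 1" for n
  proof (rule ccontr)
    assume "\<not> \<bar>t n\<bar> \<le> R + 1"
    then have "{x. \<bar>u n \<bullet> x - t n\<bar> \<le> inverse (real (Suc n))} \<subseteq> {x. R < norm x}"
    proof (intro subsetI CollectI)
      fix x assume nt: "\<not> \<bar>t n\<bar> \<le> R + 1" and "x \<in> {x. \<bar>u n \<bullet> x - t n\<bar> \<le> inverse (real (Suc n))}"
      then have "\<bar>u n \<bullet> x - t n\<bar> \<le> inverse (real (Suc n))" by simp
      also have "\<dots> \<le> 1" by (simp add: field_simps)
      finally show "R < norm x" using ux[of n x] nt by linarith
    qed
    then have "measure \<sigma> {x. \<bar>u n \<bullet> x - t n\<bar> \<le> inverse (real (Suc n))} \<le> measure \<sigma> {x. R < norm x}"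
      by (intro sig.finite_measure_mono) auto
    with strip[of n] R \<delta> show False by simp
  qed
  have "compact (sphere 0 1 \<times> cball 0 (R + 1) :: ((real^'d) \<times> real) set)"
    by (intro compact_Times) auto
  then have "seq_compact (sphere 0 1 \<times> cball 0 (R + 1) :: ((real^'d) \<times> real) set)"
    by (simp add: compact_eq_seq_compact_metric)
  moreover have "\<forall>n. (u n, t n) \<in> sphere 0 1 \<times> cball 0 (R + 1)" using u t by auto
  ultimately obtain l r where l: "l \<in> sphere 0 1 \<times> cball 0 (R + 1)" and r: "strict_mono r"
    and lim: "((\<lambda>n. (u n, t n)) \<circ> r) \<longlonglongrightarrow> l"
    by (rule seq_compactE)
  define v c where "v = fst l" and "c = snd l"
  have v: "norm v = 1" using l by (auto simp: v_def)
  have lim_u: "(\<lambda>n. u (r n)) \<longlonglongrightarrow> v" and lim_t: "(\<lambda>n. t (r n)) \<longlonglongrightarrow> c"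
    using tendsto_fst[OF lim] tendsto_snd[OF lim] by (auto simp: v_def c_def o_def)
  have lim_e: "(\<lambda>n. inverse (real (Suc (r n)))) \<longlonglongrightarrow> 0"
    using LIMSEQ_subseq_LIMSEQ[OF LIMSEQ_inverse_real_of_nat r] by (simp add: o_def)
  have half: "\<delta> / 2 \<le> measure \<sigma> {x. \<bar>v \<bullet> x - c\<bar> \<le> inverse (real (Suc k))}" for k
  proof -
    let ?\<kappa> = "inverse (real (Suc k))"
    have "(\<lambda>n. norm (u (r n) - v) * R + \<bar>t (r n) - c\<bar> + inverse (real (Suc (r n))))
        \<longlonglongrightarrow> norm (v - v) * R + \<bar>c - c\<bar> + 0"
      by (intro tendsto_intros lim_u lim_t lim_e)
    then have "(\<lambda>n. norm (u (r n) - v) * R + \<bar>t (r n) - c\<bar> + inverse (real (Suc (r n)))) \<longlonglongrightarrow> 0"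
      by simp
    then have "\<forall>\<^sub>F n in sequentially. norm (u (r n) - v) * R + \<bar>t (r n) - c\<bar>
        + inverse (real (Suc (r n))) < ?\<kappa>"
      by (rule order_tendstoD) simp
    then obtain n where n: "norm (u (r n) - v) * R + \<bar>t (r n) - c\<bar> + inverse (real (Suc (r n)))
        < ?\<kappa>"
      using eventually_happens'[OF sequentially_bot] by blast
    have "{x. \<bar>u (r n) \<bullet> x - t (r n)\<bar> \<le> inverse (real (Suc (r n)))} \<subseteq> {x. R < norm x}
        \<union> {x. \<bar>v \<bullet> x - c\<bar> \<le> ?\<kappa>}"
    proof
      fix x assume "x \<in> {x. \<bar>u (r n) \<bullet> x - t (r n)\<bar> \<le> inverse (real (Suc (r n)))}"
      then have x: "\<bar>u (r n) \<bullet> x - t (r n)\<bar> \<le> inverse (real (Suc (r n)))" by simp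
      show "x \<in> {x. R < norm x} \<union> {x. \<bar>v \<bullet> x - c\<bar> \<le> ?\<kappa>}"
      proof (cases "R < norm x")
        case False
        have "\<bar>(u (r n) - v) \<bullet> x\<bar> \<le> norm (u (r n) - v) * norm x" by (rule Cauchy_Schwarz_ineq2)
        also have "\<dots> \<le> norm (u (r n) - v) * R" using False by (intro mult_left_mono) auto
        finally have "\<bar>v \<bullet> x - c\<bar> \<le> ?\<kappa>" using x n by (simp only: inner_diff_left)
        then show ?thesis by simp
      qed simp
    qed
    then have "measure \<sigma> {x. \<bar>u (r n) \<bullet> x - t (r n)\<bar> \<le> inverse (real (Suc (r n)))}
        \<le> measure \<sigma> ({x. R < norm x} \<union> {x. \<bar>v \<bullet> x - c\<bar> \<le> ?\<kappa>})"
      by (intro sig.finite_measure_mono) auto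
    also have "\<dots> \<le> measure \<sigma> {x. R < norm x} + measure \<sigma> {x. \<bar>v \<bullet> x - c\<bar> \<le> ?\<kappa>}"
      by (rule measure_Un_le) auto
    finally show ?thesis using strip[of "r n"] R by linarith
  qed
  have "(\<lambda>k. measure \<sigma> {x. \<bar>v \<bullet> x - c\<bar> \<le> inverse (real (Suc k))})
      \<longlonglongrightarrow> measure \<sigma> (\<Inter>k. {x. \<bar>v \<bullet> x - c\<bar> \<le> inverse (real (Suc k))})"
  proof (rule sig.finite_Lim_measure_decseq)
    show "decseq (\<lambda>k. {x. \<bar>v \<bullet> x - c\<bar> \<le> inverse (real (Suc k))})"
    proof (intro decseq_SucI subsetI CollectI)
      fix k x assume "x \<in> {x. \<bar>v \<bullet> x - c\<bar> \<le> inverse (real (Suc (Suc k)))}"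
      then have "\<bar>v \<bullet> x - c\<bar> \<le> inverse (real (Suc (Suc k)))" by simp
      also have "\<dots> \<le> inverse (real (Suc k))" by (intro le_imp_inverse_le) auto
      finally show "\<bar>v \<bullet> x - c\<bar> \<le> inverse (real (Suc k))" .
    qed
  qed auto
  also have "(\<Inter>k. {x. \<bar>v \<bullet> x - c\<bar> \<le> inverse (real (Suc k))}) = {x. v \<bullet> x = c}"
  proof (intro equalityI subsetI CollectI)
    fix x assume "x \<in> (\<Inter>k. {x. \<bar>v \<bullet> x - c\<bar> \<le> inverse (real (Suc k))})"
    then have *: "\<bar>v \<bullet> x - c\<bar> \<le> inverse (real (Suc k))" for k by blast
    have "\<bar>v \<bullet> x - c\<bar> \<le> 0"
      by (rule LIMSEQ_le_const[OF LIMSEQ_inverse_real_of_nat]) (use * in blast)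
    then show "v \<bullet> x = c" by simp
  qed auto
  finally have "\<delta> / 2 \<le> measure \<sigma> {x. v \<bullet> x = c}"
    by (rule LIMSEQ_le_const) (use half in blast)
  moreover have "measure \<sigma> {x. v \<bullet> x = c} = 0"
  proof (rule proper_affine_null[OF affine_hyperplane])
    have "v \<bullet> ((c + 1) *\<^sub>R v) \<noteq> c" using v by (simp add: dot_square_norm)
    then show "{x. v \<bullet> x = c} \<noteq> UNIV" by blast
  qed
  ultimately show False using \<delta> by simp
qed

end

section \<open>Power decay of the mass of strips\<close>

lemma amgm_weighted:
  fixes a b \<delta> :: real assumes "0 < \<delta>"
  shows "a * b \<le> \<delta> / 2 * a\<^sup>2 + b\<^sup>2 / (2 * \<delta>)"
proof -
  have "0 \<le> (\<delta> * a - b)\<^sup>2 / (2 * \<delta>)" using assms by simp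
  also have "\<dots> = \<delta> / 2 * a\<^sup>2 + b\<^sup>2 / (2 * \<delta>) - a * b"
    using assms by (simp add: power2_eq_square field_simps)
  finally show ?thesis by simp
qed

lemma ge_scaled_min:
  fixes a r w :: real
  assumes "0 \<le> a" "0 < r" "0 \<le> w"
  shows "min 1 r * (a + w) \<le> r * a + w"
proof -
  have "min 1 r * a \<le> r * a" "min 1 r * w \<le> 1 * w" using assms by (intro mult_right_mono; simp)+
  then show ?thesis by (simp add: algebra_simps)
qed

text \<open>
  A point \<open>y\<close> of a piece is compared with an independent point \<open>y'\<close> of the same piece. If the image
  of \<open>y'\<close> is at distance \<open>\<ge> \<eta>\<close> from the hyperplane and neither \<open>y\<close> nor \<open>y'\<close> is far out, then the
  image of \<open>y\<close> is at distance \<open>\<ge> \<eta> / 2\<close>. In all other cases the kernel is multiplied by a factor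
  that is small on average. The weight \<open>(1 + norm y) powr s\<close> absorbs the case that \<open>y\<close> itself is
  far out.
\<close>

lemma strip_kernel_split:
  fixes z :: "('d::finite) sim_param" and u y y' :: "real^'d" and t :: real
  assumes z: "proper_param z" and u: "norm u = 1" and w: "0 < w" and c: "0 < c" "c \<le> 1"
    and \<eta>: "0 < \<eta>" "\<eta> \<le> 1" and s: "0 < s" "s \<le> 1"
  defines "A \<equiv> (1 + norm (sim_apply z y')) powr s + fst z powr s * norm y' powr s"
    and "f \<equiv> (\<bar>u \<bullet> sim_apply z y - t\<bar> + w) powr (-c)"
    and "N \<equiv> indicator {x. \<bar>u \<bullet> x - t\<bar> < \<eta>} (sim_apply z y')"
  shows "(1 + norm (sim_apply z y)) powr s * f \<le> 2 / \<eta> * (1 + norm (sim_apply z y)) powr s +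
    (A * N + 8 / \<eta> * (A * (fst z powr s * (1 + norm y' powr s)))) * ((1 + norm y) powr s * f)"
proof -
  define r W where "r = fst z" and "W = (1 + norm (sim_apply z y)) powr s"
  have r: "0 < r" using z by (simp add: r_def proper_param_def)
  have f0: "0 \<le> f" by (simp add: f_def)
  have N: "N = 0 \<or> N = 1" "0 \<le> N" by (auto simp: N_def split: split_indicator)
  have A1: "1 \<le> A"
  proof -
    have "1 \<le> (1 + norm (sim_apply z y')) powr s" using s by (intro ge_one_powr_ge_zero) auto
    moreover have "0 \<le> fst z powr s * norm y' powr s" by simp
    ultimately show ?thesis unfolding A_def by linarith
  qed
  have dist: "norm (sim_apply z y - sim_apply z y') \<le> r * norm y + r * norm y'"
    using norm_sim_apply_diff[OF z, of y y'] norm_triangle_ineq4[of y y'] r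
    by (simp add: r_def distrib_left[symmetric])
  have W: "W \<le> A + r powr s * norm y powr s"
  proof -
    have "W \<le> (((1 + norm (sim_apply z y')) + r * norm y') + r * norm y) powr s"
      unfolding W_def using dist norm_triangle_sub[of "sim_apply z y" "sim_apply z y'"] s r
      by (intro powr_mono2) auto
    also have "\<dots> \<le> ((1 + norm (sim_apply z y')) + r * norm y') powr s + (r * norm y) powr s"
      using r s by (intro powr_add_le_add_powr) auto
    also have "((1 + norm (sim_apply z y')) + r * norm y') powr s
        \<le> (1 + norm (sim_apply z y')) powr s + (r * norm y') powr s"
      using r s by (intro powr_add_le_add_powr) auto
    finally show ?thesis using r by (simp add: A_def r_def powr_mult)
  qed
  have p1: "1 \<le> (1 + norm y) powr s" using s by (intro ge_one_powr_ge_zero) auto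
  have p2: "norm y powr s \<le> (1 + norm y) powr s" using s by (intro powr_mono2) auto
  have e4: "1 \<le> 4 / \<eta> * x powr s" if "\<eta> / 4 < x" for x
  proof -
    have "1 \<le> (4 / \<eta> * x) powr s" using that \<eta> s
      by (intro ge_one_powr_ge_zero) (auto simp: field_simps)
    also have "\<dots> = (4 / \<eta>) powr s * x powr s" using that \<eta> by (subst powr_mult) auto
    also have "\<dots> \<le> (4 / \<eta>) powr 1 * x powr s"
      using \<eta> s by (intro mult_right_mono powr_mono) (auto simp: field_simps)
    finally show ?thesis using \<eta> by simp
  qed
  define Y Y' where "Y = r powr s * norm y powr s" and "Y' = r powr s * norm y' powr s"
  have Y0: "0 \<le> Y" "0 \<le> Y'" by (auto simp: Y_def Y'_def)
  \<comment> \<open>either the kernel is bounded by \<open>2 / \<eta>\<close>, or one of \<open>N\<close>, \<open>4 / \<eta> * Y'\<close> and \<open>4 / \<eta> * Y\<close> is at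
    least \<open>1\<close>\<close>
  have key: "W * f \<le> 2 / \<eta> * W + (A * N + 4 / \<eta> * (A * Y') + 4 / \<eta> * (A * Y) + Y) * f"
  proof (cases "N = 0 \<and> r * norm y' \<le> \<eta> / 4 \<and> r * norm y \<le> \<eta> / 4")
    case True
    then have "\<eta> \<le> \<bar>u \<bullet> sim_apply z y' - t\<bar>" by (auto simp: N_def split: split_indicator_asm)
    moreover have "\<bar>u \<bullet> (sim_apply z y - sim_apply z y')\<bar> \<le> \<eta> / 2"
      using Cauchy_Schwarz_ineq2[of u "sim_apply z y - sim_apply z y'"] u dist True by simp
    ultimately have "\<eta> / 2 \<le> \<bar>u \<bullet> sim_apply z y - t\<bar> + w"
      unfolding inner_diff_right using w by linarith
    then have "f \<le> (\<eta> / 2) powr (-c)" unfolding f_def using \<eta> c by (intro powr_mono2') auto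
    also have "\<dots> \<le> (\<eta> / 2) powr (-1)" using \<eta> c by (intro powr_mono') auto
    also have "\<dots> = 2 / \<eta>" using \<eta> by (simp add: powr_minus_divide)
    finally have "W * f \<le> W * (2 / \<eta>)" by (intro mult_left_mono) (auto simp: W_def)
    moreover have "0 \<le> (A * N + 4 / \<eta> * (A * Y') + 4 / \<eta> * (A * Y) + Y) * f"
      using A1 N Y0 \<eta> f0 by simp
    ultimately show ?thesis by (simp add: mult.commute)
  next
    case False
    have "A \<le> A * N + 4 / \<eta> * (A * Y') + 4 / \<eta> * (A * Y)"
    proof -
      have nn: "0 \<le> A * N" "0 \<le> 4 / \<eta> * (A * Y')" "0 \<le> 4 / \<eta> * (A * Y)" using A1 N Y0 \<eta> by auto
      consider "N = 1" | "\<eta> / 4 < r * norm y'" | "\<eta> / 4 < r * norm y" using False N by force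
      then show ?thesis
      proof cases
        case 1 then show ?thesis using nn by simp
      next
        case 2
        then have "1 \<le> 4 / \<eta> * Y'" using e4[of "r * norm y'"] r by (simp add: Y'_def powr_mult)
        then have "A * 1 \<le> A * (4 / \<eta> * Y')" using A1 by (intro mult_left_mono) auto
        then show ?thesis using nn by (simp add: mult_ac)
      next
        case 3
        then have "1 \<le> 4 / \<eta> * Y" using e4[of "r * norm y"] r by (simp add: Y_def powr_mult)
        then have "A * 1 \<le> A * (4 / \<eta> * Y)" using A1 by (intro mult_left_mono) auto
        then show ?thesis using nn by (simp add: mult_ac)
      qed
    qed
    then have "W \<le> A * N + 4 / \<eta> * (A * Y') + 4 / \<eta> * (A * Y) + Y" using W by (simp add: Y_def)
    then have "W * f \<le> (A * N + 4 / \<eta> * (A * Y') + 4 / \<eta> * (A * Y) + Y) * f"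
      using f0 by (intro mult_right_mono) auto
    moreover have "0 \<le> 2 / \<eta> * W" using \<eta> by (simp add: W_def)
    ultimately show ?thesis by linarith
  qed
  have "A * N + 4 / \<eta> * (A * Y') + 4 / \<eta> * (A * Y) + Y \<le>
     (A * N + 8 / \<eta> * (A * (r powr s * (1 + norm y' powr s)))) * (1 + norm y) powr s"
  proof -
    let ?p = "(1 + norm y) powr s"
    have "A * N \<le> A * N * ?p" using mult_left_mono[OF p1, of "A * N"] A1 N by simp
    moreover have "4 / \<eta> * (A * Y') \<le> 4 / \<eta> * (A * Y') * ?p"
      using mult_left_mono[OF p1, of "4 / \<eta> * (A * Y')"] A1 Y0 \<eta> by simp
    moreover have Yp: "Y \<le> r powr s * ?p" unfolding Y_def using p2 by (intro mult_left_mono) auto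
    moreover have "4 / \<eta> * (A * Y) \<le> 4 / \<eta> * (A * (r powr s * ?p))"
      using Yp A1 \<eta> by (intro mult_left_mono) auto
    moreover have "Y \<le> 4 / \<eta> * (A * (r powr s * ?p))"
    proof -
      have "1 * 1 \<le> 4 / \<eta> * A" using A1 \<eta> by (intro mult_mono) (auto simp: field_simps)
      then have "1 * (r powr s * ?p) \<le> (4 / \<eta> * A) * (r powr s * ?p)"
        by (intro mult_right_mono) auto
      then show ?thesis using Yp by (simp add: mult_ac)
    qed
    moreover have "4 / \<eta> * (A * Y') * ?p \<le> 8 / \<eta> * (A * Y') * ?p"
      using A1 Y0 \<eta> by (intro mult_right_mono) (auto simp: field_simps)
    moreover have "(A * N + 8 / \<eta> * (A * (r powr s * (1 + norm y' powr s)))) * ?p =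
      A * N * ?p + 8 / \<eta> * (A * Y') * ?p + 2 * (4 / \<eta> * (A * (r powr s * ?p)))"
      unfolding Y'_def by (simp add: algebra_simps)
    moreover have "x1 + x2 + x3 + x4 \<le> R"
      if "x1 \<le> z1" "x2 \<le> z2'" "x3 \<le> z3" "x4 \<le> z3" "z2' \<le> z2" "R = z1 + z2 + 2 * z3"
      for x1 x2 x3 x4 z1 z2 z2' z3 R :: real
      using that by linarith
    ultimately show ?thesis by blast
  qed
  then have "(A * N + 4 / \<eta> * (A * Y') + 4 / \<eta> * (A * Y) + Y) * f \<le>
     (A * N + 8 / \<eta> * (A * (r powr s * (1 + norm y' powr s)))) * (1 + norm y) powr s * f"
    using f0 by (rule mult_right_mono)
  with key show ?thesis unfolding W_def r_def by (simp add: mult.assoc)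
qed

text \<open>
  The preimage of a hyperplane under a similarity is a hyperplane; distances scale by the ratio.
\<close>

lemma strip_kernel_transport:
  fixes z :: "('d::finite) sim_param" and u y :: "real^'d" and t :: real
  assumes z: "proper_param z" and w: "0 < w" and c: "0 < c"
  defines "v \<equiv> transpose (fst (snd z)) *v u" and "t' \<equiv> (t - u \<bullet> snd (snd z)) / fst z"
  shows "(\<bar>u \<bullet> sim_apply z y - t\<bar> + w) powr (-c)
      \<le> min 1 (fst z) powr (-c) * (\<bar>v \<bullet> y - t'\<bar> + w) powr (-c)"
proof -
  have r: "0 < fst z" using z by (simp add: proper_param_def)
  have "u \<bullet> sim_apply z y - t = fst z * (v \<bullet> y - t')"
    unfolding sim_apply_def sim_map_def v_def t'_def using r
    by (simp add: inner_add_right dot_lmul_matrix[symmetric] field_simps)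
  then have "min 1 (fst z) * (\<bar>v \<bullet> y - t'\<bar> + w) \<le> \<bar>u \<bullet> sim_apply z y - t\<bar> + w"
    using ge_scaled_min[of "\<bar>v \<bullet> y - t'\<bar>" "fst z" w] r w by (simp add: abs_mult)
  then have "(\<bar>u \<bullet> sim_apply z y - t\<bar> + w) powr (-c)
      \<le> (min 1 (fst z) * (\<bar>v \<bullet> y - t'\<bar> + w)) powr (-c)"
    using r w c by (intro powr_mono2') (auto intro!: mult_pos_pos add_nonneg_pos)
  also have "\<dots> = min 1 (fst z) powr (-c) * (\<bar>v \<bullet> y - t'\<bar> + w) powr (-c)"
    using r w by (subst powr_mult) auto
  finally show ?thesis .
qed

text \<open>
  Two applications of \<open>amgm_weighted\<close> separate the factors of the coefficient in
  \<open>strip_kernel_split\<close>, so that only moments of single factors remain.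
\<close>

lemma strip_coefficient_bound:
  fixes z :: "('d::finite) sim_param" and y' :: "real^'d"
  assumes z: "proper_param z" and \<delta>: "0 < \<delta>" and \<eta>: "0 < \<eta>" and s: "0 < s"
    and N: "N = 0 \<or> N = (1::real)" and c: "0 < c"
  defines "A \<equiv> (1 + norm (sim_apply z y')) powr s + fst z powr s * norm y' powr s"
  shows "min 1 (fst z) powr (-c) * (A * N + 8 / \<eta> * (A * (fst z powr s * (1 + norm y' powr s)))) \<le>
    \<delta> / 2 + \<delta> / 2 * fst z powr (- (4 * c)) + 4 * \<delta> * (1 + norm (sim_apply z y')) powr (4 * s)
    + 4 * \<delta> * fst z powr (4 * s) * (1 + norm y') powr (4 * s)
    + 1 / (2 * \<delta>) * N + 128 / (\<eta>\<^sup>2 * \<delta>) * fst z powr (2 * s) * (1 + norm y') powr (4 * s)"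
proof -
  define r q X where "r = fst z" and "q = min 1 r powr (-c)"
      and "X = r powr s * (1 + norm y' powr s)"
  have r: "0 < r" using z by (simp add: r_def proper_param_def)
  have q0: "0 \<le> q" by (simp add: q_def)
  define a b where "a = (1 + norm (sim_apply z y')) powr s" and "b = r powr s * norm y' powr s"
  have ab: "A = a + b" "0 \<le> a" "0 \<le> b" by (auto simp: A_def a_def b_def r_def)
  have sq: "(x + y)\<^sup>2 \<le> 2 * x\<^sup>2 + 2 * y\<^sup>2" for x y :: real
    using sum_squares_bound[of x y] by (simp add: power2_sum)
  have p2: "(x powr e)\<^sup>2 = x powr (2 * e)" for x e :: real
    by (simp add: power2_eq_square powr_add[symmetric])
  have p4: "(x powr e) ^ 4 = x powr (4 * e)" for x e :: real
  proof -
    have "(x powr e) ^ 4 = ((x powr e)\<^sup>2)\<^sup>2" by simp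
    then show ?thesis unfolding p2 by simp
  qed
  have q4: "q ^ 4 \<le> 1 + r powr (- (4 * c))"
  proof -
    have "q ^ 4 = min 1 r powr (- (4 * c))" unfolding q_def p4 by simp
    also have "\<dots> \<le> 1 + r powr (- (4 * c))" by (auto simp: min_def)
    finally show ?thesis .
  qed
  have A4: "A ^ 4 \<le> 8 * (a ^ 4 + b ^ 4)"
  proof -
    have "A ^ 4 = ((a + b)\<^sup>2)\<^sup>2" unfolding ab by simp
    also have "\<dots> \<le> (2 * a\<^sup>2 + 2 * b\<^sup>2)\<^sup>2" by (intro power_mono sq) auto
    also have "\<dots> \<le> 2 * (2 * a\<^sup>2)\<^sup>2 + 2 * (2 * b\<^sup>2)\<^sup>2" by (rule sq)
    also have "\<dots> = 8 * (a ^ 4 + b ^ 4)" by (simp add: power_mult_distrib)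
    finally show ?thesis .
  qed
  have a4: "a ^ 4 = (1 + norm (sim_apply z y')) powr (4 * s)" unfolding a_def p4 ..
  have ny: "norm y' powr (4 * s) \<le> (1 + norm y') powr (4 * s)" using s by (intro powr_mono2) auto
  have b4: "b ^ 4 \<le> r powr (4 * s) * (1 + norm y') powr (4 * s)"
    unfolding b_def power_mult_distrib p4 using ny by (intro mult_left_mono) auto
  have qA: "(q * A)\<^sup>2 \<le> 1 / 2 + r powr (- (4 * c)) / 2 + 4 * a ^ 4 + 4 * b ^ 4"
  proof -
    have "(q * A)\<^sup>2 = q\<^sup>2 * A\<^sup>2" by (rule power_mult_distrib)
    also have "\<dots> \<le> ((q\<^sup>2)\<^sup>2 + (A\<^sup>2)\<^sup>2) / 2" using sum_squares_bound[of "q\<^sup>2" "A\<^sup>2"] by simp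
    also have "\<dots> = (q ^ 4 + A ^ 4) / 2" by simp
    finally show ?thesis using q4 A4 by argo
  qed
  have X2: "X\<^sup>2 \<le> 4 * (r powr (2 * s) * (1 + norm y') powr (4 * s))"
  proof -
    have "(1 + norm y' powr s)\<^sup>2 \<le> 2 + 2 * norm y' powr (2 * s)" using sq[of 1 "norm y' powr s"]
      by (simp add: p2)
    also have "norm y' powr (2 * s) \<le> (1 + norm y') powr (2 * s)" using s by (intro powr_mono2) auto
    also have "(1 + norm y') powr (2 * s) \<le> (1 + norm y') powr (4 * s)" using s
      by (intro powr_mono) auto
    also have "2 + 2 * (1 + norm y') powr (4 * s) \<le> 4 * (1 + norm y') powr (4 * s)"
      using ge_one_powr_ge_zero[of "1 + norm y'" "4 * s"] s by simp
    finally have "(1 + norm y' powr s)\<^sup>2 \<le> 4 * (1 + norm y') powr (4 * s)" by simp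
    then have "r powr (2 * s) * (1 + norm y' powr s)\<^sup>2
        \<le> r powr (2 * s) * (4 * (1 + norm y') powr (4 * s))"
      by (intro mult_left_mono) auto
    then show ?thesis by (simp add: X_def power_mult_distrib p2 mult_ac)
  qed
  have "q * (A * N + 8 / \<eta> * (A * X)) = (q * A) * N + (q * A) * (8 / \<eta> * X)"
    by (simp add: algebra_simps)
  also have "\<dots> \<le> (\<delta> / 2 * (q * A)\<^sup>2 + N\<^sup>2 / (2 * \<delta>))
      + (\<delta> / 2 * (q * A)\<^sup>2 + (8 / \<eta> * X)\<^sup>2 / (2 * \<delta>))"
    by (intro add_mono amgm_weighted \<delta>)
  also have "\<dots> = \<delta> * (q * A)\<^sup>2 + 1 / (2 * \<delta>) * N + 32 / (\<eta>\<^sup>2 * \<delta>) * X\<^sup>2"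
    using N \<eta> \<delta> by (auto simp: power_mult_distrib power_divide field_simps)
  also have "\<dots> \<le> \<delta> * (1 / 2 + r powr (- (4 * c)) / 2 + 4 * a ^ 4
      + 4 * (r powr (4 * s) * (1 + norm y') powr (4 * s)))
     + 1 / (2 * \<delta>) * N + 32 / (\<eta>\<^sup>2 * \<delta>) * (4 * (r powr (2 * s) * (1 + norm y') powr (4 * s)))"
    using \<delta> \<eta> qA b4 X2 by (intro add_mono mult_left_mono) auto
  finally show ?thesis
    unfolding a4 q_def X_def r_def by (simp add: algebra_simps)
qed

context stationary_similarity
begin

text \<open>
  The weighted potential of the strip of width \<open>w\<close> around the hyperplane \<open>{x. u \<bullet> x = t}\<close>. The
  regularisation by \<open>w\<close> keeps it finite.
\<close>

definition strip_potential :: "real \<Rightarrow> real \<Rightarrow> real \<Rightarrow> real^'d \<Rightarrow> real \<Rightarrow> ennreal" where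
  "strip_potential s c w u t
      = (\<integral>\<^sup>+x. ennreal ((1 + norm x) powr s * (\<bar>u \<bullet> x - t\<bar> + w) powr (-c)) \<partial>\<sigma>)"

lemma strip_potential_le:
  assumes w: "0 < w" and c: "0 < c" and s: "0 < s" 
  shows "strip_potential s c w u t
      \<le> ennreal (w powr (-c)) * (\<integral>\<^sup>+x. ennreal ((1 + norm x) powr s) \<partial>\<sigma>)"
proof -
  have "strip_potential s c w u t
      \<le> (\<integral>\<^sup>+x. ennreal (w powr (-c)) * ennreal ((1 + norm x) powr s) \<partial>\<sigma>)"
    unfolding strip_potential_def
  proof (rule nn_integral_mono)
    fix x
    have "(\<bar>u \<bullet> x - t\<bar> + w) powr (-c) \<le> w powr (-c)" using w c by (intro powr_mono2') auto
    then have "(1 + norm x) powr s * (\<bar>u \<bullet> x - t\<bar> + w) powr (-c)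
        \<le> w powr (-c) * (1 + norm x) powr s"
      by (subst mult.commute) (intro mult_right_mono, auto)
    then show "ennreal ((1 + norm x) powr s * (\<bar>u \<bullet> x - t\<bar> + w) powr (-c))
        \<le> ennreal (w powr (-c)) * ennreal ((1 + norm x) powr s)"
      by (subst ennreal_mult[symmetric]) (auto intro: ennreal_leI)
  qed
  also have "\<dots> = ennreal (w powr (-c)) * (\<integral>\<^sup>+x. ennreal ((1 + norm x) powr s) \<partial>\<sigma>)"
    by (rule nn_integral_cmult) simp
  finally show ?thesis .
qed

end

context irreducible_stationary
begin

lemma integrable_one_plus_norm_powr:
  assumes "0 < s" "s \<le> contr_exp"
  shows "integrable \<sigma> (\<lambda>y. (1 + norm y) powr s)"
proof (rule Bochner_Integration.integrable_bound)
  show "integrable \<sigma> (\<lambda>y. 1 + norm y powr s)" using integrable_norm_powr[OF assms] by simp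
  have "(1 + norm y) powr s \<le> 1 powr s + norm y powr s" for y :: "real^'d"
    using assms contr_exp by (intro powr_add_le_add_powr) auto
  then show "AE y in \<sigma>. norm ((1 + norm y) powr s) \<le> norm (1 + norm y powr s)"
    by (auto intro: order_trans[OF _ abs_ge_self])
qed simp

text \<open>
  The self-improving inequality. The coefficient of \<open>V\<close> is made \<open>\<le> 1 / 2\<close> by the choice of, in this
  order, \<open>\<delta>\<close>, \<open>\<eta>\<close>, \<open>n\<close> and \<open>c\<close>.
\<close>

lemma strip_potential_step:
  assumes V: "\<And>u t. norm u = 1 \<Longrightarrow> strip_potential s c w u t \<le> V"
    and u: "norm u = 1" and w: "0 < w" and c: "0 < c" "c \<le> 1" and s: "0 < s" "4 * s = contr_exp"
    and \<eta>: "0 < \<eta>" "\<eta> \<le> 1" and \<delta>: "0 < \<delta>"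
    and mom: "(\<integral>\<^sup>+z. ennreal (fst z powr (- (4 * c))) \<partial>iter_law \<mu> n) \<le> 2"
    and mom2: "(\<integral>\<^sup>+z. ennreal (fst z powr (2 * s)) \<partial>iter_law \<mu> n) \<le> ennreal \<kappa>" and \<kappa>: "0 \<le> \<kappa>"
    and M: "(\<integral>\<^sup>+x. ennreal ((1 + norm x) powr (4 * s)) \<partial>\<sigma>) = ennreal M" "1 \<le> M"
    and strip: "\<And>u t. norm u = 1 \<Longrightarrow> measure \<sigma> {x. \<bar>u \<bullet> x - t\<bar> < \<eta>} \<le> \<rho>"
  shows "strip_potential s c w u t \<le> ennreal (2 / \<eta> * M) +
    ennreal (\<delta> * (3 / 2 + 8 * M) + \<rho> / (2 * \<delta>) + 128 / (\<eta>\<^sup>2 * \<delta>) * \<kappa> * M) * V"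
proof -
  let ?\<nu> = "iter_law \<mu> n"
  interpret I: stationary_similarity ?\<nu> \<sigma>
    by (rule iter_law_stationary) unfold_locales
  have s1: "s \<le> 1" using s contr_exp by simp
  let ?h = "\<lambda>x :: real^'d. (1 + norm x) powr (4 * s)"
  define B where "B = {x. \<bar>u \<bullet> x - t\<bar> < \<eta>}"
  have [measurable]: "B \<in> sets borel" unfolding B_def by measurable
  define k where "k z y' = \<delta> / 2 + \<delta> / 2 * fst z powr (- (4 * c)) + 4 * \<delta> * ?h (sim_apply z y')
    + 4 * \<delta> * fst z powr (4 * s) * ?h y'
    + 1 / (2 * \<delta>) * indicator B (sim_apply z y')
        + 128 / (\<eta>\<^sup>2 * \<delta>) * fst z powr (2 * s) * ?h y'" for z y'
  have k0: "0 \<le> k z y'" for z y' unfolding k_def using \<delta> by (intro add_nonneg_nonneg) auto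
  have [measurable]: "(\<lambda>(z, y'). k z y') \<in> borel_measurable (borel \<Otimes>\<^sub>M borel)"
    unfolding k_def by measurable
  let ?F = "\<lambda>x. (1 + norm x) powr s * (\<bar>u \<bullet> x - t\<bar> + w) powr (-c)"
  have inner: "(\<integral>\<^sup>+y. ennreal (?F (sim_apply z y)) \<partial>\<sigma>) \<le>
     ennreal (2 / \<eta>) * (\<integral>\<^sup>+y. ennreal ((1 + norm (sim_apply z y)) powr s) \<partial>\<sigma>)
         + ennreal (k z y') * V"
    if z: "proper_param z" for z y'
  proof -
    define A where "A = (1 + norm (sim_apply z y')) powr s + fst z powr s * norm y' powr s"
    define N where "N = (indicator B (sim_apply z y') :: real)"
    define G where "G = A * N + 8 / \<eta> * (A * (fst z powr s * (1 + norm y' powr s)))"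
    have G0: "0 \<le> G" unfolding G_def A_def N_def using \<eta>
      by (auto intro!: add_nonneg_nonneg mult_nonneg_nonneg)
    define v where "v = transpose (fst (snd z)) *v u"
    define t' where "t' = (t - u \<bullet> snd (snd z)) / fst z"
    have "orthogonal_matrix (transpose (fst (snd z)))"
      using z by (simp add: proper_param_def orthogonal_matrix_transpose)
    then have v: "norm v = 1" unfolding v_def using u by (subst norm_orthogonal_matrix)
    let ?q = "min 1 (fst z) powr (-c)"
    have "(\<integral>\<^sup>+y. ennreal (?F (sim_apply z y)) \<partial>\<sigma>) \<le>
       (\<integral>\<^sup>+y. ennreal (2 / \<eta>) * ennreal ((1 + norm (sim_apply z y)) powr s) +
         ennreal (?q * G) * ennreal ((1 + norm y) powr s * (\<bar>v \<bullet> y - t'\<bar> + w) powr (-c)) \<partial>\<sigma>)"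
    proof (rule nn_integral_mono)
      fix y
      have "?F (sim_apply z y) \<le> 2 / \<eta> * (1 + norm (sim_apply z y)) powr s +
         G * ((1 + norm y) powr s * (\<bar>u \<bullet> sim_apply z y - t\<bar> + w) powr (-c))"
        using strip_kernel_split[OF z u w c \<eta> s(1) s1, of y t y'] unfolding G_def A_def N_def B_def
          by simp
      also have "\<dots> \<le> 2 / \<eta> * (1 + norm (sim_apply z y)) powr s +
         G * ((1 + norm y) powr s * (?q * (\<bar>v \<bullet> y - t'\<bar> + w) powr (-c)))"
        using strip_kernel_transport[OF z w c(1), of u y t] G0 unfolding v_def t'_def
        by (intro add_left_mono mult_left_mono) auto
      also have "\<dots> = 2 / \<eta> * (1 + norm (sim_apply z y)) powr s +
         (?q * G) * ((1 + norm y) powr s * (\<bar>v \<bullet> y - t'\<bar> + w) powr (-c))" by (simp add: mult_ac)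
      finally have "ennreal (?F (sim_apply z y))
          \<le> ennreal (2 / \<eta> * (1 + norm (sim_apply z y)) powr s +
         (?q * G) * ((1 + norm y) powr s * (\<bar>v \<bullet> y - t'\<bar> + w) powr (-c)))" by (rule ennreal_leI)
      also have "\<dots> = ennreal (2 / \<eta>) * ennreal ((1 + norm (sim_apply z y)) powr s) +
         ennreal (?q * G) * ennreal ((1 + norm y) powr s * (\<bar>v \<bullet> y - t'\<bar> + w) powr (-c))"
        using \<eta> G0 by (subst ennreal_plus)
            (auto simp: ennreal_mult[symmetric] simp del: ennreal_plus)
      finally show "ennreal (?F (sim_apply z y))
          \<le> ennreal (2 / \<eta>) * ennreal ((1 + norm (sim_apply z y)) powr s) +
         ennreal (?q * G) * ennreal ((1 + norm y) powr s * (\<bar>v \<bullet> y - t'\<bar> + w) powr (-c))" .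
    qed
    also have "\<dots> = ennreal (2 / \<eta>) * (\<integral>\<^sup>+y. ennreal ((1 + norm (sim_apply z y)) powr s) \<partial>\<sigma>) +
        ennreal (?q * G) * strip_potential s c w v t'"
      unfolding strip_potential_def by (simp add: nn_integral_add nn_integral_cmult)
    also have "ennreal (?q * G) * strip_potential s c w v t' \<le> ennreal (k z y') * V"
    proof (intro mult_mono ennreal_leI)
      have "N = 0 \<or> N = 1" by (auto simp: N_def split: split_indicator)
      then show "?q * G \<le> k z y'"
        unfolding G_def A_def k_def N_def[symmetric]
        by (rule strip_coefficient_bound[OF z \<delta> \<eta>(1) s(1) _ c(1)])
    qed (use V[OF v] in auto)
    finally show ?thesis by (simp add: add_left_mono)
  qed
  let ?J = "\<lambda>z. \<integral>\<^sup>+y. ennreal ((1 + norm (sim_apply z y)) powr s) \<partial>\<sigma>"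
  have "(\<integral>\<^sup>+z. ?J z \<partial>?\<nu>) = (\<integral>\<^sup>+x. ennreal ((1 + norm x) powr s) \<partial>\<sigma>)"
    by (rule I.nn_stationary[symmetric]) measurable
  also have "\<dots> \<le> (\<integral>\<^sup>+x. ennreal ((1 + norm x) powr (4 * s)) \<partial>\<sigma>)"
    using s by (intro nn_integral_mono ennreal_leI powr_mono) auto
  also have "\<dots> = ennreal M" by (rule M)
  finally have J_le: "(\<integral>\<^sup>+z. ?J z \<partial>?\<nu>) \<le> ennreal M" .
  have K_le: "(\<integral>\<^sup>+z. \<integral>\<^sup>+y'. ennreal (k z y') \<partial>\<sigma> \<partial>?\<nu>)
      \<le> ennreal (\<delta> * (3 / 2 + 8 * M) + \<rho> / (2 * \<delta>) + 128 / (\<eta>\<^sup>2 * \<delta>) * \<kappa> * M)"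
  proof -
    have \<rho>0: "0 \<le> \<rho>" using strip[OF u, of 0] measure_nonneg[of \<sigma>] order_trans by blast
    have mom4: "(\<integral>\<^sup>+z. ennreal (fst z powr (4 * s)) \<partial>?\<nu>) \<le> 1"
    proof -
      have i: "integrable \<mu> (\<lambda>z. fst z powr (4 * s))"
        by (rule integrable_ratio_powr) (use s contr_exp in auto)
      have "(\<integral>\<^sup>+z. ennreal (fst z powr (4 * s)) \<partial>\<mu>)
          = ennreal (expectation (\<lambda>z. fst z powr (4 * s)))"
        by (rule nn_integral_eq_integral[OF i]) auto
      also have "\<dots> \<le> 1" using contr_exp(4)[of "4 * s"] s by (simp add: ennreal_le_1)
      finally have "(\<integral>\<^sup>+z. ennreal (fst z powr (4 * s)) \<partial>\<mu>) ^ n \<le> 1"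
        by (rule power_le_one[OF zero_le])
      then show ?thesis by (subst iter_law_moment) unfold_locales
    qed
    have split: "ennreal (k z y') = ennreal (\<delta> / 2)
        + ennreal (\<delta> / 2) * ennreal (fst z powr (- (4 * c)))
        + ennreal (4 * \<delta>) * ennreal (?h (sim_apply z y'))
      + ennreal (4 * \<delta>) * ennreal (fst z powr (4 * s)) * ennreal (?h y')
      + ennreal (1 / (2 * \<delta>)) * indicator B (sim_apply z y')
          + ennreal (128 / (\<eta>\<^sup>2 * \<delta>)) * ennreal (fst z powr (2 * s)) * ennreal (?h y')" for z y'
    proof -
      have gen: "ennreal (d1 + d1 * x + d2 * h1 + d2 * p * h2 + d3 * N + d4 * q * h2) =
          ennreal d1 + ennreal d1 * ennreal x + ennreal d2 * ennreal h1
              + ennreal d2 * ennreal p * ennreal h2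
          + ennreal d3 * ennreal N + ennreal d4 * ennreal q * ennreal h2"
        if "0 \<le> d1" "0 \<le> d2" "0 \<le> d3" "0 \<le> d4" "0 \<le> x" "0 \<le> h1" "0 \<le> h2" "0 \<le> p" "0 \<le> q" "0 \<le> N"
        for d1 d2 d3 d4 x h1 h2 p q N :: real
        using that by (simp add: ennreal_mult)
      show ?thesis
        unfolding k_def ennreal_indicator[symmetric] by (rule gen) (use \<delta> in auto)
    qed
    have B_meas: "(\<integral>\<^sup>+z. \<integral>\<^sup>+y'. indicator B (sim_apply z y') \<partial>\<sigma> \<partial>?\<nu>) = ennreal (measure \<sigma> B)"
    proof -
      have "(\<integral>\<^sup>+x. indicator B x \<partial>\<sigma>) = (\<integral>\<^sup>+z. \<integral>\<^sup>+y'. indicator B (sim_apply z y') \<partial>\<sigma> \<partial>?\<nu>)"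
        by (rule I.nn_stationary) measurable
      then show ?thesis by (simp add: sig.emeasure_eq_measure)
    qed
    have h_meas: "(\<integral>\<^sup>+z. \<integral>\<^sup>+y'. ennreal (?h (sim_apply z y')) \<partial>\<sigma> \<partial>?\<nu>) = ennreal M"
      unfolding M(1)[symmetric] by (rule I.nn_stationary[symmetric]) measurable
    have "(\<integral>\<^sup>+z. \<integral>\<^sup>+y'. ennreal (k z y') \<partial>\<sigma> \<partial>?\<nu>) = ennreal (\<delta> / 2)
        + ennreal (\<delta> / 2) * (\<integral>\<^sup>+z. ennreal (fst z powr (- (4 * c))) \<partial>?\<nu>)
        + ennreal (4 * \<delta>) * ennreal M
      + ennreal (4 * \<delta>) * (\<integral>\<^sup>+z. ennreal (fst z powr (4 * s)) \<partial>?\<nu>) * ennreal M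
      + ennreal (1 / (2 * \<delta>)) * ennreal (measure \<sigma> B)
          + ennreal (128 / (\<eta>\<^sup>2 * \<delta>)) * (\<integral>\<^sup>+z. ennreal (fst z powr (2 * s)) \<partial>?\<nu>) * ennreal M"
      unfolding split B_meas[symmetric] h_meas[symmetric]
      by (simp add: nn_integral_add nn_integral_cmult nn_integral_multc M(1) h_meas
          sig.emeasure_space_1[simplified] I.emeasure_space_1[simplified])
    also have "\<dots> \<le> ennreal (\<delta> / 2) + ennreal (\<delta> / 2) * 2 + ennreal (4 * \<delta>) * ennreal M
      + ennreal (4 * \<delta>) * 1 * ennreal M
      + ennreal (1 / (2 * \<delta>)) * ennreal \<rho> + ennreal (128 / (\<eta>\<^sup>2 * \<delta>)) * ennreal \<kappa> * ennreal M"
      using strip[OF u, of t] unfolding B_def[symmetric]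
      by (intro add_mono mult_mono mom mom2 mom4 order_refl ennreal_leI) auto
    also have "\<dots> = ennreal (\<delta> / 2 + \<delta> / 2 * 2 + 4 * \<delta> * M + 4 * \<delta> * 1 * M + 1 / (2 * \<delta>) * \<rho>
        + 128 / (\<eta>\<^sup>2 * \<delta>) * \<kappa> * M)"
    proof -
      have "ennreal d1 + ennreal d1' * ennreal a + ennreal d2 * ennreal M
          + ennreal d2' * ennreal b * ennreal M
          + ennreal d3 * ennreal \<rho> + ennreal d4 * ennreal \<kappa> * ennreal M
        = ennreal (d1 + d1' * a + d2 * M + d2' * b * M + d3 * \<rho> + d4 * \<kappa> * M)"
        if "0 \<le> d1" "0 \<le> d1'" "0 \<le> d2" "0 \<le> d2'" "0 \<le> d3" "0 \<le> d4" "0 \<le> a" "0 \<le> b"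
        for d1 d1' d2 d2' d3 d4 a b
        using that M(2) \<kappa> \<rho>0 by (simp add: ennreal_mult)
      from this[of "\<delta> / 2" "\<delta> / 2" "4 * \<delta>" "4 * \<delta>" "1 / (2 * \<delta>)" "128 / (\<eta>\<^sup>2 * \<delta>)" 2 1] \<delta>
      show ?thesis unfolding ennreal_numeral ennreal_1 by fastforce
    qed
    also have "\<delta> / 2 + \<delta> / 2 * 2 + 4 * \<delta> * M + 4 * \<delta> * 1 * M + 1 / (2 * \<delta>) * \<rho>
        + 128 / (\<eta>\<^sup>2 * \<delta>) * \<kappa> * M
      = \<delta> * (3 / 2 + 8 * M) + \<rho> / (2 * \<delta>) + 128 / (\<eta>\<^sup>2 * \<delta>) * \<kappa> * M" by (simp add: algebra_simps)
    finally show ?thesis .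
  qed
  have "strip_potential s c w u t = (\<integral>\<^sup>+z. \<integral>\<^sup>+y. ennreal (?F (sim_apply z y)) \<partial>\<sigma> \<partial>?\<nu>)"
    unfolding strip_potential_def by (rule I.nn_stationary) measurable
  also have "\<dots> \<le> (\<integral>\<^sup>+z. ennreal (2 / \<eta>) * ?J z + (\<integral>\<^sup>+y'. ennreal (k z y') \<partial>\<sigma>) * V \<partial>?\<nu>)"
  proof (rule nn_integral_mono_AE)
    show "AE z in ?\<nu>. (\<integral>\<^sup>+y. ennreal (?F (sim_apply z y)) \<partial>\<sigma>) \<le> ennreal (2 / \<eta>) * ?J z
        + (\<integral>\<^sup>+y'. ennreal (k z y') \<partial>\<sigma>) * V"
      using I.AE_proper
    proof eventually_elim
      case (elim z)
      have "(\<integral>\<^sup>+y. ennreal (?F (sim_apply z y)) \<partial>\<sigma>)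
          = (\<integral>\<^sup>+y'. (\<integral>\<^sup>+y. ennreal (?F (sim_apply z y)) \<partial>\<sigma>) \<partial>\<sigma>)"
        by (simp add: sig.emeasure_space_1[simplified])
      also have "\<dots> \<le> (\<integral>\<^sup>+y'. ennreal (2 / \<eta>) * ?J z + ennreal (k z y') * V \<partial>\<sigma>)"
        by (intro nn_integral_mono inner elim)
      also have "\<dots> = ennreal (2 / \<eta>) * ?J z + (\<integral>\<^sup>+y'. ennreal (k z y') \<partial>\<sigma>) * V"
        by (simp add: nn_integral_add nn_integral_multc sig.emeasure_space_1[simplified])
      finally show ?case .
    qed
  qed
  also have "\<dots> = ennreal (2 / \<eta>) * (\<integral>\<^sup>+z. ?J z \<partial>?\<nu>) + (\<integral>\<^sup>+z. \<integral>\<^sup>+y'. ennreal (k z y') \<partial>\<sigma> \<partial>?\<nu>) * V"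
    by (simp add: nn_integral_add nn_integral_multc nn_integral_cmult)
  also have "\<dots> \<le> ennreal (2 / \<eta>) * ennreal M +
      ennreal (\<delta> * (3 / 2 + 8 * M) + \<rho> / (2 * \<delta>) + 128 / (\<eta>\<^sup>2 * \<delta>) * \<kappa> * M) * V"
    by (intro add_mono mult_left_mono mult_right_mono J_le K_le) auto
  also have "ennreal (2 / \<eta>) * ennreal M = ennreal (2 / \<eta> * M)"
    using \<eta> M by (subst ennreal_mult[symmetric]) auto
  finally show ?thesis .
qed

text \<open>
  The constant \<open>\<delta>\<close> depends only on the moment \<open>M\<close>, the width \<open>\<eta>\<close> on \<open>\<delta>\<close>, the number of steps \<open>n\<close> on
  \<open>\<eta>\<close> and \<open>\<delta>\<close>, and the exponent \<open>c\<close> on \<open>n\<close>. The contributions to the coefficient of \<open>V\<close> are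
  \<open>1 / 4\<close>, \<open>1 / 8\<close> and \<open>1 / 8\<close>.
\<close>

lemma strip_potential_bounded:
  "\<exists>s>0. \<exists>c>0. \<exists>a\<ge>0. \<forall>u t w. norm u = 1 \<longrightarrow> 0 < w \<longrightarrow> strip_potential s c w u t \<le> ennreal a"
proof -
  define s where "s = contr_exp / 4"
  have s: "0 < s" "4 * s = contr_exp" using contr_exp by (auto simp: s_def)
  have i: "integrable \<sigma> (\<lambda>x. (1 + norm x) powr (4 * s))"
    by (rule integrable_one_plus_norm_powr) (use s in auto)
  define M where "M = (\<integral>x. (1 + norm x) powr (4 * s) \<partial>\<sigma>)"
  have M1: "1 \<le> M"
    unfolding M_def using s by (intro sig.integral_ge_const i AE_I2 ge_one_powr_ge_zero) auto
  have M: "(\<integral>\<^sup>+x. ennreal ((1 + norm x) powr (4 * s)) \<partial>\<sigma>) = ennreal M"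
    unfolding M_def by (rule nn_integral_eq_integral[OF i]) auto
  define \<delta> where "\<delta> = 1 / (4 * (3 / 2 + 8 * M))"
  have \<delta>: "0 < \<delta>" "\<delta> * (3 / 2 + 8 * M) = 1 / 4" using M1 by (auto simp: \<delta>_def field_simps)
  obtain \<eta>' where \<eta>': "0 < \<eta>'" "\<And>u t. norm u = 1 \<Longrightarrow> measure \<sigma> {x. \<bar>u \<bullet> x - t\<bar> \<le> \<eta>'} < \<delta> / 4"
    using strip_uniformly_small[of "\<delta> / 4"] \<delta> by auto
  define \<eta> where "\<eta> = min 1 \<eta>'"
  have \<eta>: "0 < \<eta>" "\<eta> \<le> 1" using \<eta>' by (auto simp: \<eta>_def)
  have strip: "measure \<sigma> {x. \<bar>u \<bullet> x - t\<bar> < \<eta>} \<le> \<delta> / 4" if "norm u = 1" for u t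
  proof -
    have "measure \<sigma> {x. \<bar>u \<bullet> x - t\<bar> < \<eta>} \<le> measure \<sigma> {x. \<bar>u \<bullet> x - t\<bar> \<le> \<eta>'}"
      by (rule sig.finite_measure_mono) (auto simp: \<eta>_def)
    with \<eta>'(2)[OF that, of t] show ?thesis by simp
  qed
  define \<kappa> where "\<kappa> = \<eta>\<^sup>2 * \<delta> / (1024 * M)"
  have \<kappa>: "0 < \<kappa>" "128 / (\<eta>\<^sup>2 * \<delta>) * \<kappa> * M = 1 / 8"
    using \<eta> \<delta> M1 by (auto simp: \<kappa>_def field_simps)
  define \<theta> where "\<theta> = expectation (\<lambda>z. fst z powr (2 * s))"
  have \<theta>: "0 \<le> \<theta>" "\<theta> < 1" unfolding \<theta>_def using s contr_exp(4)[of "2 * s"] by auto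
  obtain n where n: "\<theta> ^ n < \<kappa>" using real_arch_pow_inv[OF \<kappa>(1) \<theta>(2)] by blast
  have mom2: "(\<integral>\<^sup>+z. ennreal (fst z powr (2 * s)) \<partial>iter_law \<mu> n) \<le> ennreal \<kappa>"
  proof -
    have i: "integrable \<mu> (\<lambda>z. fst z powr (2 * s))"
      by (rule integrable_ratio_powr) (use s contr_exp in auto)
    have "(\<integral>\<^sup>+z. ennreal (fst z powr (2 * s)) \<partial>\<mu>) = ennreal \<theta>"
      unfolding \<theta>_def by (rule nn_integral_eq_integral[OF i]) auto
    then have "(\<integral>\<^sup>+z. ennreal (fst z powr (2 * s)) \<partial>iter_law \<mu> n) = ennreal (\<theta> ^ n)"
      using \<theta> by (subst iter_law_moment) (unfold_locales, simp add: ennreal_power)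
    then show ?thesis using n by (simp add: ennreal_leI)
  qed
  define \<Theta> where "\<Theta> = expectation (\<lambda>z. fst z powr (- exponent))"
  have \<Theta>: "0 \<le> \<Theta>" unfolding \<Theta>_def by simp
  obtain k where k: "max (\<Theta> ^ n) (max exponent 1) \<le> real k" using real_arch_simple by blast
  \<comment> \<open>a tiny exponent keeps the negative moment of the \<open>n\<close>-step ratio below 2\<close>
  define c where "c = exponent / (4 * real k)"
  have k1: "1 \<le> real k" "exponent \<le> real k" "\<Theta> ^ n \<le> real k" using k by auto
  have c: "0 < c" "c \<le> 1" using k1 exponent_pos by (auto simp: c_def field_simps)
  have mom: "(\<integral>\<^sup>+z. ennreal (fst z powr (- (4 * c))) \<partial>iter_law \<mu> n) \<le> 2"
  proof -
    interpret I: random_similarity "iter_law \<mu> n"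
      by (rule iter_law_random_similarity) unfold_locales
    have i: "integrable \<mu> (\<lambda>z. fst z powr (- exponent))"
      by (rule integrable_ratio_powr) (use exponent_pos in auto)
    have "(\<integral>\<^sup>+z. ennreal (fst z powr (- exponent)) \<partial>\<mu>) = ennreal \<Theta>"
      unfolding \<Theta>_def by (rule nn_integral_eq_integral[OF i]) auto
    then have e: "(\<integral>\<^sup>+z. ennreal (fst z powr (- exponent)) \<partial>iter_law \<mu> n) = ennreal (\<Theta> ^ n)"
      using \<Theta> by (subst iter_law_moment) (unfold_locales, simp add: ennreal_power)
    have "(\<integral>\<^sup>+z. ennreal (fst z powr (- (4 * c))) \<partial>iter_law \<mu> n)
        \<le> (\<integral>\<^sup>+z. 1 + ennreal (1 / real k) * ennreal (fst z powr (- exponent)) \<partial>iter_law \<mu> n)"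
    proof (rule nn_integral_mono_AE)
      show "AE z in iter_law \<mu> n. ennreal (fst z powr (- (4 * c))) \<le> 1
          + ennreal (1 / real k) * ennreal (fst z powr (- exponent))"
        using I.AE_proper
      proof eventually_elim
        case (elim z)
        then have r: "0 < 1 / fst z" by (simp add: proper_param_def)
        have p: "(1 / fst z) powr e = fst z powr (- e)" for e
          using r by (simp add: powr_def ln_div)
        have "4 * c / exponent = 1 / real k" using exponent_pos k1 by (simp add: c_def)
        moreover have "4 * c \<le> exponent" using k1 exponent_pos by (simp add: c_def field_simps)
        ultimately have "fst z powr (- (4 * c)) \<le> 1 + 1 / real k * (fst z powr (- exponent) - 1)"
          using powr_le_linear_interpolation[OF r, of "4 * c" exponent] c unfolding p by simp
        also have "\<dots> \<le> 1 + 1 / real k * fst z powr (- exponent)"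
          by (intro add_left_mono mult_left_mono) auto
        finally show ?case
          using k1 by (subst ennreal_mult[symmetric], simp, simp, subst ennreal_1[symmetric], subst
              ennreal_plus[symmetric])
            (auto intro!: ennreal_leI simp del: ennreal_plus ennreal_1)
      qed
    qed
    also have "\<dots> = 1 + ennreal (1 / real k) * ennreal (\<Theta> ^ n)"
      using I.emeasure_space_1 by (simp add: nn_integral_add nn_integral_cmult e)
    also have "\<dots> = ennreal (1 + 1 / real k * \<Theta> ^ n)"
      using \<Theta> by (simp add: ennreal_mult[symmetric])
    also have "\<dots> \<le> ennreal 2" using k1 by (intro ennreal_leI) (simp add: field_simps)
    finally show ?thesis by simp
  qed
  define a where "a = 2 / \<eta> * M"
  have a0: "0 \<le> a" using \<eta> M1 by (simp add: a_def)
  have "strip_potential s c w u t \<le> ennreal (2 * a)" if w: "0 < w" and u: "norm u = 1" for w u t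
  proof -
    define V where "V = (SUP p\<in>{v. norm v = 1} \<times> UNIV. strip_potential s c w (fst p) (snd p))"
    have V: "strip_potential s c w v t \<le> V" if "norm v = 1" for v t
      unfolding V_def using that by (intro SUP_upper2[of "(v, t)"]) auto
    have fin: "V \<le> ennreal (w powr (-c) * M)"
      unfolding V_def
    proof (rule SUP_least)
      fix p :: "(real^'d) \<times> real"
      have "strip_potential s c w (fst p) (snd p)
          \<le> ennreal (w powr (-c)) * (\<integral>\<^sup>+x. ennreal ((1 + norm x) powr s) \<partial>\<sigma>)"
        by (rule strip_potential_le[OF w c(1) s(1)])
      also have "\<dots> \<le> ennreal (w powr (-c)) * (\<integral>\<^sup>+x. ennreal ((1 + norm x) powr (4 * s)) \<partial>\<sigma>)"
        using s by (intro mult_left_mono nn_integral_mono ennreal_leI powr_mono) auto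
      also have "\<dots> = ennreal (w powr (-c) * M)" unfolding M using M1 by (subst ennreal_mult) auto
      finally show "strip_potential s c w (fst p) (snd p) \<le> ennreal (w powr (-c) * M)" .
    qed
    have "V \<le> ennreal a + ennreal (1 / 2) * V"
      unfolding V_def
    proof (rule SUP_least)
      fix p :: "(real^'d) \<times> real" assume "p \<in> {v. norm v = 1} \<times> UNIV"
      then have v: "norm (fst p) = 1" by auto
      have half: "\<delta> * (3 / 2 + 8 * M) + (\<delta> / 4) / (2 * \<delta>) + 128 / (\<eta>\<^sup>2 * \<delta>) * \<kappa> * M = 1 / 2"
        unfolding \<delta>(2) \<kappa>(2) using \<delta>(1) by simp
      show "strip_potential s c w (fst p) (snd p) \<le> ennreal a
          + ennreal (1 / 2) * (SUP p\<in>{v. norm v = 1} \<times> UNIV. strip_potential s c w (fst p) (snd p))"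
        using strip_potential_step[OF V v w c s \<eta> \<delta>(1) mom mom2 less_imp_le[OF \<kappa>(1)] M M1 strip, of
            "snd p"]
        unfolding half a_def V_def .
    qed
    moreover obtain v where v: "V = ennreal v" "0 \<le> v"
      using fin by (cases V) (auto simp: top_unique)
    moreover have "ennreal a + ennreal (1 / 2) * ennreal v = ennreal (a + 1 / 2 * v)"
      using a0 v(2) by (subst ennreal_mult[symmetric], simp, simp, subst ennreal_plus) auto
    ultimately have "ennreal v \<le> ennreal (a + 1 / 2 * v)" by simp
    then have "v \<le> a + 1 / 2 * v" using a0 v by (subst (asm) ennreal_le_iff) auto
    then have "V \<le> ennreal (2 * a)" using v by (auto intro: ennreal_leI)
    with V[OF u, of t] show ?thesis by (rule order_trans)
  qed
  then show ?thesis
    using s(1) c(1) a0 by (intro exI[of _ s] exI[of _ c] exI[of _ "2 * a"] conjI) auto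
qed

lemma strip_decay:
  "\<exists>C>0. \<exists>c>0. \<forall>u t w. norm u = 1 \<longrightarrow> 0 < w \<longrightarrow> measure \<sigma> {x. \<bar>u \<bullet> x - t\<bar> \<le> w} \<le> C * w powr c"
proof -
  obtain s c a where s: "0 < s" and c: "0 < c" and a: "0 \<le> a"
    and bd: "\<And>u t w. norm u = 1 \<Longrightarrow> 0 < w \<Longrightarrow> strip_potential s c w u t \<le> ennreal a"
    using strip_potential_bounded by metis
  have "measure \<sigma> {x. \<bar>u \<bullet> x - t\<bar> \<le> w} \<le> (a + 1) * 2 powr c * w powr c" if u: "norm u = 1"
      and w: "0 < w" for u t w
  proof -
    let ?A = "{x. \<bar>u \<bullet> x - t\<bar> \<le> w}"
    have [measurable]: "?A \<in> sets borel" by measurable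
    have "ennreal ((2 * w) powr (-c)) * emeasure \<sigma> ?A
        = (\<integral>\<^sup>+x. ennreal ((2 * w) powr (-c)) * indicator ?A x \<partial>\<sigma>)"
      by (simp add: nn_integral_cmult_indicator)
    also have "\<dots> \<le> strip_potential s c w u t"
      unfolding strip_potential_def
    proof (rule nn_integral_mono)
      fix x
      show "ennreal ((2 * w) powr (-c)) * indicator ?A x
          \<le> ennreal ((1 + norm x) powr s * (\<bar>u \<bullet> x - t\<bar> + w) powr (-c))"
      proof (cases "x \<in> ?A")
        case True
        then have "(2 * w) powr (-c) \<le> (\<bar>u \<bullet> x - t\<bar> + w) powr (-c)" using w c
          by (intro powr_mono2') auto
        also have "\<dots> \<le> (1 + norm x) powr s * (\<bar>u \<bullet> x - t\<bar> + w) powr (-c)"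
          using mult_right_mono[of 1 "(1 + norm x) powr s" "(\<bar>u \<bullet> x - t\<bar> + w) powr (-c)"] s
              ge_one_powr_ge_zero[of "1 + norm x" s] by simp
        finally show ?thesis using True by (simp add: ennreal_leI)
      qed simp
    qed
    also have "\<dots> \<le> ennreal a" by (rule bd[OF u w])
    finally have "ennreal ((2 * w) powr (-c) * measure \<sigma> ?A) \<le> ennreal a"
      by (simp add: sig.emeasure_eq_measure ennreal_mult)
    then have "(2 * w) powr (-c) * measure \<sigma> ?A \<le> a" using a by (simp add: ennreal_le_iff)
    then have "measure \<sigma> ?A \<le> a * (2 * w) powr c" using w by (simp add: powr_minus field_simps)
    also have "\<dots> \<le> (a + 1) * (2 * w) powr c" by (intro mult_right_mono) auto
    finally show ?thesis using w by (simp add: powr_mult mult.assoc)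
  qed
  then show ?thesis
    using a c by (intro exI[of _ "(a + 1) * 2 powr c"] exI[of _ c] conjI) auto
qed

section \<open>Tails, and ratios of long products\<close>

lemma tail_decay:
  assumes "0 < R" "0 < s" "s \<le> contr_exp"
  shows "measure \<sigma> {x. R < norm x} \<le> (\<integral>x. norm x powr s \<partial>\<sigma>) * R powr (-s)"
proof -
  have "measure \<sigma> {x. R < norm x} = (\<integral>x. indicator {x. R < norm x} x \<partial>\<sigma>)" by simp
  also have "\<dots> \<le> (\<integral>x. R powr (-s) * norm x powr s \<partial>\<sigma>)"
  proof (rule Bochner_Integration.integral_mono)
    fix x
    show "indicator {x. R < norm x} x \<le> R powr (-s) * norm x powr s"
    proof (cases "R < norm x")
      case True
      then have "R powr s \<le> norm x powr s" using assms by (intro powr_mono2) auto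
      then show ?thesis using True assms by (simp add: powr_minus field_simps)
    qed simp
  qed (use integrable_norm_powr assms in \<open>auto simp: less_top[symmetric]\<close>)
  finally show ?thesis by (simp add: mult.commute)
qed

text \<open>
  For \<open>n\<close> about \<open>\<tau> * ln (1 / \<epsilon>)\<close>, Markov's inequality for the moments of order \<open>s\<close> and \<open>- s\<close>
  confines the ratio to \<open>{\<epsilon> powr (1/2)..\<epsilon> powr B}\<close> with high probability.
\<close>

lemma iter_law_ratio_concentrated:
  "\<exists>B>0. \<exists>D>0. \<exists>c>0. \<forall>\<epsilon>. 0 < \<epsilon> \<longrightarrow> \<epsilon> < 1 \<longrightarrow>
     (\<exists>n. emeasure (iter_law \<mu> n) {z. \<epsilon> powr B < fst z} \<le> ennreal (D * \<epsilon> powr c) \<and>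
          emeasure (iter_law \<mu> n) {z. fst z < \<epsilon> powr (1/2)} \<le> ennreal (D * \<epsilon> powr c))"
proof -
  define s where "s = contr_exp"
  have s: "0 < s" "s \<le> exponent" using contr_exp by (auto simp: s_def)
  define \<theta> where "\<theta> = max (1/2) (expectation (\<lambda>z. fst z powr s))"
  define \<Theta> where "\<Theta> = max 2 (expectation (\<lambda>z. fst z powr (- s)))"
  have \<theta>: "0 < \<theta>" "\<theta> < 1" using contr_exp(4)[of s] s by (auto simp: \<theta>_def s_def)
  have \<Theta>: "2 \<le> \<Theta>" by (simp add: \<Theta>_def)
  have mom: "(\<integral>\<^sup>+z. ennreal (fst z powr s) \<partial>iter_law \<mu> n) \<le> ennreal (\<theta> ^ n)" for n
  proof -
    have i: "integrable \<mu> (\<lambda>z. fst z powr s)" by (rule integrable_ratio_powr) (use s in auto)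
    have "(\<integral>\<^sup>+z. ennreal (fst z powr s) \<partial>\<mu>) = ennreal (expectation (\<lambda>z. fst z powr s))"
      by (rule nn_integral_eq_integral[OF i]) auto
    also have "\<dots> \<le> ennreal \<theta>" by (intro ennreal_leI) (simp add: \<theta>_def)
    finally have "(\<integral>\<^sup>+z. ennreal (fst z powr s) \<partial>\<mu>) ^ n \<le> ennreal \<theta> ^ n" by (rule power_mono) simp
    then show ?thesis using \<theta> by (subst iter_law_moment) (unfold_locales, simp add: ennreal_power)
  qed
  have mom': "(\<integral>\<^sup>+z. ennreal (fst z powr (- s)) \<partial>iter_law \<mu> n) \<le> ennreal (\<Theta> ^ n)" for n
  proof -
    have i: "integrable \<mu> (\<lambda>z. fst z powr (- s))" by (rule integrable_ratio_powr) (use s in auto)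
    have "(\<integral>\<^sup>+z. ennreal (fst z powr (- s)) \<partial>\<mu>) = ennreal (expectation (\<lambda>z. fst z powr (- s)))"
      by (rule nn_integral_eq_integral[OF i]) auto
    also have "\<dots> \<le> ennreal \<Theta>" by (intro ennreal_leI) (simp add: \<Theta>_def)
    finally have "(\<integral>\<^sup>+z. ennreal (fst z powr (- s)) \<partial>\<mu>) ^ n \<le> ennreal \<Theta> ^ n"
      by (rule power_mono) simp
    then show ?thesis using \<Theta> by (subst iter_law_moment) (unfold_locales, simp add: ennreal_power)
  qed
  \<comment> \<open>chosen such that the negative moment grows at most like \<open>\<epsilon> powr (- (s / 4))\<close>\<close>
  define \<tau> where "\<tau> = s / (4 * ln \<Theta>)"
  have \<tau>: "0 < \<tau>" using s \<Theta> by (simp add: \<tau>_def)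
  define B where "B = \<tau> * ln (1 / \<theta>) / (2 * s)"
  have B: "0 < B" using \<tau> \<theta> s by (simp add: B_def)
  define c where "c = min (s * B) (s / 4)"
  have c: "0 < c" using s B by (simp add: c_def)
  have main: "\<exists>n. emeasure (iter_law \<mu> n) {z. \<epsilon> powr B < fst z} \<le> ennreal (\<Theta> * \<epsilon> powr c) \<and>
          emeasure (iter_law \<mu> n) {z. fst z < \<epsilon> powr (1/2)} \<le> ennreal (\<Theta> * \<epsilon> powr c)"
    if \<epsilon>: "0 < \<epsilon>" "\<epsilon> < 1" for \<epsilon>
  proof -
    define n where "n = nat \<lceil>\<tau> * ln (1 / \<epsilon>)\<rceil>"
    have L: "0 < ln (1 / \<epsilon>)" using \<epsilon> by simp
    have n: "\<tau> * ln (1 / \<epsilon>) \<le> real n" "real n \<le> \<tau> * ln (1 / \<epsilon>) + 1"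
      unfolding n_def using \<tau> L by auto
    have th: "\<theta> ^ n \<le> \<epsilon> powr (2 * s * B)"
    proof -
      have "\<theta> ^ n = \<theta> powr (real n)" using \<theta> by (simp add: powr_realpow)
      also have "\<dots> \<le> \<theta> powr (\<tau> * ln (1 / \<epsilon>))" using \<theta> n by (intro powr_mono') auto
      also have "\<dots> = \<epsilon> powr (2 * s * B)"
        using \<theta> \<epsilon> s by (simp add: powr_def B_def ln_div)
      finally show ?thesis .
    qed
    have Th: "\<Theta> ^ n \<le> \<Theta> * \<epsilon> powr (- (s / 4))"
    proof -
      have "\<Theta> ^ n = \<Theta> powr (real n)" using \<Theta> by (simp add: powr_realpow)
      also have "\<dots> \<le> \<Theta> powr (\<tau> * ln (1 / \<epsilon>) + 1)" using \<Theta> n by (intro powr_mono) auto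
      also have "\<dots> = \<Theta> * \<Theta> powr (\<tau> * ln (1 / \<epsilon>))" using \<Theta> by (simp add: powr_add)
      also have "\<Theta> powr (\<tau> * ln (1 / \<epsilon>)) = \<epsilon> powr (- (s / 4))"
        using \<Theta> \<epsilon> s by (simp add: powr_def \<tau>_def ln_div)
      finally show ?thesis .
    qed
    interpret I: random_similarity "iter_law \<mu> n"
      by (rule iter_law_random_similarity) unfold_locales
    have [simp]: "space (iter_law \<mu> n) = UNIV" by (rule space_eq_UNIV) simp
    have "emeasure (iter_law \<mu> n) {z. \<epsilon> powr B < fst z}
        = (\<integral>\<^sup>+z. indicator {z. \<epsilon> powr B < fst z} z \<partial>iter_law \<mu> n)"
      by (simp add: nn_integral_indicator)
    also have "\<dots> \<le> (\<integral>\<^sup>+z. ennreal (\<epsilon> powr (- (s * B))) * ennreal (fst z powr s) \<partial>iter_law \<mu> n)"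
    proof (rule nn_integral_mono)
      fix z :: "'d sim_param"
      show "indicator {z. \<epsilon> powr B < fst z} z
          \<le> ennreal (\<epsilon> powr (- (s * B))) * ennreal (fst z powr s)"
      proof (cases "\<epsilon> powr B < fst z")
        case True
        then have "(\<epsilon> powr B) powr s \<le> fst z powr s" using s by (intro powr_mono2) auto
        then have "\<epsilon> powr (s * B) \<le> fst z powr s" unfolding powr_powr by (simp only: mult.commute)
        then have "1 \<le> \<epsilon> powr (- (s * B)) * fst z powr s" using \<epsilon>
          by (simp add: powr_minus field_simps)
        then show ?thesis using True by (simp add: ennreal_mult[symmetric])
      qed simp
    qed
    also have "\<dots> \<le> ennreal (\<epsilon> powr (- (s * B))) * ennreal (\<theta> ^ n)"
      by (subst nn_integral_cmult) (auto intro!: mult_left_mono mom)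
    also have "\<dots> \<le> ennreal (\<Theta> * \<epsilon> powr c)"
    proof -
      have "\<epsilon> powr (- (s * B)) * \<theta> ^ n \<le> \<epsilon> powr (- (s * B)) * \<epsilon> powr (2 * s * B)"
        using th by (intro mult_left_mono) auto
      also have "\<dots> = 1 * \<epsilon> powr (s * B)" by (simp add: powr_add[symmetric] mult.commute[of B s])
      also have "\<dots> \<le> \<Theta> * \<epsilon> powr c"
        using \<Theta> \<epsilon> by (intro mult_mono powr_mono') (auto simp: c_def)
      finally show ?thesis using \<theta> by (subst ennreal_mult[symmetric]) (auto intro: ennreal_leI)
    qed
    finally have 1: "emeasure (iter_law \<mu> n) {z. \<epsilon> powr B < fst z} \<le> ennreal (\<Theta> * \<epsilon> powr c)" .
    have "emeasure (iter_law \<mu> n) {z. fst z < \<epsilon> powr (1/2)}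
        = (\<integral>\<^sup>+z. indicator {z. fst z < \<epsilon> powr (1/2)} z \<partial>iter_law \<mu> n)"
      by (simp add: nn_integral_indicator)
    also have "\<dots> \<le> (\<integral>\<^sup>+z. ennreal (\<epsilon> powr (s / 2)) * ennreal (fst z powr (- s)) \<partial>iter_law \<mu> n)"
    proof (rule nn_integral_mono_AE)
      show "AE z in iter_law \<mu> n. indicator {z. fst z < \<epsilon> powr (1/2)} z
          \<le> ennreal (\<epsilon> powr (s / 2)) * ennreal (fst z powr (- s))"
        using I.AE_proper
      proof eventually_elim
        case (elim z)
        then have r: "0 < fst z" by (simp add: proper_param_def)
        show ?case
        proof (cases "fst z < \<epsilon> powr (1/2)")
          case True
          then have "fst z powr s \<le> (\<epsilon> powr (1/2)) powr s" using s r by (intro powr_mono2) auto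
          then have "fst z powr s \<le> \<epsilon> powr (s / 2)" by (simp add: powr_powr)
          then have "1 \<le> \<epsilon> powr (s / 2) * fst z powr (- s)" using r
            by (simp add: powr_minus field_simps)
          then show ?thesis using True by (simp add: ennreal_mult[symmetric])
        qed simp
      qed
    qed
    also have "\<dots> \<le> ennreal (\<epsilon> powr (s / 2)) * ennreal (\<Theta> ^ n)"
      by (subst nn_integral_cmult) (auto intro!: mult_left_mono mom')
    also have "\<dots> \<le> ennreal (\<Theta> * \<epsilon> powr c)"
    proof -
      have "\<epsilon> powr (s / 2) * \<Theta> ^ n \<le> \<epsilon> powr (s / 2) * (\<Theta> * \<epsilon> powr (- (s / 4)))"
        using Th by (intro mult_left_mono) auto
      also have "\<dots> = \<Theta> * \<epsilon> powr (s / 4)" by (simp add: powr_add[symmetric])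
      also have "\<dots> \<le> \<Theta> * \<epsilon> powr c"
        using \<Theta> \<epsilon> by (intro mult_mono powr_mono') (auto simp: c_def)
      finally show ?thesis using \<Theta> by (subst ennreal_mult[symmetric]) (auto intro: ennreal_leI)
    qed
    finally have 2: "emeasure (iter_law \<mu> n) {z. fst z < \<epsilon> powr (1/2)} \<le> ennreal (\<Theta> * \<epsilon> powr c)" .
    from 1 2 show ?thesis by blast
  qed
  have "0 < \<Theta>" using \<Theta> by simp
  with main show ?thesis using B c by (intro exI[of _ B] exI[of _ \<Theta>] exI[of _ c] conjI) auto
qed

end

section \<open>From strips to functions with a Taylor expansion\<close>

text \<open>
  Where the gradient does not vanish, the small values of \<open>P\<close> on a small piece of \<open>\<sigma>\<close> lie in a
  strip. The width of the strip is the error of the affine approximation divided by the ratio and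
  the norm of the gradient.
\<close>

lemma taylor_strip_inclusion:
  fixes P :: "real^'d \<Rightarrow> real" and G :: "real^'d \<Rightarrow> real^'d"
  assumes taylor: "\<And>x h. \<bar>P (x + h) - P x - G x \<bullet> h\<bar> \<le> K * (norm h)\<^sup>2 * (1 + norm x + norm h) ^ m"
    and z: "proper_param z" and \<epsilon>: "0 < \<epsilon>" and M: "1 \<le> M" and K: "0 \<le> K"
    and good: "norm y' \<le> M" "norm (sim_apply z y') \<le> M" "fst z * M \<le> 1" "0
        < norm (G (sim_apply z y'))"
  shows "\<exists>v t. norm v = 1 \<and> {y. \<bar>P (sim_apply z y)\<bar> \<le> \<epsilon>} \<subseteq> {y. M < norm y} \<union>
    {y. \<bar>v \<bullet> y - t\<bar> \<le> (\<epsilon> / fst z + 4 ^ Suc m * K * fst z * M ^ (m + 2)) / norm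
        (G (sim_apply z y'))}"
proof -
  define x r g where "x = sim_apply z y'" and "r = fst z" and "g = G x"
  have r: "0 < r" and Q: "orthogonal_matrix (transpose (fst (snd z)))"
    using z by (auto simp: r_def proper_param_def orthogonal_matrix_transpose)
  have g: "0 < norm g" using good by (simp add: g_def x_def)
  define v where "v = transpose (fst (snd z)) *v ((1 / norm g) *\<^sub>R g)"
  define t where "t = v \<bullet> y' - P x / (r * norm g)"
  have v: "norm v = 1" unfolding v_def using g by (subst norm_orthogonal_matrix[OF Q]) simp
  have "{y. \<bar>P (sim_apply z y)\<bar> \<le> \<epsilon>} \<subseteq> {y. M < norm y} \<union>
    {y. \<bar>v \<bullet> y - t\<bar> \<le> (\<epsilon> / r + 4 ^ Suc m * K * r * M ^ (m + 2)) / norm g}"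
  proof
    fix y assume "y \<in> {y. \<bar>P (sim_apply z y)\<bar> \<le> \<epsilon>}"
    then have Py: "\<bar>P (sim_apply z y)\<bar> \<le> \<epsilon>" by simp
    show "y \<in> {y. M < norm y}
        \<union> {y. \<bar>v \<bullet> y - t\<bar> \<le> (\<epsilon> / r + 4 ^ Suc m * K * r * M ^ (m + 2)) / norm g}"
    proof (cases "M < norm y")
      case False
      define h where "h = sim_apply z y - x"
      have "norm h = r * norm (y - y')" unfolding h_def x_def r_def
        by (rule norm_sim_apply_diff[OF z])
      also have "\<dots> \<le> r * (2 * M)"
        using norm_triangle_ineq4[of y y'] False good(1) r by (intro mult_left_mono) auto
      finally have h: "norm h \<le> 2 * (r * M)" by simp
      then have h2: "norm h \<le> 2" using good(3) by (simp add: r_def)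
      have gh: "g \<bullet> h = r * norm g * (v \<bullet> y - v \<bullet> y')"
      proof -
        have "v \<bullet> (y - y') = ((1 / norm g) *\<^sub>R g) \<bullet> (fst (snd z) *v (y - y'))"
          unfolding v_def by (simp add: dot_lmul_matrix)
        moreover have "h = r *\<^sub>R (fst (snd z) *v (y - y'))" unfolding h_def x_def r_def
          by (rule sim_apply_diff)
        ultimately show ?thesis using g by (simp add: inner_diff_right)
      qed
      have "\<bar>P (x + h) - P x - g \<bullet> h\<bar> \<le> K * (norm h)\<^sup>2 * (1 + norm x + norm h) ^ m"
        unfolding g_def by (rule taylor)
      also have "\<dots> \<le> K * (2 * (r * M))\<^sup>2 * (4 * M) ^ m"
        using h h2 good(2) M K by (intro mult_mono mult_left_mono power_mono) (auto simp: x_def)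
      also have "\<dots> = 4 ^ Suc m * K * r\<^sup>2 * M ^ (m + 2)"
        by (simp add: power_mult_distrib power_add power2_eq_square)
      finally have "\<bar>P x + g \<bullet> h\<bar> \<le> \<epsilon> + 4 ^ Suc m * K * r\<^sup>2 * M ^ (m + 2)"
        using Py by (simp add: h_def)
      moreover have "P x + g \<bullet> h = (r * norm g) * (v \<bullet> y - t)"
        unfolding gh t_def using r g by (simp add: field_simps)
      ultimately have "(r * norm g) * \<bar>v \<bullet> y - t\<bar> \<le> \<epsilon> + 4 ^ Suc m * K * r\<^sup>2 * M ^ (m + 2)"
        using r g by (simp add: abs_mult)
      then have "\<bar>v \<bullet> y - t\<bar> \<le> (\<epsilon> + 4 ^ Suc m * K * r\<^sup>2 * M ^ (m + 2)) / (r * norm g)"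
        using r g by (simp add: field_simps)
      also have "\<dots> = (\<epsilon> / r + 4 ^ Suc m * K * r * M ^ (m + 2)) / norm g"
        using r g by (simp add: field_simps power2_eq_square)
      finally show ?thesis by simp
    qed simp
  qed
  with v show ?thesis unfolding r_def g_def x_def by blast
qed

context irreducible_stationary
begin

text \<open>
  The power \<open>b\<close> must be small compared with the exponent \<open>B\<close> of the upper bound for the ratio: the
  radius \<open>\<epsilon> powr (- b)\<close> of the region considered, raised to the power \<open>m + 2\<close>, and the gradient
  bound \<open>\<epsilon> powr b\<close> have to be compensated by the ratio.
\<close>

lemma taylor_decay:
  fixes K :: real and m :: nat
  assumes K: "0 \<le> K"
  shows "\<exists>b>0. \<forall>C2 c2. 0 \<le> C2 \<longrightarrow> 0 < c2 \<longrightarrow> (\<exists>C>0. \<exists>c>0. \<forall>\<epsilon> P G.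
    0 < \<epsilon> \<longrightarrow> \<epsilon> < 1 \<longrightarrow> P \<in> borel_measurable borel \<longrightarrow> G \<in> borel_measurable borel \<longrightarrow>
    (\<forall>x h. \<bar>P (x + h) - P x - G x \<bullet> h\<bar> \<le> K * (norm h)\<^sup>2 * (1 + norm x + norm h) ^ m) \<longrightarrow>
    measure \<sigma> {x. norm (G x) \<le> \<epsilon> powr b} \<le> C2 * \<epsilon> powr c2 \<longrightarrow>
    measure \<sigma> {x. \<bar>P x\<bar> \<le> \<epsilon>} \<le> C * \<epsilon> powr c)"
proof -
  obtain C1 c1 where C1: "0 < C1" "0 < c1"
    and strip: "\<And>u t w. norm u = 1 \<Longrightarrow> 0 < w \<Longrightarrow> measure \<sigma> {x. \<bar>u \<bullet> x - t\<bar> \<le> w} \<le> C1 * w powr c1"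
    using strip_decay by metis
  obtain B D c3 where B: "0 < B" and D: "0 < D" and c3: "0 < c3"
    and conc: "\<And>\<epsilon>. 0 < \<epsilon> \<Longrightarrow> \<epsilon> < 1 \<Longrightarrow>
      \<exists>n. emeasure (iter_law \<mu> n) {z. \<epsilon> powr B < fst z} \<le> ennreal (D * \<epsilon> powr c3) \<and>
          emeasure (iter_law \<mu> n) {z. fst z < \<epsilon> powr (1/2)} \<le> ennreal (D * \<epsilon> powr c3)"
    using iter_law_ratio_concentrated by metis
  define Ms where "Ms = (\<integral>x. norm x powr contr_exp \<partial>\<sigma>)"
  have Ms: "0 \<le> Ms" by (simp add: Ms_def)
  define b where "b = min (1/4) (B / (2 * (real m + 3)))"
  \<comment> \<open>the exponent of the width of the strip\<close>
  define e where "e = min (1/4) (B / 2)"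
  have "b \<le> 1/4" unfolding b_def by (rule min.cobounded1)
  moreover have "0 < b" using B by (simp add: b_def)
  ultimately have b: "0 < b" "b \<le> 1/4" by auto
  have bm: "b * (real m + 3) \<le> B / 2"
  proof -
    have "b * (real m + 3) \<le> B / (2 * (real m + 3)) * (real m + 3)"
      by (intro mult_right_mono) (auto simp: b_def min.coboundedI2)
    also have "\<dots> = B / 2"
      using nonzero_mult_divide_mult_cancel_right[of "real m + 3" B 2]
        by (simp only: times_divide_eq_left)
    finally show ?thesis .
  qed
  have "b * 1 \<le> b * (real m + 3)" using b by (intro mult_left_mono) auto
  then have bB: "b \<le> B" using bm B by linarith
  have e: "0 < e" using B by (simp add: e_def)
  define K' where "K' = 1 + 4 ^ Suc m * K"
  have K': "1 \<le> K'" using K by (simp add: K'_def)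
  have main: "measure \<sigma> {x. \<bar>P x\<bar> \<le> \<epsilon>}
      \<le> (3 * Ms + 2 * D + C2 + C1 * K' powr c1) * \<epsilon> powr
      (min (min (b * contr_exp) c3) (min c2 (e * c1)))"
    if C2: "0 \<le> C2" "0 < c2" and \<epsilon>: "0 < \<epsilon>" "\<epsilon> < 1"
      and [measurable]: "P \<in> borel_measurable borel" "G \<in> borel_measurable borel"
      and taylor: "\<And>x h. \<bar>P (x + h) - P x - G x \<bullet> h\<bar> \<le> K * (norm h)\<^sup>2 * (1 + norm x + norm h) ^ m"
      and grad: "measure \<sigma> {x. norm (G x) \<le> \<epsilon> powr b} \<le> C2 * \<epsilon> powr c2"
    for C2 c2 \<epsilon> and P :: "real^'d \<Rightarrow> real" and G
  proof -
    obtain n where n: "emeasure (iter_law \<mu> n) {z. \<epsilon> powr B < fst z} \<le> ennreal (D * \<epsilon> powr c3)"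
      "emeasure (iter_law \<mu> n) {z. fst z < \<epsilon> powr (1/2)} \<le> ennreal (D * \<epsilon> powr c3)"
      using conc[OF \<epsilon>] by blast
    let ?\<nu> = "iter_law \<mu> n"
    interpret I: stationary_similarity ?\<nu> \<sigma>
      by (rule iter_law_stationary) unfold_locales
    define M where "M = \<epsilon> powr (- b)"
    have M1: "1 \<le> M"
    proof -
      have "\<epsilon> powr 0 \<le> \<epsilon> powr (- b)" using \<epsilon> b by (intro powr_mono') auto
      then show ?thesis using \<epsilon> by (simp add: M_def)
    qed
    define w where "w = K' * \<epsilon> powr e"
    have w: "0 < w" using K' \<epsilon> by (simp add: w_def)
    define far where "far = {x :: real^'d. M < norm x}"
    define flat where "flat = {x. norm (G x) \<le> \<epsilon> powr b}"
    define big where "big = {z :: 'd sim_param. \<epsilon> powr B < fst z}"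
    define small where "small = {z :: 'd sim_param. fst z < \<epsilon> powr (1/2)}"
    define A where "A = {x. \<bar>P x\<bar> \<le> \<epsilon>}"
    have [measurable]: "far \<in> sets borel" "flat \<in> sets borel" "big \<in> sets borel"
        "small \<in> sets borel" "A \<in> sets borel"
      unfolding far_def flat_def big_def small_def A_def by measurable
    define S where "S = C1 * w powr c1"
    define T where "T = Ms * \<epsilon> powr (b * contr_exp)"
    have ST: "0 \<le> S" "0 \<le> T" using C1 Ms by (auto simp: S_def T_def)
    have far_le: "emeasure \<sigma> far \<le> ennreal T"
    proof -
      have "measure \<sigma> far \<le> Ms * M powr (- contr_exp)"
        unfolding far_def Ms_def using M1 contr_exp by (intro tail_decay) auto
      also have "M powr (- contr_exp) = \<epsilon> powr (b * contr_exp)" by (simp add: M_def powr_powr)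
      finally show ?thesis by (simp add: sig.emeasure_eq_measure T_def ennreal_leI)
    qed
    \<comment> \<open>the exceptional events: one of the points is far out, the ratio is not of the right order, or
      the gradient is small; otherwise only a strip remains\<close>
    have pt: "emeasure \<sigma> (sim_apply z -` A) \<le> ennreal T + indicator far y'
        + indicator far (sim_apply z y')
        + indicator big z + indicator small z + indicator flat (sim_apply z y') + ennreal S"
      if z: "proper_param z" for z y'
    proof (cases "y' \<in> far \<or> sim_apply z y' \<in> far \<or> z \<in> big \<or> z \<in> small \<or> sim_apply z y' \<in> flat")
      case True
      have "emeasure \<sigma> (sim_apply z -` A) \<le> 1" by (rule sig.emeasure_le_1)
      also have "\<dots> \<le> ennreal T + indicator far y' + indicator far (sim_apply z y')
        + indicator big z + indicator small z + indicator flat (sim_apply z y') + ennreal S"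
        using True by (auto simp: add_increasing add_increasing2)
      finally show ?thesis .
    next
      case False
      then have good: "norm y' \<le> M" "norm (sim_apply z y') \<le> M" "fst z \<le> \<epsilon> powr B" "\<epsilon> powr (1/2)
          \<le> fst z"
        "\<epsilon> powr b < norm (G (sim_apply z y'))"
        by (auto simp: far_def big_def small_def flat_def)
      have r: "0 < fst z" using z by (simp add: proper_param_def)
      have \<epsilon>b: "0 < \<epsilon> powr b" using \<epsilon> by simp
      have "fst z * M \<le> \<epsilon> powr B * \<epsilon> powr (- b)" unfolding M_def
        by (intro mult_right_mono good) auto
      also have "\<dots> = \<epsilon> powr (B - b)" by (simp add: powr_add[symmetric])
      also have "\<dots> \<le> \<epsilon> powr 0" using \<epsilon> bB by (intro powr_mono') auto
      finally have rM: "fst z * M \<le> 1" using \<epsilon> by simp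
      have G0: "0 < norm (G (sim_apply z y'))" using good(5) \<epsilon>b by linarith
      obtain v t where v: "norm v = 1" and incl: "{y. \<bar>P (sim_apply z y)\<bar> \<le> \<epsilon>} \<subseteq> {y. M < norm y} \<union>
        {y. \<bar>v \<bullet> y - t\<bar> \<le> (\<epsilon> / fst z + 4 ^ Suc m * K * fst z * M ^ (m + 2)) / norm
            (G (sim_apply z y'))}"
        using taylor_strip_inclusion[OF taylor z \<epsilon>(1) M1 K good(1,2) rM G0] by blast
      have "(\<epsilon> / fst z + 4 ^ Suc m * K * fst z * M ^ (m + 2)) / norm (G (sim_apply z y'))
         \<le> (\<epsilon> / \<epsilon> powr (1/2) + 4 ^ Suc m * K * \<epsilon> powr B * M ^ (m + 2)) / \<epsilon> powr b"
        using good r \<epsilon> K M1 by (intro frac_le add_mono divide_left_mono mult_right_mono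
            mult_left_mono) (auto intro!: add_nonneg_nonneg)
      also have "\<dots> = \<epsilon> powr (1/2 - b) + 4 ^ Suc m * K * \<epsilon> powr (B - b * (real m + 3))"
      proof -
        have "M ^ (m + 2) = M powr real (m + 2)"
          using M1 by (intro powr_realpow[symmetric]) auto
        also have "\<dots> = \<epsilon> powr (- b * (real m + 2))"
          unfolding M_def powr_powr by (simp add: add.commute)
        finally have "M ^ (m + 2) = \<epsilon> powr (- b * (real m + 2))" .
        moreover have "\<epsilon> / \<epsilon> powr (1/2) / \<epsilon> powr b = \<epsilon> powr (1/2 - b)"
        proof -
          have "\<epsilon> / \<epsilon> powr (1/2) / \<epsilon> powr b = \<epsilon> powr 1 / \<epsilon> powr (1/2) / \<epsilon> powr b" using \<epsilon> by simp
          also have "\<dots> = \<epsilon> powr (1 - 1/2 - b)" by (simp only: powr_diff)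
          finally show ?thesis by simp
        qed
        moreover have "\<epsilon> powr B * \<epsilon> powr (- b * (real m + 2)) / \<epsilon> powr b
            = \<epsilon> powr (B - b * (real m + 3))"
          unfolding powr_add[symmetric] powr_diff[symmetric] by (simp add: algebra_simps)
        ultimately show ?thesis by
            (simp add: add_divide_distrib mult.assoc times_divide_eq_right[symmetric] del:
            times_divide_eq_right)
      qed
      also have "\<dots> \<le> \<epsilon> powr e + 4 ^ Suc m * K * \<epsilon> powr e"
        using \<epsilon> b bm K by (intro add_mono mult_left_mono powr_mono') (auto simp: e_def min_def)
      also have "\<dots> = w" by (simp add: w_def K'_def algebra_simps)
      finally have "sim_apply z -` A \<subseteq> far \<union> {y. \<bar>v \<bullet> y - t\<bar> \<le> w}"
        using incl by (force simp: A_def far_def)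
      then have "emeasure \<sigma> (sim_apply z -` A) \<le> emeasure \<sigma> (far \<union> {y. \<bar>v \<bullet> y - t\<bar> \<le> w})"
        by (intro emeasure_mono) auto
      also have "\<dots> \<le> emeasure \<sigma> far + emeasure \<sigma> {y. \<bar>v \<bullet> y - t\<bar> \<le> w}"
        by (rule emeasure_subadditive) auto
      also have "\<dots> \<le> ennreal T + ennreal S"
        using strip[OF v w, of t]
          by (intro add_mono far_le) (simp add: sig.emeasure_eq_measure S_def ennreal_leI)
      finally show ?thesis using False by simp
    qed
    have "emeasure \<sigma> A = (\<integral>\<^sup>+z. emeasure \<sigma> (sim_apply z -` A) \<partial>?\<nu>)"
      by (rule I.stat) simp
    also have "\<dots> \<le> (\<integral>\<^sup>+z. \<integral>\<^sup>+y'. (ennreal T + indicator far y' + indicator far (sim_apply z y')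
        + indicator big z + indicator small z + indicator flat (sim_apply z y') + ennreal S) \<partial>\<sigma>
            \<partial>?\<nu>)"
    proof (rule nn_integral_mono_AE)
      show "AE z in ?\<nu>. emeasure \<sigma> (sim_apply z -` A)
          \<le> (\<integral>\<^sup>+y'. (ennreal T + indicator far y' + indicator far (sim_apply z y')
        + indicator big z + indicator small z + indicator flat (sim_apply z y') + ennreal S) \<partial>\<sigma>)"
        using I.AE_proper
        by eventually_elim (intro sig.nn_integral_ge_const AE_I2 pt)
    qed
    also have "\<dots> = ennreal T + emeasure \<sigma> far + (\<integral>\<^sup>+z. \<integral>\<^sup>+y'. indicator far (sim_apply z y') \<partial>\<sigma> \<partial>?\<nu>)
        + emeasure ?\<nu> big + emeasure ?\<nu> small
            + (\<integral>\<^sup>+z. \<integral>\<^sup>+y'. indicator flat (sim_apply z y') \<partial>\<sigma> \<partial>?\<nu>) + ennreal S"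
      using I.emeasure_space_1 sig.emeasure_space_1
        by (simp add: nn_integral_add nn_integral_indicator)
    also have "(\<integral>\<^sup>+z. \<integral>\<^sup>+y'. indicator far (sim_apply z y') \<partial>\<sigma> \<partial>?\<nu>) = emeasure \<sigma> far"
      using I.nn_stationary[of "indicator far"] by simp
    also have "(\<integral>\<^sup>+z. \<integral>\<^sup>+y'. indicator flat (sim_apply z y') \<partial>\<sigma> \<partial>?\<nu>) = emeasure \<sigma> flat"
      using I.nn_stationary[of "indicator flat"] by simp
    also have "ennreal T + emeasure \<sigma> far + emeasure \<sigma> far + emeasure ?\<nu> big + emeasure ?\<nu> small
        + emeasure \<sigma> flat + ennreal S
       \<le> ennreal T + ennreal T + ennreal T + ennreal (D * \<epsilon> powr c3) + ennreal (D * \<epsilon> powr c3)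
           + ennreal (C2 * \<epsilon> powr c2) + ennreal S"
      using grad n unfolding flat_def[symmetric] big_def[symmetric] small_def[symmetric]
      by (intro add_mono far_le order_refl) (auto simp: sig.emeasure_eq_measure ennreal_leI)
    also have "\<dots> = ennreal (T + T + T + D * \<epsilon> powr c3 + D * \<epsilon> powr c3 + C2 * \<epsilon> powr c2 + S)"
    proof -
      have "ennreal a1 + ennreal a2 + ennreal a3 + ennreal a4 + ennreal a5 + ennreal a6 + ennreal a7
          = ennreal (a1 + a2 + a3 + a4 + a5 + a6 + a7)"
        if "0 \<le> a1" "0 \<le> a2" "0 \<le> a3" "0 \<le> a4" "0 \<le> a5" "0 \<le> a6" "0 \<le> a7" for a1 a2 a3 a4 a5 a6 a7
        using that by simp
      then show ?thesis by this (use ST D C2 in auto)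
    qed
    finally have "measure \<sigma> A \<le> T + T + T + D * \<epsilon> powr c3 + D * \<epsilon> powr c3 + C2 * \<epsilon> powr c2 + S"
      using ST D C2 by (simp add: sig.emeasure_eq_measure ennreal_le_iff del: ennreal_plus)
    also have "\<dots> \<le> (3 * Ms + 2 * D + C2 + C1 * K' powr c1) * \<epsilon> powr
        (min (min (b * contr_exp) c3) (min c2 (e * c1)))"
    proof -
      let ?E = "\<epsilon> powr (min (min (b * contr_exp) c3) (min c2 (e * c1)))"
      have le: "\<epsilon> powr q \<le> ?E" if "min (min (b * contr_exp) c3) (min c2 (e * c1)) \<le> q" for q
        using \<epsilon> that by (intro powr_mono') auto
      have "T \<le> Ms * ?E" unfolding T_def using Ms by (intro mult_left_mono le) auto
      moreover have "D * \<epsilon> powr c3 \<le> D * ?E" using D by (intro mult_left_mono le) auto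
      moreover have "C2 * \<epsilon> powr c2 \<le> C2 * ?E" using C2 by (intro mult_left_mono le) auto
      moreover have "S \<le> C1 * K' powr c1 * ?E"
      proof -
        have "S = C1 * K' powr c1 * \<epsilon> powr (e * c1)"
          using K' \<epsilon> by (simp add: S_def w_def powr_mult powr_powr)
        also have "\<dots> \<le> C1 * K' powr c1 * ?E" using C1 by (intro mult_left_mono le) auto
        finally show ?thesis .
      qed
      ultimately show ?thesis by (simp add: algebra_simps)
    qed
    finally show ?thesis unfolding A_def .
  qed
  show ?thesis
  proof (rule exI[of _ b], intro conjI allI impI)
    show "0 < b" by (rule b)
    fix C2 c2 :: real assume C2: "0 \<le> C2" "0 < c2"
    show "\<exists>C>0. \<exists>c>0. \<forall>\<epsilon> P G.
      0 < \<epsilon> \<longrightarrow> \<epsilon> < 1 \<longrightarrow> P \<in> borel_measurable borel \<longrightarrow> G \<in> borel_measurable borel \<longrightarrow>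
      (\<forall>x h. \<bar>P (x + h) - P x - G x \<bullet> h\<bar> \<le> K * (norm h)\<^sup>2 * (1 + norm x + norm h) ^ m) \<longrightarrow>
      measure \<sigma> {x. norm (G x) \<le> \<epsilon> powr b} \<le> C2 * \<epsilon> powr c2 \<longrightarrow>
      measure \<sigma> {x. \<bar>P x\<bar> \<le> \<epsilon>} \<le> C * \<epsilon> powr c"
    proof (rule exI[of _ "3 * Ms + 2 * D + C2 + C1 * K' powr c1"], rule conjI)
      show "0 < 3 * Ms + 2 * D + C2 + C1 * K' powr c1"
        using Ms D C2 C1 K' by (intro add_nonneg_pos mult_pos_pos) auto
    next
      show "\<exists>c>0. \<forall>\<epsilon> P G. 0 < \<epsilon> \<longrightarrow> \<epsilon> < 1 \<longrightarrow> P \<in> borel_measurable borel \<longrightarrow> G \<in> borel_measurable borel \<longrightarrow>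
        (\<forall>x h. \<bar>P (x + h) - P x - G x \<bullet> h\<bar> \<le> K * (norm h)\<^sup>2 * (1 + norm x + norm h) ^ m) \<longrightarrow>
        measure \<sigma> {x. norm (G x) \<le> \<epsilon> powr b} \<le> C2 * \<epsilon> powr c2 \<longrightarrow>
        measure \<sigma> {x. \<bar>P x\<bar> \<le> \<epsilon>} \<le> (3 * Ms + 2 * D + C2 + C1 * K' powr c1) * \<epsilon> powr c"
        using b contr_exp c3 C2 e C1
        by (intro exI[of _ "min (min (b * contr_exp) c3) (min c2 (e * c1))"] conjI allI impI main)
            auto
    qed
  qed
qed

end

section \<open>Polynomials\<close>

text \<open>
  The monomial with exponents \<open>\<alpha>\<close>.
\<close>

definition monom_fun :: "('d::finite \<Rightarrow> nat) \<Rightarrow> real^'d \<Rightarrow> real" where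
  "monom_fun \<alpha> x = (\<Prod>i\<in>UNIV. (x $ i) ^ \<alpha> i)"

text \<open>
  The partial derivative of a monomial. The truncated subtraction is harmless because of the factor
  \<open>\<alpha> i\<close>.
\<close>

definition monom_deriv :: "'d \<Rightarrow> ('d::finite \<Rightarrow> nat) \<Rightarrow> real^'d \<Rightarrow> real" where
  "monom_deriv i \<alpha> x = real (\<alpha> i) * monom_fun (\<alpha>(i := \<alpha> i - 1)) x"

text \<open>
  The exponents of the monomials of degree at most \<open>l\<close>.
\<close>

definition multi_indices :: "nat \<Rightarrow> ('d::finite \<Rightarrow> nat) set" where
  "multi_indices l = {\<alpha>. sum \<alpha> UNIV \<le> l}"

text \<open>
  The polynomial of degree at most \<open>l\<close> with coefficients \<open>a\<close>; coefficients of higher degree are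
  ignored.
\<close>

definition poly_eval :: "nat \<Rightarrow> (('d::finite \<Rightarrow> nat) \<Rightarrow> real) \<Rightarrow> real^'d \<Rightarrow> real" where
  "poly_eval l a x = (\<Sum>\<alpha>\<in>multi_indices l. a \<alpha> * monom_fun \<alpha> x)"

text \<open>
  The coefficients of a partial derivative.
\<close>

definition coeff_deriv :: "'d \<Rightarrow> (('d::finite \<Rightarrow> nat) \<Rightarrow> real) \<Rightarrow> ('d \<Rightarrow> nat) \<Rightarrow> real" where
  "coeff_deriv i a \<beta> = real (\<beta> i + 1) * a (\<beta>(i := \<beta> i + 1))"

lemma finite_multi_indices [simp]: "finite (multi_indices l :: ('d::finite \<Rightarrow> nat) set)"
proof (rule finite_subset)
  show "multi_indices l \<subseteq> (UNIV :: 'd set) \<rightarrow>\<^sub>E {..l}"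
  proof (auto simp: multi_indices_def PiE_def)
    fix \<alpha> :: "'d \<Rightarrow> nat" and i assume "sum \<alpha> UNIV \<le> l"
    then show "\<alpha> i \<le> l" using member_le_sum[of i UNIV \<alpha>] by simp
  qed
  show "finite ((UNIV :: 'd set) \<rightarrow>\<^sub>E {..l})" by (intro finite_PiE) auto
qed

lemma sum_fun_upd_add:
  fixes \<alpha> :: "'d::finite \<Rightarrow> nat"
  shows "sum (\<alpha>(i := k)) UNIV + \<alpha> i = sum \<alpha> UNIV + k"
  by (simp add: sum.remove[of UNIV i])

lemma monom_fun_split: "monom_fun \<alpha> x = x $ i ^ \<alpha> i * (\<Prod>j\<in>UNIV - {i}. (x $ j) ^ \<alpha> j)"
  unfolding monom_fun_def by (rule prod.remove) auto

lemma monom_fun_upd: "monom_fun (\<alpha>(i := k)) x = x $ i ^ k * (\<Prod>j\<in>UNIV - {i}. (x $ j) ^ \<alpha> j)"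
  unfolding monom_fun_split[of _ _ i] by simp

lemma monom_fun_lower: "0 < \<alpha> i \<Longrightarrow> x $ i * monom_fun (\<alpha>(i := \<alpha> i - 1)) x = monom_fun \<alpha> x"
  unfolding monom_fun_upd monom_fun_split[of \<alpha> x i] by (cases "\<alpha> i") auto

lemma monom_fun_bound: "\<bar>monom_fun \<alpha> x\<bar> \<le> (1 + norm x) ^ sum \<alpha> UNIV"
proof -
  have "\<bar>monom_fun \<alpha> x\<bar> = (\<Prod>i\<in>UNIV. \<bar>x $ i\<bar> ^ \<alpha> i)"
    by (simp add: monom_fun_def abs_prod power_abs)
  also have "\<dots> \<le> (\<Prod>i\<in>UNIV. (1 + norm x) ^ \<alpha> i)"
    by (intro prod_mono conjI power_mono) (auto intro: order_trans[OF component_le_norm_cart])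
  also have "\<dots> = (1 + norm x) ^ sum \<alpha> UNIV" by (simp add: power_sum)
  finally show ?thesis .
qed

lemma monom_deriv_bound: "\<bar>monom_deriv i \<alpha> x\<bar> \<le> real (sum \<alpha> UNIV) * (1 + norm x) ^ sum \<alpha> UNIV"
proof -
  have le: "sum (\<alpha>(i := \<alpha> i - 1)) UNIV \<le> sum \<alpha> UNIV" by (intro sum_mono) auto
  have "\<bar>monom_fun (\<alpha>(i := \<alpha> i - 1)) x\<bar> \<le> (1 + norm x) ^ sum (\<alpha>(i := \<alpha> i - 1)) UNIV"
    by (rule monom_fun_bound)
  also have "\<dots> \<le> (1 + norm x) ^ sum \<alpha> UNIV" using le by (intro power_increasing) auto
  finally show ?thesis
    unfolding monom_deriv_def abs_mult using member_le_sum[of i UNIV \<alpha>]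
    by (intro mult_mono) (auto simp del: of_nat_sum)
qed

lemma monom_deriv_step:
  assumes "0 < \<alpha> j"
  shows "monom_deriv i \<alpha> x = (if i = j then monom_fun (\<alpha>(j := \<alpha> j - 1)) x else 0)
      + x $ j * monom_deriv i (\<alpha>(j := \<alpha> j - 1)) x"
proof (cases "i = j")
  case True
  show ?thesis
  proof (cases "\<alpha> j = 1")
    case False
    then have "0 < (\<alpha>(j := \<alpha> j - 1)) j" using assms by simp
    from monom_fun_lower[of "\<alpha>(j := \<alpha> j - 1)" j, OF this, of x] show ?thesis
      using True assms unfolding monom_deriv_def
      by (simp add: mult.left_commute of_nat_diff algebra_simps)
  qed (use True in \<open>simp add: monom_deriv_def\<close>)
next
  case False
  then have "0 < (\<alpha>(i := \<alpha> i - 1)) j" using assms by simp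
  from monom_fun_lower[of "\<alpha>(i := \<alpha> i - 1)" j, OF this, of x] show ?thesis
    using False unfolding monom_deriv_def by (simp add: fun_upd_twist mult.left_commute)
qed

lemma sum_abs_components_le: "\<bar>\<Sum>i\<in>UNIV. h $ i * f i\<bar> \<le> real CARD('d) * (norm h * B)"
  if "\<And>i. \<bar>f i\<bar> \<le> B" for h :: "real^'d::finite"
proof -
  have "\<bar>\<Sum>i\<in>UNIV. h $ i * f i\<bar> \<le> (\<Sum>i\<in>UNIV. \<bar>h $ i * f i\<bar>)" by (rule sum_abs)
  also have "\<dots> \<le> (\<Sum>i\<in>(UNIV :: 'd set). norm h * B)"
    using that by (intro sum_mono) (auto simp: abs_mult intro!: mult_mono component_le_norm_cart)
  finally show ?thesis by simp
qed

text \<open>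
  Induction on the degree: for \<open>P x = x $ j * Q x\<close>, the remainder is \<open>(x + h) $ j\<close> times the
  remainder of \<open>Q\<close> plus \<open>h $ j\<close> times the differential of \<open>Q\<close>.
\<close>

lemma monom_taylor:
  fixes \<alpha> :: "'d::finite \<Rightarrow> nat"
  shows "\<exists>K\<ge>0. \<forall>x h. \<bar>monom_fun \<alpha> (x + h) - monom_fun \<alpha> x - (\<Sum>i\<in>UNIV. h $ i * monom_deriv i \<alpha> x)\<bar>
    \<le> K * (norm h)\<^sup>2 * (1 + norm x + norm h) ^ sum \<alpha> UNIV"
proof (induction "sum \<alpha> UNIV" arbitrary: \<alpha>)
  case 0
  then have "\<alpha> = (\<lambda>_. 0)" by auto
  then show ?case by (intro exI[of _ 0]) (simp add: monom_fun_def monom_deriv_def)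
next
  case (Suc n)
  obtain j where j: "0 < \<alpha> j"
    using Suc.hyps(2) by (metis Zero_not_Suc gr0I sum.neutral)
  define \<beta> where "\<beta> = \<alpha>(j := \<alpha> j - 1)"
  have n: "sum \<beta> UNIV = n"
    using sum_fun_upd_add[of \<alpha> j "\<alpha> j - 1"] Suc.hyps(2) j unfolding \<beta>_def by linarith
  obtain K where K: "0 \<le> K"
      and KB: "\<And>x h. \<bar>monom_fun \<beta> (x + h) - monom_fun \<beta> x - (\<Sum>i\<in>UNIV. h $ i * monom_deriv i \<beta> x)\<bar>
    \<le> K * (norm h)\<^sup>2 * (1 + norm x + norm h) ^ n"
    using Suc.hyps(1)[of \<beta>] n by auto
  define K' where "K' = K + real CARD('d) * real n"
  have "\<bar>monom_fun \<alpha> (x + h) - monom_fun \<alpha> x - (\<Sum>i\<in>UNIV. h $ i * monom_deriv i \<alpha> x)\<bar>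
    \<le> K' * (norm h)\<^sup>2 * (1 + norm x + norm h) ^ Suc n" for x h
  proof -
    define D where "D = (\<Sum>i\<in>UNIV. h $ i * monom_deriv i \<beta> x)"
    define R where "R = monom_fun \<beta> (x + h) - monom_fun \<beta> x - D"
    let ?X = "1 + norm x + norm h"
    have m: "monom_fun \<alpha> y = y $ j * monom_fun \<beta> y" for y
      using monom_fun_lower[where \<alpha> = \<alpha> and i = j and x = y] j by (simp add: \<beta>_def)
    have "(\<Sum>i\<in>UNIV. h $ i * monom_deriv i \<alpha> x)
        = (\<Sum>i\<in>UNIV. (if i = j then h $ i * monom_fun \<beta> x else 0)
        + x $ j * (h $ i * monom_deriv i \<beta> x))"
      by (intro sum.cong) (auto simp: monom_deriv_step[where \<alpha> = \<alpha> and j = j] j \<beta>_def algebra_simps)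
    also have "\<dots> = h $ j * monom_fun \<beta> x + x $ j * D"
      by (simp add: sum.distrib D_def sum_distrib_left)
    finally have "monom_fun \<alpha> (x + h) - monom_fun \<alpha> x - (\<Sum>i\<in>UNIV. h $ i * monom_deriv i \<alpha> x)
        = (x $ j + h $ j) * R + h $ j * D"
      unfolding m R_def by (simp add: algebra_simps)
    moreover have "\<bar>(x $ j + h $ j) * R\<bar> \<le> ?X * (K * (norm h)\<^sup>2 * ?X ^ n)"
      unfolding abs_mult
    proof (rule mult_mono)
      show "\<bar>x $ j + h $ j\<bar> \<le> ?X"
        using component_le_norm_cart[of x j] component_le_norm_cart[of h j] by linarith
      show "\<bar>R\<bar> \<le> K * (norm h)\<^sup>2 * ?X ^ n" unfolding R_def D_def by (rule KB)
    qed auto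
    moreover have "\<bar>h $ j * D\<bar> \<le> norm h * (real CARD('d) * (norm h * (real n * ?X ^ Suc n)))"
      unfolding abs_mult
    proof (intro mult_mono component_le_norm_cart)
      have "\<bar>monom_deriv i \<beta> x\<bar> \<le> real n * ?X ^ Suc n" for i
      proof -
        have "\<bar>monom_deriv i \<beta> x\<bar> \<le> real n * (1 + norm x) ^ n" using monom_deriv_bound[of i \<beta> x] n
          by simp
        also have "\<dots> \<le> real n * ?X ^ n" by (intro mult_left_mono power_mono) auto
        also have "\<dots> \<le> real n * ?X ^ Suc n" by (intro mult_left_mono power_increasing) auto
        finally show ?thesis .
      qed
      then show "\<bar>D\<bar> \<le> real CARD('d) * (norm h * (real n * ?X ^ Suc n))"
        unfolding D_def by (rule sum_abs_components_le)
    qed auto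
    ultimately have "\<bar>monom_fun \<alpha> (x + h) - monom_fun \<alpha> x - (\<Sum>i\<in>UNIV. h $ i * monom_deriv i \<alpha> x)\<bar>
      \<le> ?X * (K * (norm h)\<^sup>2 * ?X ^ n)
          + norm h * (real CARD('d) * (norm h * (real n * ?X ^ Suc n)))"
      by (simp only:)
    also have "\<dots> = K' * (norm h)\<^sup>2 * ?X ^ Suc n"
      by (simp add: K'_def power2_eq_square algebra_simps)
    finally show ?thesis .
  qed
  moreover have "0 \<le> K'" using K by (simp add: K'_def)
  ultimately show ?case unfolding Suc.hyps(2)[symmetric] by blast
qed

text \<open>
  The gradient of a polynomial.
\<close>

definition poly_grad :: "nat \<Rightarrow> (('d::finite \<Rightarrow> nat) \<Rightarrow> real) \<Rightarrow> real^'d \<Rightarrow> real^'d" where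
  "poly_grad l a x = (\<chi> i. \<Sum>\<alpha>\<in>multi_indices l. a \<alpha> * monom_deriv i \<alpha> x)"

lemma poly_grad_component:
  "poly_grad (Suc l) a x $ i = poly_eval l (coeff_deriv i a) x"
proof -
  let ?J = "{\<alpha> \<in> multi_indices (Suc l). 0 < \<alpha> i}"
  have "poly_grad (Suc l) a x $ i = (\<Sum>\<alpha>\<in>?J. a \<alpha> * monom_deriv i \<alpha> x)"
    unfolding poly_grad_def vec_lambda_beta
    by (rule sum.mono_neutral_right) (auto simp: monom_deriv_def)
  also have "\<dots> = (\<Sum>\<beta>\<in>multi_indices l. coeff_deriv i a \<beta> * monom_fun \<beta> x)"
  proof (rule sum.reindex_bij_witness[where i = "\<lambda>\<beta>. \<beta>(i := \<beta> i + 1)" and j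
      = "\<lambda>\<alpha>. \<alpha>(i := \<alpha> i - 1)"])
    fix \<alpha> assume \<alpha>: "\<alpha> \<in> ?J"
    then show "(\<alpha>(i := \<alpha> i - 1))(i := (\<alpha>(i := \<alpha> i - 1)) i + 1) = \<alpha>" by simp
    show "\<alpha>(i := \<alpha> i - 1) \<in> multi_indices l"
      using \<alpha> sum_fun_upd_add[of \<alpha> i "\<alpha> i - 1"] unfolding multi_indices_def mem_Collect_eq
        by linarith
    show "coeff_deriv i a (\<alpha>(i := \<alpha> i - 1)) * monom_fun (\<alpha>(i := \<alpha> i - 1)) x
        = a \<alpha> * monom_deriv i \<alpha> x"
      using \<alpha> by (simp add: coeff_deriv_def monom_deriv_def)
  next
    fix \<beta> :: "'a \<Rightarrow> nat" assume \<beta>: "\<beta> \<in> multi_indices l"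
    show "(\<beta>(i := \<beta> i + 1))(i := (\<beta>(i := \<beta> i + 1)) i - 1) = \<beta>" by simp
    show "\<beta>(i := \<beta> i + 1) \<in> ?J"
      using \<beta> sum_fun_upd_add[of \<beta> i "\<beta> i + 1"] unfolding multi_indices_def mem_Collect_eq
      by (simp_all del: fun_upd_apply) simp_all
  qed
  finally show ?thesis by (simp add: poly_eval_def)
qed

lemma poly_taylor:
  "\<exists>K\<ge>0. \<forall>a x h. (\<forall>\<alpha>\<in>multi_indices l. \<bar>a \<alpha>\<bar> \<le> 1) \<longrightarrow>
    \<bar>poly_eval l a (x + h) - poly_eval l a x - poly_grad l a x \<bullet> (h :: real^'d::finite)\<bar>
        \<le> K * (norm h)\<^sup>2 * (1 + norm x + norm h) ^ l"
proof -
  have "\<forall>\<alpha>. \<exists>K\<ge>0. \<forall>x h :: real^'d. \<bar>monom_fun \<alpha> (x + h) - monom_fun \<alpha> x -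
      (\<Sum>i\<in>UNIV. h $ i * monom_deriv i \<alpha> x)\<bar>
    \<le> K * (norm h)\<^sup>2 * (1 + norm x + norm h) ^ sum \<alpha> UNIV" using monom_taylor by blast
  then have "\<exists>K. \<forall>\<alpha>. 0 \<le> K \<alpha> \<and>
      (\<forall>x h :: real^'d. \<bar>monom_fun \<alpha> (x + h) - monom_fun \<alpha> x - (\<Sum>i\<in>UNIV. h $ i * monom_deriv i \<alpha> x)\<bar>
    \<le> K \<alpha> * (norm h)\<^sup>2 * (1 + norm x + norm h) ^ sum \<alpha> UNIV)" by (rule choice)
  then obtain K where "\<forall>\<alpha>. 0
      \<le> K \<alpha> \<and> (\<forall>x h :: real^'d. \<bar>monom_fun \<alpha> (x + h) - monom_fun \<alpha> x -
      (\<Sum>i\<in>UNIV. h $ i * monom_deriv i \<alpha> x)\<bar>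
    \<le> K \<alpha> * (norm h)\<^sup>2 * (1 + norm x + norm h) ^ sum \<alpha> UNIV)" by (rule exE)
  then have K: "\<And>\<alpha>. 0 \<le> K \<alpha>"
      and KB: "\<And>\<alpha> x h. \<bar>monom_fun \<alpha> (x + h) - monom_fun \<alpha> x -
      (\<Sum>i\<in>UNIV. (h :: real^'d) $ i * monom_deriv i \<alpha> x)\<bar>
    \<le> K \<alpha> * (norm h)\<^sup>2 * (1 + norm x + norm h) ^ sum \<alpha> UNIV" by blast+
  have "\<bar>poly_eval l a (x + h) - poly_eval l a x - poly_grad l a x \<bullet> h\<bar>
      \<le> (\<Sum>\<alpha>\<in>multi_indices l. K \<alpha>) * (norm h)\<^sup>2 * (1 + norm x + norm h) ^ l"
    if a: "\<forall>\<alpha>\<in>multi_indices l. \<bar>a \<alpha>\<bar> \<le> 1" for a and x h :: "real^'d"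
  proof -
    let ?R = "\<lambda>\<alpha>. monom_fun \<alpha> (x + h) - monom_fun \<alpha> x - (\<Sum>i\<in>UNIV. h $ i * monom_deriv i \<alpha> x)"
    have "poly_grad l a x \<bullet> h = (\<Sum>i\<in>UNIV. \<Sum>\<alpha>\<in>multi_indices l. a \<alpha> * (h $ i * monom_deriv i \<alpha> x))"
      by (simp add: inner_vec_def poly_grad_def sum_distrib_right sum_distrib_left mult_ac)
    also have "\<dots> = (\<Sum>\<alpha>\<in>multi_indices l. a \<alpha> * (\<Sum>i\<in>UNIV. h $ i * monom_deriv i \<alpha> x))"
      by (subst sum.swap) (simp add: sum_distrib_left)
    finally have "poly_eval l a (x + h) - poly_eval l a x - poly_grad l a x \<bullet> h
        = (\<Sum>\<alpha>\<in>multi_indices l. a \<alpha> * ?R \<alpha>)"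
      by (simp add: poly_eval_def sum_subtractf right_diff_distrib)
    then have "\<bar>poly_eval l a (x + h) - poly_eval l a x - poly_grad l a x \<bullet> h\<bar>
        \<le> (\<Sum>\<alpha>\<in>multi_indices l. \<bar>a \<alpha> * ?R \<alpha>\<bar>)"
      by (simp only: sum_abs)
    also have "\<dots> \<le> (\<Sum>\<alpha>\<in>multi_indices l. K \<alpha> * ((norm h)\<^sup>2 * (1 + norm x + norm h) ^ l))"
    proof (rule sum_mono)
      fix \<alpha> :: "'d \<Rightarrow> nat" assume \<alpha>: "\<alpha> \<in> multi_indices l"
      have "\<bar>a \<alpha> * ?R \<alpha>\<bar> \<le> 1 * (K \<alpha> * (norm h)\<^sup>2 * (1 + norm x + norm h) ^ sum \<alpha> UNIV)"
        unfolding abs_mult using a \<alpha> KB[of \<alpha> x h] by (intro mult_mono) auto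
      also have "\<dots> \<le> 1 * (K \<alpha> * (norm h)\<^sup>2 * (1 + norm x + norm h) ^ l)"
        using \<alpha> K by (intro mult_left_mono power_increasing) (auto simp: multi_indices_def)
      finally show "\<bar>a \<alpha> * ?R \<alpha>\<bar> \<le> K \<alpha> * ((norm h)\<^sup>2 * (1 + norm x + norm h) ^ l)"
        by (simp add: mult.assoc)
    qed
    finally show ?thesis by (simp add: sum_distrib_right mult.assoc)
  qed
  moreover have "0 \<le> (\<Sum>\<alpha>\<in>multi_indices l. K \<alpha>)" by (intro sum_nonneg K)
  ultimately show ?thesis by blast
qed

lemma monom_fun_continuous: "continuous_on A (monom_fun \<alpha>)"
  unfolding monom_fun_def by (intro continuous_intros)

lemma poly_eval_measurable [measurable]: "poly_eval l a \<in> borel_measurable borel"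
  unfolding poly_eval_def
  by (intro borel_measurable_continuous_onI continuous_intros monom_fun_continuous)

lemma poly_grad_measurable [measurable]: "poly_grad l a \<in> borel_measurable borel"
  unfolding poly_grad_def monom_deriv_def
  by (intro borel_measurable_continuous_onI continuous_intros monom_fun_continuous
      continuous_on_vec_lambda)

lemma poly_eval_scale: "poly_eval l (\<lambda>\<alpha>. k * a \<alpha>) x = k * poly_eval l a x"
  by (simp add: poly_eval_def sum_distrib_left mult.assoc)

context irreducible_stationary
begin

text \<open>
  The normalisation asks for one coefficient of absolute value at least \<open>1\<close>; it is inherited by a
  suitable multiple of a partial derivative.
\<close>

lemma poly_decay_normalized:
  "\<exists>C>0. \<exists>c>0. \<forall>a \<epsilon>. (\<exists>\<alpha>\<in>multi_indices l. 1 \<le> \<bar>a \<alpha>\<bar>) \<longrightarrow> 0 < \<epsilon> \<longrightarrow>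
     measure \<sigma> {x. \<bar>poly_eval l a x\<bar> \<le> \<epsilon>} \<le> C * \<epsilon> powr c"
proof (induction l)
  case 0
  have I0: "multi_indices 0 = {\<lambda>_::'d. 0}" by (auto simp: multi_indices_def)
  have "measure \<sigma> {x. \<bar>poly_eval 0 a x\<bar> \<le> \<epsilon>} \<le> 1 * \<epsilon> powr 1"
    if "\<exists>\<alpha>\<in>multi_indices 0. 1 \<le> \<bar>a \<alpha>\<bar>" "0 < \<epsilon>" for a \<epsilon>
  proof (cases "1 \<le> \<epsilon>")
    case True
    then show ?thesis using sig.prob_le_1 that by (simp add: order_trans[OF sig.prob_le_1])
  next
    case False
    have "poly_eval 0 a x = a (\<lambda>_. 0)" for x by (simp add: poly_eval_def I0 monom_fun_def)
    then have "{x. \<bar>poly_eval 0 a x\<bar> \<le> \<epsilon>} = {}" using that False by (auto simp: I0)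
    then show ?thesis using that by simp
  qed
  then show ?case using zero_less_one by blast
next
  case (Suc l)
  obtain C0 c0 where C0: "0 < C0" "0 < c0"
    and IH: "\<And>a \<epsilon>. (\<exists>\<alpha>\<in>multi_indices l. 1 \<le> \<bar>a \<alpha>\<bar>) \<Longrightarrow> 0 < \<epsilon> \<Longrightarrow>
     measure \<sigma> {x. \<bar>poly_eval l a x\<bar> \<le> \<epsilon>} \<le> C0 * \<epsilon> powr c0"
    using Suc.IH by metis
  obtain K where K: "0 \<le> K" and taylor: "\<And>a x h. (\<forall>\<alpha>\<in>multi_indices (Suc l). \<bar>a \<alpha>\<bar> \<le> 1) \<Longrightarrow>
    \<bar>poly_eval (Suc l) a (x + h) - poly_eval (Suc l) a x - poly_grad (Suc l) a x \<bullet> (h :: real^'d)\<bar>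
        \<le> K * (norm h)\<^sup>2 * (1 + norm x + norm h) ^ Suc l"
    using poly_taylor[of "Suc l", where 'd = 'd] by metis
  obtain b where b: "0 < b" and bt: "\<And>C2 c2. 0 \<le> C2 \<Longrightarrow> 0 < c2 \<Longrightarrow> (\<exists>C>0. \<exists>c>0. \<forall>\<epsilon> P G.
    0 < \<epsilon> \<longrightarrow> \<epsilon> < 1 \<longrightarrow> P \<in> borel_measurable borel \<longrightarrow> G \<in> borel_measurable borel \<longrightarrow>
    (\<forall>x h. \<bar>P (x + h) - P x - G x \<bullet> h\<bar> \<le> K * (norm h)\<^sup>2 * (1 + norm x + norm h) ^ Suc l) \<longrightarrow>
    measure \<sigma> {x. norm (G x) \<le> \<epsilon> powr b} \<le> C2 * \<epsilon> powr c2 \<longrightarrow>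
    measure \<sigma> {x. \<bar>P x\<bar> \<le> \<epsilon>} \<le> C * \<epsilon> powr c)"
    using taylor_decay[OF K, of "Suc l"] by blast
  define b' where "b' = b / 2"
  have b': "0 < b'" using b by (simp add: b'_def)
  have "0 < b' * c0" using C0 b' by simp
  from bt[OF less_imp_le[OF C0(1)] this] obtain C1 c1 where C1: "0 < C1" "0 < c1" and step: "\<forall>\<epsilon> P G.
    0 < \<epsilon> \<longrightarrow> \<epsilon> < 1 \<longrightarrow> P \<in> borel_measurable borel \<longrightarrow> G \<in> borel_measurable borel \<longrightarrow>
    (\<forall>x h. \<bar>P (x + h) - P x - G x \<bullet> h\<bar> \<le> K * (norm h)\<^sup>2 * (1 + norm x + norm h) ^ Suc l) \<longrightarrow>
    measure \<sigma> {x. norm (G x) \<le> \<epsilon> powr b} \<le> C0 * \<epsilon> powr (b' * c0) \<longrightarrow>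
    measure \<sigma> {x. \<bar>P x\<bar> \<le> \<epsilon>} \<le> C1 * \<epsilon> powr c1"
    by (elim exE conjE) (rule that)
  define N where "N = real (card (multi_indices (Suc l) :: ('d \<Rightarrow> nat) set))"
  have N: "0 \<le> N" by (simp add: N_def)
  define s where "s = contr_exp / real (Suc l)"
  have s: "0 < s" using contr_exp by (simp add: s_def)
  define M where "M = (\<integral>x. (1 + norm x) powr contr_exp \<partial>\<sigma>)"
  have M: "0 \<le> M" by (simp add: M_def)
  define C where "C = 2 + C1 + M * (2 * N) powr s"
  define c where "c = min 1 (min c1 (b' * s))"
  have "0 \<le> M * (2 * N) powr s" using M by simp
  then have C: "0 < C" "2 \<le> C" using C1 by (auto simp: C_def)
  have c: "0 < c" "c \<le> 1" using C1 b' s by (auto simp: c_def)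
  have norm1: "measure \<sigma> {x. \<bar>poly_eval (Suc l) a x\<bar> \<le> \<epsilon>} \<le> C * \<epsilon> powr c"
    if a: "\<forall>\<alpha>\<in>multi_indices (Suc l). \<bar>a \<alpha>\<bar> \<le> 1" "\<exists>\<alpha>\<in>multi_indices (Suc l). \<bar>a \<alpha>\<bar> = 1" and \<epsilon>: "0 < \<epsilon>"
        for a \<epsilon>
  proof (cases "\<epsilon> \<le> 1/2")
    case False
    have "1 \<le> 2 * (1/2 :: real) powr 1" by simp
    also have "\<dots> \<le> 2 * (1/2) powr c" using c by (intro mult_left_mono powr_mono') auto
    also have "\<dots> \<le> C * \<epsilon> powr c" using C c False by (intro mult_mono powr_mono2) auto
    finally show ?thesis by (rule order_trans[OF sig.prob_le_1])
  next
    case True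
    then have \<epsilon>1: "\<epsilon> < 1" by simp
    show ?thesis
    proof (cases "\<exists>\<alpha>\<in>multi_indices (Suc l). \<alpha> \<noteq> (\<lambda>_. 0) \<and> \<epsilon> powr b' \<le> \<bar>a \<alpha>\<bar>")
      case True
      then obtain \<alpha> where \<alpha>: "\<alpha> \<in> multi_indices (Suc l)" "\<alpha> \<noteq> (\<lambda>_. 0)" "\<epsilon> powr b' \<le> \<bar>a \<alpha>\<bar>" by blast
      \<comment> \<open>differentiation in the direction \<open>i\<close> does not decrease the large coefficient\<close>
      then obtain i where i: "0 < \<alpha> i" by (auto simp: fun_eq_iff)
      define \<beta> where "\<beta> = \<alpha>(i := \<alpha> i - 1)"
      have \<beta>: "\<beta> \<in> multi_indices l"
        using \<alpha>(1) i sum_fun_upd_add[of \<alpha> i "\<alpha> i - 1"]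
          unfolding multi_indices_def mem_Collect_eq \<beta>_def by linarith
      have "coeff_deriv i a \<beta> = real (\<alpha> i) * a \<alpha>" using i by (simp add: coeff_deriv_def \<beta>_def)
      then have "\<bar>a \<alpha>\<bar> \<le> \<bar>coeff_deriv i a \<beta>\<bar>"
        using i mult_right_mono[of 1 "real (\<alpha> i)" "\<bar>a \<alpha>\<bar>"] by (simp add: abs_mult)
      with \<alpha>(3) have "\<epsilon> powr b' \<le> \<bar>coeff_deriv i a \<beta>\<bar>" by linarith
      then have "1 \<le> \<bar>\<epsilon> powr (- b') * coeff_deriv i a \<beta>\<bar>"
        using \<epsilon> by (simp add: abs_mult powr_minus field_simps)
      then have ih: "measure \<sigma> {x. \<bar>poly_eval l (\<lambda>\<beta>. \<epsilon> powr (- b') * coeff_deriv i a \<beta>) x\<bar>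
          \<le> \<epsilon> powr b'} \<le> C0 * (\<epsilon> powr b') powr c0"
        using \<beta> \<epsilon> by (intro IH) auto
      have "measure \<sigma> {x. \<bar>poly_eval (Suc l) a x\<bar> \<le> \<epsilon>} \<le> C1 * \<epsilon> powr c1"
      proof (rule step[rule_format, OF \<epsilon> \<epsilon>1 _ _ taylor[OF a(1)]])
        have "measure \<sigma> {x. norm (poly_grad (Suc l) a x) \<le> \<epsilon> powr b}
            \<le> measure \<sigma> {x. \<bar>poly_eval l (\<lambda>\<beta>. \<epsilon> powr (- b') * coeff_deriv i a \<beta>) x\<bar> \<le> \<epsilon> powr b'}"
        proof (rule sig.finite_measure_mono)
          show "{x. norm (poly_grad (Suc l) a x) \<le> \<epsilon> powr b}
              \<subseteq> {x. \<bar>poly_eval l (\<lambda>\<beta>. \<epsilon> powr (- b') * coeff_deriv i a \<beta>) x\<bar> \<le> \<epsilon> powr b'}"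
          proof (intro subsetI CollectI)
            fix x assume "x \<in> {x. norm (poly_grad (Suc l) a x) \<le> \<epsilon> powr b}"
            then have "\<bar>poly_eval l (coeff_deriv i a) x\<bar> \<le> \<epsilon> powr b"
              using component_le_norm_cart[of "poly_grad (Suc l) a x" i]
                by (simp add: poly_grad_component)
            then have "\<epsilon> powr (- b') * \<bar>poly_eval l (coeff_deriv i a) x\<bar> \<le> \<epsilon> powr (- b') * \<epsilon> powr b"
              by (intro mult_left_mono) auto
            also have "\<dots> = \<epsilon> powr b'" unfolding powr_add[symmetric] by (simp add: b'_def)
            finally show "\<bar>poly_eval l (\<lambda>\<beta>. \<epsilon> powr (- b') * coeff_deriv i a \<beta>) x\<bar> \<le> \<epsilon> powr b'"
              by (simp add: poly_eval_scale abs_mult)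
          qed
        qed measurable
        also note ih
        also have "(\<epsilon> powr b') powr c0 = \<epsilon> powr (b' * c0)" by (rule powr_powr)
        finally show "measure \<sigma> {x. norm (poly_grad (Suc l) a x) \<le> \<epsilon> powr b}
            \<le> C0 * \<epsilon> powr (b' * c0)" .
      qed measurable
      also have "\<dots> \<le> C * \<epsilon> powr c"
        using \<epsilon> \<epsilon>1 C1 M by (intro mult_mono powr_mono') (auto simp: C_def c_def)
      finally show ?thesis .
    next
      case False
      then have small: "\<bar>a \<alpha>\<bar> \<le> \<epsilon> powr b'" if "\<alpha> \<in> multi_indices (Suc l)" "\<alpha> \<noteq> (\<lambda>_. 0)" for \<alpha>
        using that by force
      have "\<epsilon> powr b' < 1" using \<epsilon> \<epsilon>1 b' powr_less_mono2[of b' \<epsilon> 1] by simp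
      then have a0: "\<bar>a (\<lambda>_. 0)\<bar> = 1" using a(2) small by force
      have z_in: "(\<lambda>_. 0) \<in> (multi_indices (Suc l) :: ('d \<Rightarrow> nat) set)"
        by (simp add: multi_indices_def)
      \<comment> \<open>only the constant term is large, so the polynomial is small only for large \<open>norm x\<close>\<close>
      have sub: "1 \<le> (2 * N * \<epsilon> powr b') powr s * (1 + norm x) powr contr_exp"
          if x: "\<bar>poly_eval (Suc l) a x\<bar> \<le> \<epsilon>" for x
      proof -
        have "poly_eval (Suc l) a x = a (\<lambda>_. 0)
            + (\<Sum>\<alpha>\<in>multi_indices (Suc l) - {\<lambda>_. 0}. a \<alpha> * monom_fun \<alpha> x)"
          unfolding poly_eval_def by (subst sum.remove[OF _ z_in]) (auto simp: monom_fun_def)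
        moreover have "\<bar>\<Sum>\<alpha>\<in>multi_indices (Suc l) - {\<lambda>_. 0}. a \<alpha> * monom_fun \<alpha> x\<bar>
            \<le> N * (\<epsilon> powr b' * (1 + norm x) ^ Suc l)"
        proof -
          have "\<bar>\<Sum>\<alpha>\<in>multi_indices (Suc l) - {\<lambda>_. 0}. a \<alpha> * monom_fun \<alpha> x\<bar>
              \<le> (\<Sum>\<alpha>\<in>multi_indices (Suc l) - {\<lambda>_. 0}. \<bar>a \<alpha> * monom_fun \<alpha> x\<bar>)"
            by (rule sum_abs)
          also have "\<dots> \<le> (\<Sum>\<alpha>\<in>multi_indices (Suc l) - {\<lambda>_ :: 'd. 0}. \<epsilon> powr b' * (1 + norm x) ^ Suc
              l)"
          proof (rule sum_mono)
            fix \<alpha> :: "'d \<Rightarrow> nat" assume \<alpha>: "\<alpha> \<in> multi_indices (Suc l) - {\<lambda>_. 0}"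
            have "\<bar>monom_fun \<alpha> x\<bar> \<le> (1 + norm x) ^ sum \<alpha> UNIV" by (rule monom_fun_bound)
            also have "\<dots> \<le> (1 + norm x) ^ Suc l" using \<alpha>
              by (intro power_increasing) (auto simp: multi_indices_def)
            finally show "\<bar>a \<alpha> * monom_fun \<alpha> x\<bar> \<le> \<epsilon> powr b' * (1 + norm x) ^ Suc l"
              unfolding abs_mult using small \<alpha> by (intro mult_mono) auto
          qed
          also have "\<dots> = real (card (multi_indices (Suc l) - {\<lambda>_ :: 'd. 0})) *
              (\<epsilon> powr b' * (1 + norm x) ^ Suc l)" by simp
          also have "\<dots> \<le> N * (\<epsilon> powr b' * (1 + norm x) ^ Suc l)"
            unfolding N_def by (intro mult_right_mono of_nat_mono card_mono) auto
          finally show ?thesis .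
        qed
        ultimately have "1 - \<epsilon> \<le> N * (\<epsilon> powr b' * (1 + norm x) ^ Suc l)" using a0 x by linarith
        then have "1 \<le> 2 * N * \<epsilon> powr b' * (1 + norm x) ^ Suc l" using \<open>\<epsilon> \<le> 1/2\<close> by simp
        then have "1 \<le> (2 * N * \<epsilon> powr b' * (1 + norm x) ^ Suc l) powr s" using s
          by (intro ge_one_powr_ge_zero) auto
        also have "\<dots> = (2 * N * \<epsilon> powr b') powr s * ((1 + norm x) ^ Suc l) powr s"
          using N by (intro powr_mult)
        also have "((1 + norm x) ^ Suc l) powr s = (1 + norm x) powr contr_exp"
        proof -
          have "(1 + norm x) ^ Suc l = (1 + norm x) powr real (Suc l)"
            by (rule powr_realpow[symmetric]) (simp add: add_pos_nonneg)
          then show ?thesis by (simp only: powr_powr) (simp add: s_def)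
        qed
        finally show ?thesis .
      qed
      let ?A = "{x. \<bar>poly_eval (Suc l) a x\<bar> \<le> \<epsilon>}"
      have [measurable]: "?A \<in> sets borel" by measurable
      have "measure \<sigma> ?A = (\<integral>x. indicator ?A x \<partial>\<sigma>)" by simp
      also have "\<dots> \<le> (\<integral>x. (2 * N * \<epsilon> powr b') powr s * (1 + norm x) powr contr_exp \<partial>\<sigma>)"
      proof (rule Bochner_Integration.integral_mono)
        show "indicator ?A x \<le> (2 * N * \<epsilon> powr b') powr s * (1 + norm x) powr contr_exp" for x
          using sub[of x] by (auto split: split_indicator)
      qed (use integrable_one_plus_norm_powr[of contr_exp] contr_exp in
          \<open>auto simp: less_top[symmetric]\<close>)
      also have "\<dots> = M * (2 * N) powr s * \<epsilon> powr (b' * s)"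
        using N by (simp add: M_def powr_mult powr_powr)
      also have "\<dots> \<le> C * \<epsilon> powr c"
        using \<epsilon> \<epsilon>1 C1 M by (intro mult_mono powr_mono') (auto simp: C_def c_def)
      finally show ?thesis .
    qed
  qed
  have "measure \<sigma> {x. \<bar>poly_eval (Suc l) a x\<bar> \<le> \<epsilon>} \<le> C * \<epsilon> powr c"
    if a: "\<exists>\<alpha>\<in>multi_indices (Suc l). 1 \<le> \<bar>a \<alpha>\<bar>" and \<epsilon>: "0 < \<epsilon>" for a \<epsilon>
  proof -
    define m where "m = Max ((\<lambda>\<alpha>. \<bar>a \<alpha>\<bar>) ` multi_indices (Suc l))"
    have m_ge: "\<bar>a \<alpha>\<bar> \<le> m" if "\<alpha> \<in> multi_indices (Suc l)" for \<alpha> unfolding m_def using that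
      by (intro Max_ge) auto
    have m1: "1 \<le> m" using a m_ge by force
    have "m \<in> (\<lambda>\<alpha>. \<bar>a \<alpha>\<bar>) ` multi_indices (Suc l)" unfolding m_def using a by (intro Max_in) auto
    then have ex: "\<exists>\<alpha>\<in>multi_indices (Suc l). \<bar>1 / m * a \<alpha>\<bar> = 1" using m1 by (auto simp: abs_mult)
    have "measure \<sigma> {x. \<bar>poly_eval (Suc l) a x\<bar> \<le> \<epsilon>}
        \<le> measure \<sigma> {x. \<bar>poly_eval (Suc l) (\<lambda>\<alpha>. 1 / m * a \<alpha>) x\<bar> \<le> \<epsilon>}"
    proof (rule sig.finite_measure_mono)
      show "{x. \<bar>poly_eval (Suc l) a x\<bar> \<le> \<epsilon>} \<subseteq> {x. \<bar>poly_eval (Suc l) (\<lambda>\<alpha>. 1 / m * a \<alpha>) x\<bar> \<le> \<epsilon>}"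
      proof (intro subsetI CollectI)
        fix x assume "x \<in> {x. \<bar>poly_eval (Suc l) a x\<bar> \<le> \<epsilon>}"
        then have x: "\<bar>poly_eval (Suc l) a x\<bar> \<le> \<epsilon>" by simp
        have "\<bar>poly_eval (Suc l) (\<lambda>\<alpha>. 1 / m * a \<alpha>) x\<bar> = 1 / m * \<bar>poly_eval (Suc l) a x\<bar>"
          unfolding poly_eval_scale using m1 by (simp add: abs_mult)
        also have "\<dots> \<le> 1 * \<bar>poly_eval (Suc l) a x\<bar>" using m1 by (intro mult_right_mono) auto
        finally show "\<bar>poly_eval (Suc l) (\<lambda>\<alpha>. 1 / m * a \<alpha>) x\<bar> \<le> \<epsilon>" using x by simp
      qed
    qed measurable
    also have "\<dots> \<le> C * \<epsilon> powr c"
    proof (rule norm1[OF _ ex \<epsilon>])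
      show "\<forall>\<alpha>\<in>multi_indices (Suc l). \<bar>1 / m * a \<alpha>\<bar> \<le> 1" using m_ge m1 by (auto simp: abs_mult)
    qed
    finally show ?thesis .
  qed
  then show ?case using C c by blast
qed

end

section \<open>Transfer from the group of similarities\<close>

text \<open>
  The parameters of a similarity, as in the inverse map in \<open>sim_plus_homeomorphism\<close>.
\<close>

definition sim_param_of :: "(real^'d \<Rightarrow> real^'d) \<Rightarrow> ('d::finite) sim_param" where
  "sim_param_of \<phi> = (norm (\<phi> (axis undefined 1) - \<phi> 0),
     \<chi> i j. (\<phi> (axis j 1) - \<phi> 0) $ i / norm (\<phi> (axis undefined 1) - \<phi> 0), \<phi> 0)"

lemma sim_param_of:
  fixes \<phi> :: "real^'d \<Rightarrow> real^'d::finite"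
  assumes "\<phi> \<in> sim_plus"
  shows "sim_apply (sim_param_of \<phi>) = \<phi>" and "proper_param (sim_param_of \<phi>)"
    and "fst (sim_param_of \<phi>) = sim_ratio \<phi>" and "snd (snd (sim_param_of \<phi>)) = sim_trans \<phi>"
proof -
  have "sim_param_of \<phi> \<in> {0<..} \<times> {Q. rotation_matrix Q} \<times> UNIV"
    and inv: "(\<lambda>(r, Q, b). sim_map r Q b) (sim_param_of \<phi>) = \<phi>"
    using sim_plus_homeomorphism[of "undefined :: 'd"] assms
    unfolding homeomorphism_def sim_param_of_def by blast+
  then obtain r Q b where z: "sim_param_of \<phi> = (r, Q, b)" and rQ: "0 < r" "rotation_matrix Q"
    by auto
  have \<phi>: "\<phi> = sim_map r Q b" using inv z by simp
  show "sim_apply (sim_param_of \<phi>) = \<phi>" by (simp add: z sim_apply_def \<phi>[symmetric])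
  show "proper_param (sim_param_of \<phi>)" using rQ
    by (simp add: z proper_param_def rotation_matrix_def)
  show "fst (sim_param_of \<phi>) = sim_ratio \<phi>" unfolding z using rQ by (simp add: \<phi>)
  show "snd (snd (sim_param_of \<phi>)) = sim_trans \<phi>" unfolding z using rQ by (simp add: \<phi>)
qed

lemma sim_param_of_measurable:
  "sim_param_of \<in> borel_measurable
      (restrict_space borel (sim_plus :: (real^'d \<Rightarrow> real^'d::finite) set))"
proof (rule borel_measurable_continuous_on_restrict)
  show "continuous_on (sim_plus :: (real^'d \<Rightarrow> real^'d) set) sim_param_of"
    using sim_plus_homeomorphism[of "undefined :: 'd"]
    unfolding homeomorphism_def sim_param_of_def by blast
qed

text \<open>
  A closed condition that holds almost surely holds on the support. That the support has full
  measure is not needed.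
\<close>

lemma sim_supp_subset_closed:
  assumes \<Lambda>: "sim_prob_measure \<Lambda>" and D: "closed D" and AE: "AE \<phi> in \<Lambda>. \<phi> \<in> D"
  shows "sim_supp \<Lambda> \<subseteq> D"
proof (rule ccontr)
  assume "\<not> sim_supp \<Lambda> \<subseteq> D"
  then obtain \<phi> where \<phi>: "\<phi> \<in> sim_supp \<Lambda>" "\<phi> \<notin> D" by blast
  have "0 < emeasure \<Lambda> (- D \<inter> sim_plus)"
    using \<phi> D unfolding sim_supp_def by auto
  moreover have "- D \<inter> sim_plus \<in> null_sets \<Lambda>"
  proof -
    have "- D \<inter> sim_plus \<in> sets (restrict_space borel sim_plus)"
      using D by (auto simp: sets_restrict_space image_iff intro!: bexI[of _ "- D"] borel_open)
    then have "- D \<inter> sim_plus \<in> sets \<Lambda>" using \<Lambda> by (simp add: sim_prob_measure_def)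
    moreover have "AE \<phi> in \<Lambda>. \<phi> \<notin> - D \<inter> sim_plus" using AE by eventually_elim auto
    ultimately show ?thesis by (subst AE_iff_null_sets) auto
  qed
  ultimately show False by (simp add: null_sets_def)
qed

text \<open>
  A subspace that almost every similarity maps into itself is mapped into itself by every
  similarity in the support, because the condition is closed, and onto itself, for reasons of
  dimension.
\<close>

lemma irreducible_stationary_distr:
  fixes \<Lambda> :: "(real^'d \<Rightarrow> real^'d::finite) measure" and \<sigma> :: "(real^'d) measure"
  assumes \<Lambda>: "sim_prob_measure \<Lambda>" and irred: "irreducible_sim \<Lambda>" and moment: "finite_exp_moment \<Lambda>"
    and \<sigma>: "prob_space \<sigma>" "sets \<sigma> = sets borel" and stat: "stationary \<Lambda> \<sigma>"
  shows "irreducible_stationary (distr \<Lambda> borel sim_param_of) \<sigma>"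
proof -
  let ?\<mu> = "distr \<Lambda> borel (sim_param_of :: _ \<Rightarrow> 'd sim_param)"
  interpret L: prob_space \<Lambda> using \<Lambda> by (simp add: sim_prob_measure_def)
  interpret sig: prob_space \<sigma> by fact
  have sets: "sets \<Lambda> = sets (restrict_space borel sim_plus)" using \<Lambda>
    by (simp add: sim_prob_measure_def)
  have space: "space \<Lambda> = sim_plus"
    using sets_eq_imp_space_eq[OF sets] by (simp add: space_restrict_space)
  have meas [measurable]: "sim_param_of \<in> borel_measurable \<Lambda>"
    using sim_param_of_measurable sets by (simp cong: measurable_cong_sets)
  interpret M: prob_space ?\<mu> by (rule L.prob_space_distr) measurable
  show ?thesis
  proof unfold_locales
    show "sets ?\<mu> = sets borel" by simp
    show "AE z in ?\<mu>. proper_param z"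
      by (subst AE_distr_iff) (auto simp: space intro!: AE_I2 sim_param_of(2))
    show "sets \<sigma> = sets borel" by fact
    show "emeasure \<sigma> A = (\<integral>\<^sup>+z. emeasure \<sigma> (sim_apply z -` A) \<partial>?\<mu>)" if A: "A \<in> sets borel" for A
    proof -
      have "emeasure \<sigma> A = (\<integral>\<^sup>+\<phi>. emeasure (distr \<sigma> borel \<phi>) A \<partial>\<Lambda>)"
        using stat A by (simp add: stationary_def)
      also have "\<dots> = (\<integral>\<^sup>+\<phi>. emeasure \<sigma> (sim_apply (sim_param_of \<phi>) -` A) \<partial>\<Lambda>)"
      proof (rule nn_integral_cong)
        fix \<phi> assume "\<phi> \<in> space \<Lambda>"
        then have \<phi>: "sim_apply (sim_param_of \<phi>) = \<phi>" by (simp add: space sim_param_of)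
        have "\<phi> \<in> borel \<rightarrow>\<^sub>M borel"
          using borel_measurable_continuous_onI[OF continuous_sim_apply_right, of "sim_param_of \<phi>"]
            by (simp add: \<phi>)
        then have "\<phi> \<in> \<sigma> \<rightarrow>\<^sub>M borel" using \<sigma>(2) by (simp cong: measurable_cong_sets)
        then show "emeasure (distr \<sigma> borel \<phi>) A = emeasure \<sigma> (sim_apply (sim_param_of \<phi>) -` A)"
          using A by (simp add: emeasure_distr \<phi> space_eq_UNIV[OF \<sigma>(2)])
      qed
      also have "\<dots> = (\<integral>\<^sup>+z. emeasure \<sigma> (sim_apply z -` A) \<partial>?\<mu>)"
        using emeasure_vimage_sim_apply_measurable[OF \<sigma> A]
        by (subst nn_integral_distr) auto
      finally show ?thesis .
    qed
    show "\<exists>\<epsilon>>0. (\<integral>\<^sup>+z. ennreal (fst z powr \<epsilon> + fst z powr (-\<epsilon>) + norm (snd (snd z)) powr \<epsilon>) \<partial>?\<mu>)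
        < \<infinity>"
    proof -
      obtain \<epsilon> where \<epsilon>: "\<epsilon> > 0"
          "(\<integral>\<^sup>+\<phi>. ennreal (sim_ratio \<phi> powr \<epsilon> + sim_ratio \<phi> powr (-\<epsilon>) + norm (sim_trans \<phi>) powr \<epsilon>)
          \<partial>\<Lambda>) < \<infinity>"
        using moment by (auto simp: finite_exp_moment_def)
      have "(\<integral>\<^sup>+z. ennreal (fst z powr \<epsilon> + fst z powr (-\<epsilon>) + norm (snd (snd z)) powr \<epsilon>) \<partial>?\<mu>) =
        (\<integral>\<^sup>+\<phi>. ennreal (fst (sim_param_of \<phi>) powr \<epsilon> + fst (sim_param_of \<phi>) powr (-\<epsilon>)
            + norm (snd (snd (sim_param_of \<phi>))) powr \<epsilon>) \<partial>\<Lambda>)"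
        by (rule nn_integral_distr) measurable
      also have "\<dots> = (\<integral>\<^sup>+\<phi>. ennreal (sim_ratio \<phi> powr \<epsilon> + sim_ratio \<phi> powr (-\<epsilon>)
          + norm (sim_trans \<phi>) powr \<epsilon>) \<partial>\<Lambda>)"
        by (rule nn_integral_cong) (simp add: space sim_param_of)
      finally show ?thesis using \<epsilon> by auto
    qed
    fix E :: "(real^'d) set"
    assume E: "affine E" "E \<noteq> {}" and AE: "AE z in ?\<mu>. sim_apply z ` E \<subseteq> E"
    have "AE \<phi> in \<Lambda>. sim_apply (sim_param_of \<phi>) ` E \<subseteq> E"
      by (rule AE_distrD[OF meas AE])
    moreover have "AE \<phi> in \<Lambda>. \<phi> \<in> sim_plus" using AE_space[of \<Lambda>] by (simp add: space)
    ultimately have AE': "AE \<phi> in \<Lambda>. \<phi> \<in> {\<phi>. \<forall>x\<in>E. \<phi> x \<in> E}"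
      by eventually_elim (auto simp: sim_param_of)
    have "closed {\<phi> :: real^'d \<Rightarrow> real^'d. \<forall>x\<in>E. \<phi> x \<in> E}"
    proof -
      have "closed ((\<lambda>\<phi> :: real^'d \<Rightarrow> real^'d. \<phi> x) -` E)" for x
        by (rule closed_vimage[OF affine_closed[OF E(1)] continuous_on_product_coordinates])
      then have "closed (\<Inter>x\<in>E. (\<lambda>\<phi> :: real^'d \<Rightarrow> real^'d. \<phi> x) -` E)" by blast
      also have "(\<Inter>x\<in>E. (\<lambda>\<phi> :: real^'d \<Rightarrow> real^'d. \<phi> x) -` E) = {\<phi>. \<forall>x\<in>E. \<phi> x \<in> E}" by auto
      finally show ?thesis .
    qed
    from sim_supp_subset_closed[OF \<Lambda> this AE'] have sub: "\<phi> ` E \<subseteq> E" if "\<phi> \<in> sim_supp \<Lambda>" for \<phi>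
      using that by blast
    have "\<phi> ` E = E" if \<phi>: "\<phi> \<in> sim_supp \<Lambda>" for \<phi>
    proof -
      have pl: "\<phi> \<in> sim_plus" using \<phi> by (simp add: sim_supp_def)
      define z where "z = sim_param_of \<phi>"
      have z: "proper_param z" "sim_apply z = \<phi>" using sim_param_of[OF pl] by (auto simp: z_def)
      have im: "\<phi> ` (\<phi> -` E) = E"
        using bij_sim_apply[OF z(1)] by (simp add: z surj_image_vimage_eq bij_is_surj)
      have "aff_dim (\<phi> -` E) = aff_dim E"
        using aff_dim_sim_apply_image[OF z(1), of "\<phi> -` E"] im by (simp add: z)
      moreover have "affine (\<phi> -` E)" using affine_sim_apply_vimage[OF E(1), of z] by (simp add: z)
      moreover have "E \<subseteq> \<phi> -` E" using sub[OF \<phi>] by auto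
      ultimately have "E = \<phi> -` E" using E by (intro affine_dim_equal) auto
      then show ?thesis using im by simp
    qed
    then show "E = UNIV" using irred E by (simp add: irreducible_sim_def)
  qed
qed

lemma poly_space_eval:
  assumes P: "P \<in> poly_space l" and nz: "P \<noteq> (\<lambda>s. 0)"
  obtains a where "P = poly_eval l a" "0 < poly_norm P" "\<exists>\<alpha>\<in>multi_indices l. \<bar>a \<alpha>\<bar> = poly_norm P"
proof -
  obtain a where a: "has_coeffs P a" and deg: "\<And>\<alpha>. a \<alpha> \<noteq> 0 \<Longrightarrow> sum \<alpha> UNIV \<le> l"
    using P by (auto simp: poly_space_def)
  have fin: "finite {\<alpha>. a \<alpha> \<noteq> 0}" and Pa: "P = (\<lambda>s. \<Sum>\<alpha> | a \<alpha> \<noteq> 0. a \<alpha> * monom_fun \<alpha> s)"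
    using a by (auto simp: has_coeffs_def monom_fun_def)
  have "{\<alpha>. a \<alpha> \<noteq> 0} \<subseteq> multi_indices l" using deg by (auto simp: multi_indices_def)
  then have "P = poly_eval l a"
    unfolding Pa poly_eval_def by (intro ext sum.mono_neutral_left) auto
  have ne: "{\<alpha>. a \<alpha> \<noteq> 0} \<noteq> {}" using nz unfolding Pa by (auto simp del: Collect_empty_eq)
  define A where "A = (\<lambda>\<alpha>. \<bar>a \<alpha>\<bar>) ` {\<alpha>. a \<alpha> \<noteq> 0}"
  have "Max A \<in> A" unfolding A_def using fin ne by (intro Max_in) auto
  then obtain \<alpha> where \<alpha>: "a \<alpha> \<noteq> 0" "Max A = \<bar>a \<alpha>\<bar>" unfolding A_def by auto
  have le: "\<bar>a \<beta>\<bar> \<le> \<bar>a \<alpha>\<bar>" for \<beta>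
  proof (cases "a \<beta> = 0")
    case False
    then have "\<bar>a \<beta>\<bar> \<le> Max A" unfolding A_def using fin by (intro Max_ge) auto
    then show ?thesis using \<alpha> by simp
  qed simp
  have "poly_norm P = \<bar>a \<alpha>\<bar>"
    unfolding poly_norm_def poly_coeffs_eq[OF a] by (rule cSup_eq_maximum) (use le in auto)
  then show ?thesis
    using that[OF \<open>P = poly_eval l a\<close>] \<alpha> deg by (auto simp: multi_indices_def)
qed

theorem theorem4p4:
  fixes \<Lambda> :: "(real^'d \<Rightarrow> real^'d) measure"
    and \<sigma> :: "(real^'d) measure"
    and l :: nat
  assumes "sim_prob_measure \<Lambda>"
    and "irreducible_sim \<Lambda>"
    and "finite_exp_moment \<Lambda>"
    and "prob_space \<sigma>"
    and "sets \<sigma> = sets borel"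
    and "stationary \<Lambda> \<sigma>"
  shows "\<exists>C>0. \<exists>c>0. \<forall>P\<in>poly_space l. P \<noteq> (\<lambda>s. 0) \<longrightarrow>
    (\<forall>\<epsilon>>0. measure \<sigma> {s. \<bar>P s\<bar> \<le> \<epsilon> * poly_norm P} \<le> C * \<epsilon> powr c)"
proof -
  interpret irreducible_stationary "distr \<Lambda> borel sim_param_of" \<sigma>
    by (rule irreducible_stationary_distr) fact+
  obtain C c where Cc: "0 < C" "0 < c" and decay: "\<And>a \<epsilon>. \<exists>\<alpha>\<in>multi_indices l. 1 \<le> \<bar>a \<alpha>\<bar> \<Longrightarrow> 0 < \<epsilon> \<Longrightarrow>
     measure \<sigma> {x. \<bar>poly_eval l a x\<bar> \<le> \<epsilon>} \<le> C * \<epsilon> powr c"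
    using poly_decay_normalized[of l] by metis
  have "measure \<sigma> {s. \<bar>P s\<bar> \<le> \<epsilon> * poly_norm P} \<le> C * \<epsilon> powr c"
    if P: "P \<in> poly_space l" "P \<noteq> (\<lambda>s. 0)" and \<epsilon>: "0 < \<epsilon>" for P \<epsilon>
  proof -
    obtain a where a: "P = poly_eval l a" and pos: "0 < poly_norm P"
        and ex: "\<exists>\<alpha>\<in>multi_indices l. \<bar>a \<alpha>\<bar> = poly_norm P"
      using poly_space_eval[OF P] .
    define N where "N = poly_norm P"
    have "{s. \<bar>P s\<bar> \<le> \<epsilon> * N} = {s. \<bar>poly_eval l (\<lambda>\<alpha>. 1 / N * a \<alpha>) s\<bar> \<le> \<epsilon>}"
      unfolding a poly_eval_scale using pos by (auto simp: N_def abs_mult field_simps)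
    also have "measure \<sigma> \<dots> \<le> C * \<epsilon> powr c"
    proof (rule decay[OF _ \<epsilon>])
      obtain \<alpha> where "\<alpha> \<in> multi_indices l" "\<bar>a \<alpha>\<bar> = N" using ex by (auto simp: N_def)
      then show "\<exists>\<alpha>\<in>multi_indices l. 1 \<le> \<bar>1 / N * a \<alpha>\<bar>"
        using pos by (intro bexI[of _ \<alpha>]) (auto simp: N_def abs_mult)
    qed
    finally show ?thesis unfolding N_def .
  qed
  then show ?thesis using Cc by blast
qed

end
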